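(* Let $A,B$ be $n\times n$ complex Hermitian matrices with $A\ge 0$ (positive semidefinite) and $B>0$ (positive definite). Then $$A(\log A-\log B)-B\,D\log[B](A)+B=\int_{-\infty}^{\infty}\frac{dt}{|t|(t-1)^2}\,\big((1-t)A+tB\big)_-.$$
   Context: For a Hermitian matrix $T$, $\{T>0\}$ denotes the orthogonal projection onto the span of the eigenvectors of $T$ with positive eigenvalues; $T_+=T\{T>0\}$ and $T_-=-T\{-T>0\}$, so $T=T_+-T_-$ with $T_\pm\ge 0$. For $B>0$ and $A$ Hermitian, $D\log[B](A)=\lim_{t\to0}\frac{\log(B+tA)-\log B}{t}$ is the derivative of the matrix logarithm at $B$ in direction $A$. For singular $A\ge 0$, $A\log A$ is defined by functional calculus with $0\log 0=0$. The integral of the matrix-valued function is an entrywise (improper) integral; for $A,B\ge 0$ the integrand vanishes for $t\in[0,1]$ (and is taken to be $0$ at $t=0,1$). *)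

theory Defs
  imports "HOL-Analysis.Analysis"
begin

section \<open>Hermitian matrices\<close>

definition cadjoint :: "complex^'n^'m \<Rightarrow> complex^'m^'n" where
  "cadjoint A = (\<chi> i j. cnj (A $ j $ i))"

definition hermitian :: "complex^'n^'n \<Rightarrow> bool" where
  "hermitian A \<longleftrightarrow> cadjoint A = A"

text \<open>On \<^typ>\<open>complex^'n\<close> the library's inner product is real-valued: \<^term>\<open>v \<bullet> w\<close> is the real
  part of the Hermitian inner product of \<^term>\<open>v\<close> and \<^term>\<open>w\<close>. For Hermitian \<^term>\<open>A\<close> the
  quadratic form is real, so nothing is lost below.\<close>

definition positive_semidefinite :: "complex^'n^'n \<Rightarrow> bool" where
  "positive_semidefinite A \<longleftrightarrow> hermitian A \<and> (\<forall>v. 0 \<le> v \<bullet> (A *v v))"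

definition positive_definite :: "complex^'n^'n \<Rightarrow> bool" where
  "positive_definite A \<longleftrightarrow> hermitian A \<and> (\<forall>v. v \<noteq> 0 \<longrightarrow> 0 < v \<bullet> (A *v v))"

section \<open>Spectral notions\<close>

text \<open>The matrix of the orthogonal projection onto a complex subspace \<^term>\<open>S\<close>: the unique
  Hermitian idempotent with range \<^term>\<open>S\<close>.\<close>

definition orth_proj :: "(complex^'n) set \<Rightarrow> complex^'n^'n" where
  "orth_proj S = (THE P. hermitian P \<and> P ** P = P \<and> range ((*v) P) = S)"

definition eigenspace :: "complex^'n^'n \<Rightarrow> real \<Rightarrow> (complex^'n) set" where
  "eigenspace T x = {v. T *v v = complex_of_real x *s v}"

text \<open>Only real eigenvalues are considered, which for Hermitian matrices are all of them.\<close>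

definition eigenvalues :: "complex^'n^'n \<Rightarrow> real set" where
  "eigenvalues T = {x. \<exists>v\<in>eigenspace T x. v \<noteq> 0}"

text \<open>Functional calculus for Hermitian \<^term>\<open>T\<close>, via the spectral decomposition of \<^term>\<open>T\<close>.\<close>

definition mat_fun :: "(real \<Rightarrow> real) \<Rightarrow> complex^'n^'n \<Rightarrow> complex^'n^'n" where
  "mat_fun f T = (\<Sum>x\<in>eigenvalues T. f x *\<^sub>R orth_proj (eigenspace T x))"

definition mat_log :: "complex^'n^'n \<Rightarrow> complex^'n^'n" where
  "mat_log = mat_fun ln"

text \<open>The matrix \<open>A log A\<close>, defined also for singular \<open>A \<ge> 0\<close>, with \<open>0 log 0 = 0\<close>.\<close>

definition mat_xlogx :: "complex^'n^'n \<Rightarrow> complex^'n^'n" where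
  "mat_xlogx = mat_fun (\<lambda>x. x * ln x)"

definition Dlog :: "complex^'n^'n \<Rightarrow> complex^'n^'n \<Rightarrow> complex^'n^'n" where
  "Dlog B A = Lim (at 0) (\<lambda>t::real. (1 / t) *\<^sub>R (mat_log (B + t *\<^sub>R A) - mat_log B))"

text \<open>The projection \<open>{T > 0}\<close>; \<^term>\<open>vec.span\<close> is the complex linear span.\<close>

definition pos_proj :: "complex^'n^'n \<Rightarrow> complex^'n^'n" where
  "pos_proj T = orth_proj (vec.span {v. v \<noteq> 0 \<and> (\<exists>x>0. v \<in> eigenspace T x)})"

definition neg_part :: "complex^'n^'n \<Rightarrow> complex^'n^'n" where
  "neg_part T = - (T ** pos_proj (- T))"

section \<open>The integrand\<close>

text \<open>At \<open>t = 0\<close> and \<open>t = 1\<close> the value is \<open>0\<close>, since division by zero yields zero.\<close>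

definition frenkel_integrand ::
    "complex^'n^'n \<Rightarrow> complex^'n^'n \<Rightarrow> real \<Rightarrow> complex^'n^'n" where
  "frenkel_integrand A B t =
     (1 / (\<bar>t\<bar> * (t - 1)\<^sup>2)) *\<^sub>R neg_part ((1 - t) *\<^sub>R A + t *\<^sub>R B)"

end

theory Submission
  imports Defs "HOL-Real_Asymp.Real_Asymp"
begin

text \<open>Let \<open>f(x) = x log x\<close>. In an eigenbasis of \<open>B\<close> one sees that \<open>A log B + B Dlog[B](A) = Df[B](A)\<close>, and
  \<open>Df[B](B) = f(B) + B\<close>, so the left-hand side is the first-order remainder \<open>f(A) - f(B) - Df[B](A - B)\<close>.

  It is the gradient in \<open>A\<close> of the second-order remainder
  \<open>R(A) = Tr F(A) - Tr F(B) - Tr f(B)(A - B) - 1/2 Tr (A - B) Df[B](A - B)\<close> with \<open>F' = f\<close>, while the right-hand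
  side is the gradient of \<open>\<integral> Tr (T\<^sub>t)\<^sub>-\<^sup>2 / (2 \<bar>t\<bar> (t - 1)\<^sup>3) dt\<close> with \<open>T\<^sub>t = (1 - t) A + t B\<close>. Hence for \<open>A > 0\<close>
  it suffices to prove the scalar identity between these two; singular \<open>A\<close> follow by dominated convergence.

  Writing \<open>x\<^sub>-\<^sup>2 / 2 = \<integral> \<tau> [x + \<tau> \<le> 0] d\<tau>\<close> over \<open>\<tau> \<ge> 0\<close> and using \<open>T\<^sub>t + \<tau> = (1 - t) (A + \<tau>) + t (B + \<tau>)\<close>, Fubini's
  theorem reduces it to counting the nonpositive eigenvalues of a pencil. By Sylvester's law of inertia
  these are read off from the eigenvalues \<open>s\<^sub>k\<close> of \<open>(B + \<tau>)\<^sup>-\<^sup>1\<^sup>/\<^sup>2 (A + \<tau>) (B + \<tau>)\<^sup>-\<^sup>1\<^sup>/\<^sup>2\<close>, and the \<open>t\<close>-integral becomes the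
  sum of \<open>log s\<^sub>k - (s\<^sub>k - 1) + (s\<^sub>k - 1)\<^sup>2 / 2\<close>, an expression in traces and determinants which is exactly the second
  \<open>\<tau>\<close>-derivative of the remainder \<open>R\<close> for the pair \<open>A + \<tau>, B + \<tau>\<close>.\<close>

section \<open>Hermitian inner product and orthonormal bases\<close>


text \<open>The detour through traces is forced by noncommutativity: eigenvectors of (1 - t) A + t B
  do not come from those of A and B, so the matrix integrand resists direct integration, whereas the
  trace of a function of that matrix depends only on eigenvalue counts, whose signs are invariant
  under congruence. The square is chosen because x_-^2 / 2 has the 1-Lipschitz derivative -x_-.
  Gradients can therefore be read off from first-order expansions with quadratic error, obtained by
  pushing scalar inequalities through double sums over two eigenbases; no perturbation theory of
  eigenvalues is involved. The segment depends on A with coefficient 1 - t, so the gradient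
  contributes a factor t - 1: this is why the scalar weight has a cube where the matrix integrand
  has a square. Removing two Taylor orders serves convergence: as \<tau> grows, the primitives in
  \<tau> diverge like quadratic polynomials in the eigenvalues, and the identities for Tr A and Tr
  A^2 cancel precisely these terms.\<close>

definition cip :: "complex^'n \<Rightarrow> complex^'n \<Rightarrow> complex" where
  "cip v w = (\<Sum>i\<in>UNIV. v $ i * cnj (w $ i))"

definition rank1 :: "complex^'n \<Rightarrow> complex^'n^'n" where
  "rank1 v = (\<chi> i j. v $ i * cnj (v $ j))"

lemma cip_add_left: "cip (v + w) x = cip v x + cip w x"
  by (simp add: cip_def algebra_simps sum.distrib)

lemma cip_add_right: "cip x (v + w) = cip x v + cip x w"
  by (simp add: cip_def algebra_simps sum.distrib)

lemma cip_diff_left: "cip (v - w) x = cip v x - cip w x"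
  by (simp add: cip_def algebra_simps sum_subtractf)

lemma cip_scale_left [simp]: "cip (c *s v) x = c * cip v x"
  by (simp add: cip_def sum_distrib_left algebra_simps)

lemma cip_scale_right [simp]: "cip x (c *s v) = cnj c * cip x v"
  by (simp add: cip_def sum_distrib_left algebra_simps)

lemma cip_zero [simp]: "cip 0 v = 0" "cip v 0 = 0"
  by (simp_all add: cip_def)

lemma cip_sum_left: "cip (\<Sum>i\<in>I. f i) x = (\<Sum>i\<in>I. cip (f i) x)"
  by (induction I rule: infinite_finite_induct) (simp_all add: cip_add_left)

lemma cip_sum_right: "cip x (\<Sum>i\<in>I. f i) = (\<Sum>i\<in>I. cip x (f i))"
  by (induction I rule: infinite_finite_induct) (simp_all add: cip_add_right)

lemma cnj_cip: "cnj (cip v w) = cip w v"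
  by (simp add: cip_def mult.commute)

lemma inner_eq_Re_cip: "v \<bullet> w = Re (cip v w)"
  by (simp add: inner_vec_def cip_def inner_complex_def)

lemma cip_self: "cip v v = complex_of_real ((norm v)\<^sup>2)"
proof -
  have "Im (cip v v) = 0"
    using cnj_cip[of v v] by (simp add: complex_eq_iff)
  moreover have "Re (cip v v) = (norm v)\<^sup>2"
    using inner_eq_Re_cip[of v v] by (simp add: power2_norm_eq_inner)
  ultimately show ?thesis by (simp add: complex_eq_iff)
qed

lemma cip_matrix_left: "cip (A *v v) w = cip v (cadjoint A *v w)"
proof -
  have "cip (A *v v) w = (\<Sum>i\<in>UNIV. \<Sum>j\<in>UNIV. A $ i $ j * v $ j * cnj (w $ i))"
    by (simp add: cip_def matrix_vector_mult_def sum_distrib_right)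
  also have "\<dots> = (\<Sum>j\<in>UNIV. \<Sum>i\<in>UNIV. A $ i $ j * v $ j * cnj (w $ i))"
    by (rule sum.swap)
  also have "\<dots> = cip v (cadjoint A *v w)"
    by (simp add: cip_def matrix_vector_mult_def cadjoint_def sum_distrib_left algebra_simps)
  finally show ?thesis .
qed

lemma cip_hermitian: "hermitian A \<Longrightarrow> cip (A *v v) w = cip v (A *v w)"
  by (metis cip_matrix_left hermitian_def)

lemma inner_hermitian: "hermitian A \<Longrightarrow> (A *v v) \<bullet> w = v \<bullet> (A *v w)"
  by (simp add: inner_eq_Re_cip cip_hermitian)

lemma scaleR_eq_scale: "r *\<^sub>R (v :: complex^'n) = complex_of_real r *s v"
  by (simp add: vec_eq_iff scaleR_conv_of_real[where 'a=complex])

lemma cadjoint_simps [simp]: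
  "cadjoint (A + B) = cadjoint A + cadjoint B"
  "cadjoint (A - B) = cadjoint A - cadjoint B"
  "cadjoint (- A) = - cadjoint A"
  "cadjoint 0 = 0"
  "cadjoint (r *\<^sub>R A) = r *\<^sub>R cadjoint A"
  "cadjoint (mat 1) = mat 1"
  "cadjoint (cadjoint A) = A"
  by (auto simp: cadjoint_def vec_eq_iff mat_def)

lemma cadjoint_mult: "cadjoint (A ** B) = cadjoint B ** cadjoint A"
  by (simp add: cadjoint_def matrix_matrix_mult_def vec_eq_iff mult.commute)

lemma cadjoint_sum: "cadjoint (\<Sum>i\<in>I. f i) = (\<Sum>i\<in>I. cadjoint (f i))"
  by (induction I rule: infinite_finite_induct) simp_all

lemma cadjoint_rank1 [simp]: "cadjoint (rank1 v) = rank1 v"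
  by (simp add: cadjoint_def rank1_def vec_eq_iff)

lemma hermitian_add: "hermitian A \<Longrightarrow> hermitian B \<Longrightarrow> hermitian (A + B)"
  and hermitian_diff: "hermitian A \<Longrightarrow> hermitian B \<Longrightarrow> hermitian (A - B)"
  and hermitian_scaleR: "hermitian A \<Longrightarrow> hermitian (r *\<^sub>R A)"
  and hermitian_mat_1: "hermitian (mat 1)"
  and hermitian_rank1: "hermitian (rank1 v)"
  by (simp_all add: hermitian_def)

lemma hermitian_sum: "(\<And>i. i \<in> I \<Longrightarrow> hermitian (f i)) \<Longrightarrow> hermitian (\<Sum>i\<in>I. f i)"
  by (simp add: hermitian_def cadjoint_sum)

lemma rank1_mult_vec: "rank1 v *v x = cip x v *s v"
  by (simp add: rank1_def matrix_vector_mult_def cip_def vec_eq_iff sum_distrib_right sum_distrib_left algebra_simps)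

lemma matrix_mult_scaleR: "(r *\<^sub>R A) ** B = r *\<^sub>R (A ** B)" "A ** (r *\<^sub>R B) = r *\<^sub>R (A ** B)"
  for A B :: "complex^'n^'n"
  by (simp_all add: matrix_matrix_mult_def vec_eq_iff scaleR_sum_right)

lemma matrix_add_rdistrib_c: "(A + B) ** C = A ** C + B ** C"
  for C :: "complex^'n^'n"
  by (simp add: matrix_matrix_mult_def vec_eq_iff algebra_simps sum.distrib)

lemma matrix_mult_sum_left: "(\<Sum>i\<in>I. f i) ** B = (\<Sum>i\<in>I. f i ** B)"
  for B :: "complex^'n^'n"
  by (induction I rule: infinite_finite_induct) (simp_all add: matrix_add_rdistrib_c)

lemma matrix_mult_sum_right: "B ** (\<Sum>i\<in>I. f i) = (\<Sum>i\<in>I. B ** f i)"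
  for B :: "complex^'n^'n"
  by (induction I rule: infinite_finite_induct) (simp_all add: matrix_add_ldistrib)

lemma sum_matrix_mult_vec: "(\<Sum>i\<in>I. f i) *v x = (\<Sum>i\<in>I. f i *v x)"
  for f :: "_ \<Rightarrow> complex^'n^'n"
  by (induction I rule: infinite_finite_induct) (simp_all add: matrix_vector_mult_add_rdistrib)

lemma scaleR_matrix_mult_vec: "(r *\<^sub>R A) *v x = complex_of_real r *s (A *v x)"
  for A :: "complex^'n^'n"
  by (simp add: matrix_vector_mult_def vec_eq_iff scaleR_conv_of_real[where 'a=complex] sum_distrib_left algebra_simps)

lemma matrix_vec_sum: "A *v (\<Sum>i\<in>I. f i) = (\<Sum>i\<in>I. A *v f i)"
  for A :: "complex^'n^'n"
  by (induction I rule: infinite_finite_induct) (simp_all add: matrix_vector_right_distrib)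

lemma matrix_vec_scale: "A *v (c *s x) = c *s (A *v x)"
  for A :: "complex^'n^'n"
  by (simp add: matrix_vector_mult_def vec_eq_iff sum_distrib_left algebra_simps)

section \<open>Orthonormal bases and the spectral theorem\<close>

definition onb :: "('n \<Rightarrow> complex^'n) \<Rightarrow> bool" where
  "onb u \<longleftrightarrow> (\<forall>i j. cip (u i) (u j) = (if i = j then 1 else 0))"

lemma onb_cip: "onb u \<Longrightarrow> cip (u i) (u j) = (if i = j then 1 else 0)"
  by (simp add: onb_def)

text \<open>The family is indexed by the coordinate type, so the matrix \<open>U\<close> with these
  columns is square: its adjoint is a left inverse by orthonormality, hence also a right inverse.
  This is why \<open>onb\<close> asks for orthonormality alone.\<close>

lemma onb_resolution:
  fixes u :: "'n \<Rightarrow> complex^'n"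
  assumes "onb u"
  shows "(\<Sum>i\<in>UNIV. rank1 (u i)) = mat 1"
proof -
  define U :: "complex^'n^'n" where "U = (\<chi> i j. u j $ i)"
  have "cadjoint U ** U = mat 1"
    using assms by (simp add: onb_def cip_def U_def cadjoint_def matrix_matrix_mult_def mat_def
        vec_eq_iff mult.commute)
  then have "U ** cadjoint U = mat 1"
    using matrix_left_right_inverse by blast
  then show ?thesis
    by (simp add: U_def cadjoint_def matrix_matrix_mult_def mat_def vec_eq_iff rank1_def)
qed

lemma onb_expand: "onb u \<Longrightarrow> x = (\<Sum>i\<in>UNIV. cip x (u i) *s u i)"
  using onb_resolution[of u] by (metis (no_types, lifting) matrix_vector_mul_lid rank1_mult_vec sum.cong sum_matrix_mult_vec)

lemma parseval:
  assumes "onb u"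
  shows "(\<Sum>i\<in>UNIV. (cmod (cip x (u i)))\<^sup>2) = (norm x)\<^sup>2"
proof -
  have "cip x x = cip x (\<Sum>i\<in>UNIV. cip x (u i) *s u i)"
    using onb_expand[OF assms, of x] by simp
  also have "\<dots> = (\<Sum>i\<in>UNIV. complex_of_real ((cmod (cip x (u i)))\<^sup>2))"
    by (simp add: cip_sum_right complex_norm_square mult.commute del: of_real_power)
  finally show ?thesis
    unfolding cip_self of_real_sum[symmetric] of_real_eq_iff by simp
qed

text \<open>The orthogonal complement \<open>W\<close> of the eigenvectors found so far is invariant
  under \<open>A\<close>, and a maximiser of the quadratic form on its unit sphere is an
  eigenvector. The family lives on a subset \<open>I\<close> of the final index type, which turns
  the construction of a basis into an induction over \<open>I\<close>.\<close>

lemma onb_extend: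
  fixes A :: "complex^'n^'n" and u :: "'n \<Rightarrow> complex^'n"
  assumes A: "hermitian A" and "I \<noteq> UNIV"
    and on: "\<And>i j. i \<in> I \<Longrightarrow> j \<in> I \<Longrightarrow> cip (u i) (u j) = (if i = j then 1 else 0)"
    and ev: "\<And>i. i \<in> I \<Longrightarrow> A *v u i = complex_of_real (a i) *s u i"
  obtains v l where "norm v = 1" "A *v v = complex_of_real l *s v" "\<And>i. i \<in> I \<Longrightarrow> cip v (u i) = 0"
proof -
  define W where "W = {v. \<forall>i\<in>I. cip v (u i) = 0}"
  have Wadd: "v + w \<in> W" if "v \<in> W" "w \<in> W" for v w
    using that by (simp add: W_def cip_add_left)
  have Wsc: "c *s v \<in> W" if "v \<in> W" for c v
    using that by (simp add: W_def)
  have WA: "A *v v \<in> W" if "v \<in> W" for v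
    using that by (simp add: W_def cip_hermitian[OF A] ev)
  have "finite (u ` I)" "card (u ` I) < CARD('n)"
  proof -
    have "card (u ` I) \<le> card I" by (rule card_image_le) simp
    also have "card I < CARD('n)" using assms(2) by (simp add: psubset_card_mono psubsetI)
    finally show "card (u ` I) < CARD('n)" .
  qed simp
  have "vec.span (u ` I) \<noteq> UNIV"
  proof
    assume "vec.span (u ` I) = UNIV"
    then have "vec.dim (UNIV :: (complex^'n) set) \<le> card (u ` I)"
      using \<open>finite (u ` I)\<close> by (metis vec.dim_span vec.dim_le_card' )
    then show False using \<open>card (u ` I) < CARD('n)\<close> by (metis vec_dim_card not_less)
  qed
  then obtain x where x: "x \<notin> vec.span (u ` I)" by blast
  \<comment> \<open>Gram-Schmidt residual: a nonzero element of \<open>W\<close>, so the unit sphere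
    of \<open>W\<close> is nonempty.\<close>
  define y where "y = x - (\<Sum>i\<in>I. cip x (u i) *s u i)"
  have "(\<Sum>i\<in>I. cip x (u i) *s u i) \<in> vec.span (u ` I)"
    by (intro vec.span_sum vec.span_scale vec.span_base) auto
  then have "y \<noteq> 0" using x y_def by auto
  have "cip y (u j) = 0" if "j \<in> I" for j
    using that by (simp add: y_def cip_diff_left cip_sum_left on if_distrib cong: if_cong sum.cong)
  then have "y \<in> W" by (simp add: W_def)
  define K where "K = W \<inter> sphere 0 1"
  have "(1 / norm y) *\<^sub>R y \<in> W"
    using \<open>y \<in> W\<close> Wsc unfolding scaleR_eq_scale by blast
  then have "(1 / norm y) *\<^sub>R y \<in> K"
    using \<open>y \<noteq> 0\<close> by (simp add: K_def)
  then have "K \<noteq> {}" by blast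
  moreover have "W = (\<Inter>i\<in>I. {v. cip v (u i) = 0})" by (auto simp: W_def)
  then have "closed W"
    by (auto simp: cip_def intro!: closed_INT closed_Collect_eq continuous_intros)
  then have "compact K" by (simp add: K_def closed_Int_compact)
  moreover have "continuous_on K (\<lambda>v. v \<bullet> (A *v v))"
    unfolding matrix_vector_mult_def by (intro continuous_intros)
  ultimately obtain v where v: "v \<in> K" and vmax: "\<And>w. w \<in> K \<Longrightarrow> w \<bullet> (A *v w) \<le> v \<bullet> (A *v v)"
    using continuous_attains_sup by metis
  define l where "l = v \<bullet> (A *v v)"
  have nv: "norm v = 1" and vW: "v \<in> W" using v by (auto simp: K_def)
  have le: "w \<bullet> (A *v w) \<le> l * (w \<bullet> w)" if "w \<in> W" for w
  proof (cases "w = 0")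
    case False
    define z where "z = (1 / norm w) *\<^sub>R w"
    have "z \<in> W" using that Wsc unfolding z_def scaleR_eq_scale by blast
    then have "z \<in> K" using False by (simp add: z_def K_def)
    then have "z \<bullet> (A *v z) \<le> l" using vmax l_def by blast
    moreover have "A *v z = (1 / norm w) *\<^sub>R (A *v w)"
      unfolding z_def scaleR_eq_scale matrix_vec_scale ..
    then have "z \<bullet> (A *v z) = (w \<bullet> (A *v w)) / (w \<bullet> w)"
      by (simp add: z_def power2_norm_eq_inner[symmetric] power2_eq_square)
    ultimately show ?thesis using False by (simp add: pos_divide_le_eq)
  qed simp
  define r where "r = A *v v - complex_of_real l *s v"
  have rW: "r \<in> W" using Wadd[OF WA[OF vW] Wsc[OF vW, of "- complex_of_real l"]] by (simp add: r_def)
  \<comment> \<open>The residual \<open>r\<close> lies in \<open>W\<close> and points uphill: moving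
    from \<open>v\<close> by \<open>e *\<^sub>R r\<close> raises the form minus \<open>l\<close>
    times the squared norm by 2 e |r|^2 to first order, which is impossible at a maximum.\<close>
  have "r \<bullet> r = 0"
  proof (rule ccontr)
    assume "r \<bullet> r \<noteq> 0"
    then have rp: "r \<bullet> r > 0" by simp
    have key: "2 * e * (r \<bullet> r) + e\<^sup>2 * (r \<bullet> (A *v r) - l * (r \<bullet> r)) \<le> 0" for e :: real
    proof -
      have "v + e *\<^sub>R r \<in> W" using vW rW Wadd Wsc by (simp add: scaleR_eq_scale)
      note le0 = le[OF this]
      have eq: "A *v (v + e *\<^sub>R r) = A *v v + e *\<^sub>R (A *v r)"
        by (simp add: matrix_vector_right_distrib scaleR_eq_scale matrix_vec_scale)
      have "v \<bullet> (A *v r) = r \<bullet> (A *v v)"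
        using inner_hermitian[OF A, of v r] by (simp add: inner_commute)
      then have "(v + e *\<^sub>R r) \<bullet> (A *v (v + e *\<^sub>R r)) = l + 2 * e * (r \<bullet> (A *v v)) + e\<^sup>2 * (r \<bullet> (A *v r))"
        unfolding eq by (simp add: inner_add_left inner_add_right l_def algebra_simps power2_eq_square)
      moreover have "(v + e *\<^sub>R r) \<bullet> (v + e *\<^sub>R r) = 1 + 2 * e * (r \<bullet> v) + e\<^sup>2 * (r \<bullet> r)"
        using nv by (simp add: inner_add_left inner_add_right norm_eq_sqrt_inner inner_commute[of v r]
            algebra_simps power2_eq_square)
      ultimately have "2 * e * (r \<bullet> (A *v v)) + e\<^sup>2 * (r \<bullet> (A *v r)) \<le> l * (2 * e * (r \<bullet> v)) + l * (e\<^sup>2 * (r \<bullet> r))"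
        using le0 by (simp add: distrib_left)
      moreover have "r \<bullet> r = r \<bullet> (A *v v) - l * (r \<bullet> v)"
        by (subst (2) r_def) (simp add: inner_diff_right scaleR_eq_scale[symmetric])
      then have "2 * e * (r \<bullet> r) = 2 * e * (r \<bullet> (A *v v)) - l * (2 * e * (r \<bullet> v))"
        by (simp only:) (simp add: right_diff_distrib)
      ultimately show ?thesis by (simp add: algebra_simps)
    qed
    define c where "c = \<bar>r \<bullet> (A *v r) - l * (r \<bullet> r)\<bar> + 1"
    \<comment> \<open>Makes the quadratic term at most \<open>e * (r \<bullet> r)\<close> in size,
      half of the linear gain.\<close>
    define e where "e = (r \<bullet> r) / c"
    have c: "c > 0" and e: "e > 0" using rp by (auto simp: c_def e_def)
    have "e\<^sup>2 * (r \<bullet> (A *v r) - l * (r \<bullet> r)) \<ge> - (e\<^sup>2 * c)"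
    proof -
      have "- c \<le> r \<bullet> (A *v r) - l * (r \<bullet> r)" unfolding c_def by linarith
      from mult_left_mono[OF this, of "e\<^sup>2"] show ?thesis by simp
    qed
    moreover have "e\<^sup>2 * c = e * (r \<bullet> r)" using c by (simp add: e_def power2_eq_square)
    ultimately have "e * (r \<bullet> r) \<le> 0" using key[of e] by linarith
    then show False using e rp by (simp add: mult_le_0_iff)
  qed
  then have "A *v v = complex_of_real l *s v" by (simp add: r_def)
  with nv vW show ?thesis using that[of v l] by (auto simp: W_def)
qed

text \<open>Eigenvalues are listed with multiplicity by the coordinate type itself, so traces and
  determinants become sums and products over \<open>UNIV\<close>, and two matrices can be compared
  through a square array of overlaps.\<close>

definition eigb :: "complex^'n^'n \<Rightarrow> ('n \<Rightarrow> real) \<Rightarrow> ('n \<Rightarrow> complex^'n) \<Rightarrow> bool" where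
  "eigb T a u \<longleftrightarrow> onb u \<and> (\<forall>i. T *v u i = complex_of_real (a i) *s u i)"

theorem spectral_theorem:
  fixes A :: "complex^'n^'n"
  assumes A: "hermitian A"
  obtains a u where "eigb A a u"
proof -
  have "finite I \<Longrightarrow> \<exists>a u. (\<forall>i\<in>I. \<forall>j\<in>I. cip (u i) (u j) = (if i = j then 1 else 0)) \<and>
    (\<forall>i\<in>I. A *v u i = complex_of_real (a i) *s u i)" for I :: "'n set"
  proof (induction I rule: finite_induct)
    case (insert k I)
    then obtain a u where au: "\<And>i j. i \<in> I \<Longrightarrow> j \<in> I \<Longrightarrow> cip (u i) (u j) = (if i = j then 1 else 0)"
      "\<And>i. i \<in> I \<Longrightarrow> A *v u i = complex_of_real (a i) *s u i" by blast
    have "I \<noteq> UNIV" using insert by blast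
    from onb_extend[OF A this au] obtain v l where v: "norm v = 1" "A *v v = complex_of_real l *s v"
      "\<And>i. i \<in> I \<Longrightarrow> cip v (u i) = 0" by blast
    have v': "cip (u i) v = 0" if "i \<in> I" for i
      using v(3)[OF that] cnj_cip by (metis complex_cnj_zero)
    have "cip v v = 1" using v(1) by (simp add: cip_self)
    with au v v' \<open>k \<notin> I\<close> show ?case
      by (intro exI[of _ "a(k := l)"] exI[of _ "u(k := v)"]) auto
  qed simp
  from this[of UNIV] show ?thesis using that by (auto simp: eigb_def onb_def)
qed


lemma eigb_onb: "eigb T a u \<Longrightarrow> onb u"
  by (simp add: eigb_def)

lemma eigb_eig: "eigb T a u \<Longrightarrow> T *v u i = complex_of_real (a i) *s u i"
  by (simp add: eigb_def)

lemma eigb_apply: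
  assumes "eigb T a u"
  shows "T *v x = (\<Sum>i\<in>UNIV. (complex_of_real (a i) * cip x (u i)) *s u i)"
  by (subst onb_expand[OF eigb_onb[OF assms], of x])
    (simp add: matrix_vec_sum matrix_vec_scale eigb_eig[OF assms] mult.commute)

text \<open>Functional calculus relative to a chosen eigenbasis. \<open>mat_fun\<close> sums over
  distinct eigenvalues instead; once \<open>mat_fun_eq\<close> identifies the two, any eigenbasis
  may be used.\<close>

definition spec :: "(real \<Rightarrow> real) \<Rightarrow> ('n \<Rightarrow> real) \<Rightarrow> ('n \<Rightarrow> complex^'n) \<Rightarrow> complex^'n^'n" where
  "spec g a u = (\<Sum>i\<in>UNIV. g (a i) *\<^sub>R rank1 (u i))"

lemma spec_apply: "spec g a u *v x = (\<Sum>i\<in>UNIV. (complex_of_real (g (a i)) * cip x (u i)) *s u i)"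
  by (simp add: spec_def sum_matrix_mult_vec scaleR_matrix_mult_vec rank1_mult_vec)

lemma hermitian_spec: "hermitian (spec g a u)"
  unfolding spec_def by (intro hermitian_sum hermitian_scaleR hermitian_rank1)

lemma eigb_spec: "eigb T a u \<Longrightarrow> T = spec (\<lambda>x. x) a u"
  by (simp add: matrix_eq eigb_apply spec_apply)

lemma spec_cong: "(\<And>i. g (a i) = h (b i)) \<Longrightarrow> spec g a u = spec h b u"
  by (simp add: spec_def)

lemma spec_eigb: "onb u \<Longrightarrow> eigb (spec g a u) (\<lambda>i. g (a i)) u"
  by (simp add: eigb_def spec_apply onb_cip if_distrib if_distribR cong: if_cong)

lemma spec_mult: "onb u \<Longrightarrow> spec g a u ** spec h a u = spec (\<lambda>x. g x * h x) a u"
  unfolding matrix_eq matrix_vector_mul_assoc[symmetric]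
  by (simp add: spec_apply[of h] spec_apply[of "\<lambda>x. g x * h x"] matrix_vec_sum matrix_vec_scale
      eigb_eig[OF spec_eigb] algebra_simps)

lemma eigb_affine: "eigb T a u \<Longrightarrow> eigb (r *\<^sub>R T + c *\<^sub>R mat 1) (\<lambda>i. r * a i + c) u"
  by (simp add: eigb_def matrix_vector_mult_add_rdistrib scaleR_matrix_mult_vec vec_eq_iff algebra_simps)

lemma eigb_shift: "eigb T a u \<Longrightarrow> eigb (T + c *\<^sub>R mat 1) (\<lambda>i. a i + c) u"
  using eigb_affine[of T a u 1 c] by simp

lemma eigb_uminus: "eigb T a u \<Longrightarrow> eigb (- T) (\<lambda>i. - a i) u"
  using eigb_affine[of T a u "-1" 0] by simp

lemma eigb_hermitian: "eigb T a u \<Longrightarrow> hermitian T"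
  using eigb_spec hermitian_spec by metis

section \<open>The functional calculus in an orthonormal eigenbasis\<close>

text \<open>Idempotents with a common range fix each other's values, so P Q = Q and Q P = P; for
  Hermitian ones, taking adjoints gives P = Q. This makes the description in
  \<open>orth_proj\<close> unique.\<close>

lemma orth_proj_eqI:
  assumes "hermitian P" "P ** P = P" "range ((*v) P) = S"
  shows "orth_proj S = P"
  unfolding orth_proj_def
proof (rule the_equality)
  show "hermitian P \<and> P ** P = P \<and> range ((*v) P) = S" using assms by blast
  fix Q assume Q: "hermitian Q \<and> Q ** Q = Q \<and> range ((*v) Q) = S"
  have *: "P ** Q = Q" if id: "P ** P = P" and rg: "range ((*v) Q) = range ((*v) P)" for P Q :: "complex^'n^'n"
    unfolding matrix_eq matrix_vector_mul_assoc[symmetric]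
  proof
    fix x
    obtain y where "Q *v x = P *v y" using rg by (metis rangeE rangeI)
    then show "P *v (Q *v x) = Q *v x" using id by (simp add: matrix_vector_mul_assoc)
  qed
  have "P ** Q = Q" "Q ** P = P" using *[of P Q] *[of Q P] Q assms by auto
  then show "Q = P" using Q assms by (metis cadjoint_mult hermitian_def)
qed

lemma orth_proj_onb:
  assumes u: "onb u"
  shows "orth_proj {v. \<forall>i. i \<notin> J \<longrightarrow> cip v (u i) = 0} = (\<Sum>i\<in>J. rank1 (u i))" (is "orth_proj ?S = ?P")
proof (rule orth_proj_eqI)
  define g where "g = (\<lambda>i. if i \<in> J then 1 else 0 :: real)"
  have P: "?P *v x = (\<Sum>i\<in>J. cip x (u i) *s u i)" for x
    by (simp add: sum_matrix_mult_vec rank1_mult_vec)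
  have Pu: "cip (?P *v x) (u j) = (if j \<in> J then cip x (u j) else 0)" for x j
    by (simp add: P cip_sum_left onb_cip[OF u] if_distrib sum.delta cong: if_cong)
  show "hermitian ?P" by (intro hermitian_sum hermitian_rank1)
  have id: "?P *v x = x" if "x \<in> ?S" for x
  proof -
    have "x = (\<Sum>i\<in>UNIV. cip x (u i) *s u i)" by (rule onb_expand[OF u])
    also have "\<dots> = ?P *v x" unfolding P using that by (intro sum.mono_neutral_right) auto
    finally show ?thesis by simp
  qed
  have mem: "?P *v x \<in> ?S" for x using Pu by simp
  show "?P ** ?P = ?P" unfolding matrix_eq matrix_vector_mul_assoc[symmetric] using id mem by blast
  show "range ((*v) ?P) = ?S"
  proof (intro equalityI subsetI)
    fix x assume "x \<in> ?S"
    then have "x = ?P *v x" using id by simp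
    then show "x \<in> range ((*v) ?P)" by (rule range_eqI)
  qed (use mem in blast)
qed

text \<open>Comparing coordinates in T v = x v gives (a i - x) times the i-th coordinate equal to 0.
  Vanishing coordinates are the shape in which \<open>orth_proj_onb\<close> takes its
  subspace.\<close>

lemma eigenspace_eq:
  assumes "eigb T a u"
  shows "eigenspace T x = {v. \<forall>i. i \<notin> {i. a i = x} \<longrightarrow> cip v (u i) = 0}"
proof -
  have *: "cip (T *v v) (u i) = complex_of_real (a i) * cip v (u i)" for v i
    using cip_hermitian[OF eigb_hermitian[OF assms], of v "u i"] by (simp add: eigb_eig[OF assms])
  have "T *v v = complex_of_real x *s v \<longleftrightarrow> (\<forall>i. a i \<noteq> x \<longrightarrow> cip v (u i) = 0)" for v
  proof
    assume "T *v v = complex_of_real x *s v"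
    then show "\<forall>i. a i \<noteq> x \<longrightarrow> cip v (u i) = 0" using *[of v] by (metis cip_scale_left mult_right_cancel of_real_eq_iff)
  next
    assume r: "\<forall>i. a i \<noteq> x \<longrightarrow> cip v (u i) = 0"
    have "T *v v = (\<Sum>i\<in>UNIV. complex_of_real x *s (cip v (u i) *s u i))"
      unfolding eigb_apply[OF assms] using r by (intro sum.cong refl) (metis mult_zero_right vector_smult_assoc)
    also have "\<dots> = complex_of_real x *s (\<Sum>i\<in>UNIV. cip v (u i) *s u i)"
      by (simp only: vec.scale_sum_right)
    finally show "T *v v = complex_of_real x *s v" using onb_expand[OF eigb_onb[OF assms], of v] by simp
  qed
  then show ?thesis by (simp add: eigenspace_def)
qed

lemma onb_nonzero: "onb u \<Longrightarrow> u i \<noteq> 0"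
  using onb_cip[of u i i] by auto

lemma eigenvalues_eq:
  assumes "eigb T a u"
  shows "eigenvalues T = range a"
proof
  show "range a \<subseteq> eigenvalues T"
    using assms onb_nonzero by (fastforce simp: eigenvalues_def eigenspace_def eigb_def)
  show "eigenvalues T \<subseteq> range a"
  proof
    fix x assume "x \<in> eigenvalues T"
    then obtain v where v: "v \<in> eigenspace T x" "v \<noteq> 0" by (auto simp: eigenvalues_def)
    show "x \<in> range a"
    proof (rule ccontr)
      assume "x \<notin> range a"
      then have "cip v (u i) = 0" for i using v(1) unfolding eigenspace_eq[OF assms] by auto
      then show False using onb_expand[OF eigb_onb[OF assms], of v] v(2) by simp
    qed
  qed
qed

lemma mat_fun_eq:
  assumes "eigb T a u"
  shows "mat_fun g T = spec g a u"
proof -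
  have "mat_fun g T = (\<Sum>x\<in>range a. g x *\<^sub>R (\<Sum>i\<in>{i. a i = x}. rank1 (u i)))"
    unfolding mat_fun_def eigenvalues_eq[OF assms] eigenspace_eq[OF assms] orth_proj_onb[OF eigb_onb[OF assms]] ..
  also have "\<dots> = (\<Sum>x\<in>range a. \<Sum>i\<in>{i. i \<in> UNIV \<and> a i = x}. g (a i) *\<^sub>R rank1 (u i))"
    by (simp add: scaleR_sum_right)
  also have "\<dots> = spec g a u"
    unfolding spec_def by (subst sum.image_gen[of UNIV _ a]) auto
  finally show ?thesis .
qed

lemma pos_proj_eq:
  assumes "eigb T a u"
  shows "pos_proj T = (\<Sum>i\<in>{i. a i > 0}. rank1 (u i))"
proof -
  let ?S = "{v. \<forall>i. i \<notin> {i. a i > 0} \<longrightarrow> cip v (u i) = 0}"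
  let ?E = "{v. v \<noteq> 0 \<and> (\<exists>x>0. v \<in> eigenspace T x)}"
  have "vec.span ?E = ?S"
  proof
    show "vec.span ?E \<subseteq> ?S"
    proof (rule vec.span_minimal)
      show "?E \<subseteq> ?S" unfolding eigenspace_eq[OF assms] by auto
      show "vec.subspace ?S" by (simp add: vec.subspace_def cip_add_left)
    qed
    show "?S \<subseteq> vec.span ?E"
    proof
      fix v assume v: "v \<in> ?S"
      have "cip v (u i) *s u i \<in> vec.span ?E" for i
      proof (cases "a i > 0")
        case True
        have "u i \<in> ?E" using True onb_nonzero[OF eigb_onb[OF assms]] eigb_eig[OF assms, of i] by (auto simp: eigenspace_def)
        then show ?thesis by (intro vec.span_scale vec.span_base)
      next
        case False
        then show ?thesis using v vec.span_zero by auto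
      qed
      then have "(\<Sum>i\<in>UNIV. cip v (u i) *s u i) \<in> vec.span ?E" by (intro vec.span_sum)
      then show "v \<in> vec.span ?E" using onb_expand[OF eigb_onb[OF assms], of v] by simp
    qed
  qed
  then show ?thesis unfolding pos_proj_def by (simp only: orth_proj_onb[OF eigb_onb[OF assms]])
qed

definition nprt :: "real \<Rightarrow> real" where
  "nprt x = max 0 (- x)"

lemma neg_part_eq:
  assumes "hermitian T"
  shows "neg_part T = mat_fun nprt T"
proof -
  obtain a u where T: "eigb T a u" by (rule spectral_theorem[OF assms])
  have "pos_proj (- T) = spec (\<lambda>x. if x < 0 then 1 else 0) a u"
    unfolding pos_proj_eq[OF eigb_uminus[OF T]] spec_def by (intro sum.mono_neutral_cong_left) auto
  moreover have "- T = spec (\<lambda>x. - x) a u"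
    using eigb_spec[OF T] by (simp add: spec_def sum_negf)
  ultimately have "neg_part T = spec (\<lambda>x. - x) a u ** spec (\<lambda>x. if x < 0 then 1 else 0) a u"
    unfolding neg_part_def using matrix_mult_scaleR(1)[of "-1" T] by simp
  also have "\<dots> = spec nprt a u"
    unfolding spec_mult[OF eigb_onb[OF T]] by (intro spec_cong) (simp add: nprt_def)
  finally show ?thesis by (simp add: mat_fun_eq[OF T])
qed

section \<open>Double sums over two eigenbases\<close>

text \<open>The real inner product of matrices is the Hilbert-Schmidt one, the real part of the
  trace of M times the adjoint of N; pairing with a rank-one matrix evaluates the quadratic
  form.\<close>

lemma inner_rank1: "M \<bullet> rank1 v = v \<bullet> (M *v v)"
proof -
  have "M \<bullet> rank1 v = (\<Sum>i\<in>UNIV. \<Sum>j\<in>UNIV. Re (M $ i $ j * cnj (v $ i) * v $ j))"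
    by (simp add: inner_vec_def rank1_def inner_complex_def algebra_simps)
  also have "\<dots> = v \<bullet> (M *v v)"
    unfolding inner_vec_def inner_complex_def matrix_vector_mult_def
    by (simp add: sum_distrib_left sum_distrib_right sum_subtractf[symmetric] sum.distrib[symmetric] algebra_simps)
  finally show ?thesis .
qed

lemma inner_rank1_rank1: "rank1 v \<bullet> rank1 w = (cmod (cip v w))\<^sup>2"
proof -
  have "cip w (cip w v *s v) = cip v w * cnj (cip v w)"
    by (simp add: cnj_cip)
  also have "\<dots> = complex_of_real ((cmod (cip v w))\<^sup>2)"
    by (simp only: complex_norm_square)
  finally show ?thesis
    by (simp add: inner_rank1 rank1_mult_vec inner_eq_Re_cip del: of_real_power)
qed

text \<open>For two orthonormal bases this array is doubly stochastic. It handles pairs of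
  noncommuting matrices: expressions in f(X) and g(Y) become weighted sums of scalar expressions in
  pairs of eigenvalues.\<close>

definition overlap :: "('n \<Rightarrow> complex^'n) \<Rightarrow> ('n \<Rightarrow> complex^'n) \<Rightarrow> 'n \<Rightarrow> 'n \<Rightarrow> real" where
  "overlap u v i j = (cmod (cip (u i) (v j)))\<^sup>2"

lemma overlap_nonneg: "0 \<le> overlap u v i j"
  by (simp add: overlap_def)

lemma onb_norm: "onb u \<Longrightarrow> norm (u i) = 1"
  using cip_self[of "u i"] onb_cip[of u i i] norm_ge_zero[of "u i"]
  by (simp add: power2_eq_1_iff del: of_real_power norm_ge_zero)

lemma overlap_row: "onb u \<Longrightarrow> onb v \<Longrightarrow> (\<Sum>j\<in>UNIV. overlap u v i j) = 1"
  using parseval[of v "u i"] onb_norm[of u i] by (simp add: overlap_def)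

lemma overlap_col: "onb u \<Longrightarrow> onb v \<Longrightarrow> (\<Sum>i\<in>UNIV. overlap u v i j) = 1"
proof -
  have "overlap u v i j = overlap v u j i" for i
    unfolding overlap_def by (metis cnj_cip complex_mod_cnj)
  then show "onb u \<Longrightarrow> onb v \<Longrightarrow> ?thesis" using overlap_row[of v u j] by simp
qed

lemma spec_inner: "spec g a u \<bullet> spec h b v = (\<Sum>i\<in>UNIV. \<Sum>j\<in>UNIV. overlap u v i j * (g (a i) * h (b j)))"
  unfolding spec_def inner_sum_left inner_sum_right
  by (subst sum.swap) (simp add: inner_rank1_rank1 overlap_def algebra_simps)

definition tr_fun :: "(real \<Rightarrow> real) \<Rightarrow> complex^'n^'n \<Rightarrow> real" where
  "tr_fun g T = mat 1 \<bullet> mat_fun g T"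

lemma tr_fun_eq:
  assumes "eigb T a u"
  shows "tr_fun g T = (\<Sum>i\<in>UNIV. g (a i))"
proof -
  have "norm (u i) = 1" for i
    by (rule onb_norm[OF eigb_onb[OF assms]])
  then show ?thesis
    by (simp add: tr_fun_def mat_fun_eq[OF assms] spec_def inner_sum_right inner_rank1 power2_norm_eq_inner[symmetric])
qed

lemma sum_overlap_left: "onb u \<Longrightarrow> onb v \<Longrightarrow> (\<Sum>i\<in>UNIV. \<Sum>j\<in>UNIV. overlap u v i j * f i) = (\<Sum>i\<in>UNIV. f i)"
  by (simp add: sum_distrib_right[symmetric] overlap_row)

lemma sum_overlap_right: "onb u \<Longrightarrow> onb v \<Longrightarrow> (\<Sum>i\<in>UNIV. \<Sum>j\<in>UNIV. overlap u v i j * f j) = (\<Sum>j\<in>UNIV. f j)"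
  by (subst sum.swap) (simp add: sum_distrib_right[symmetric] overlap_col)

lemma spec_inner_self: "onb u \<Longrightarrow> spec g a u \<bullet> spec h a u = (\<Sum>i\<in>UNIV. g (a i) * h (a i))"
  by (simp add: spec_inner overlap_def onb_cip if_distrib if_distribR cong: if_cong)

lemma norm_diff_spec:
  assumes "onb u" "onb v"
  shows "(norm (spec h b v - spec g a u))\<^sup>2 = (\<Sum>i\<in>UNIV. \<Sum>j\<in>UNIV. overlap u v i j * (h (b j) - g (a i))\<^sup>2)"
proof -
  have "(norm (spec h b v - spec g a u))\<^sup>2 =
      (\<Sum>j\<in>UNIV. h (b j) * h (b j)) - 2 * (spec g a u \<bullet> spec h b v) + (\<Sum>i\<in>UNIV. g (a i) * g (a i))"
    by (simp add: power2_norm_eq_inner inner_diff_left inner_diff_right spec_inner_self assms inner_commute)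
  also have "\<dots> = (\<Sum>i\<in>UNIV. \<Sum>j\<in>UNIV. overlap u v i j * (h (b j) * h (b j)) -
      2 * (overlap u v i j * (g (a i) * h (b j))) + overlap u v i j * (g (a i) * g (a i)))"
    by (simp add: sum.distrib sum_subtractf spec_inner sum_distrib_left[symmetric]
        sum_overlap_left[OF assms, of "\<lambda>i. g (a i) * g (a i)"] sum_overlap_right[OF assms, of "\<lambda>j. h (b j) * h (b j)"])
  also have "\<dots> = (\<Sum>i\<in>UNIV. \<Sum>j\<in>UNIV. overlap u v i j * (h (b j) - g (a i))\<^sup>2)"
    by (intro sum.cong refl) (simp add: power2_eq_square algebra_simps)
  finally show ?thesis .
qed

text \<open>Rows and columns of \<open>overlap\<close> sum to 1, so the traces of F(X) and F(Y) can
  also be written as double sums. A quadratic bound on the scalar Taylor remainder then passes to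
  matrices, since the terms (b j - a i)^2 add up to the squared norm of Y - X.\<close>

lemma tr_fun_remainder:
  assumes X: "eigb X a u" and Y: "eigb Y b v"
  shows "tr_fun F Y - tr_fun F X - mat_fun f X \<bullet> (Y - X) =
    (\<Sum>i\<in>UNIV. \<Sum>j\<in>UNIV. overlap u v i j * (F (b j) - F (a i) - f (a i) * (b j - a i)))"
proof -
  note on = eigb_onb[OF X] eigb_onb[OF Y]
  have "mat_fun f X \<bullet> Y = (\<Sum>i\<in>UNIV. \<Sum>j\<in>UNIV. overlap u v i j * (f (a i) * b j))"
    unfolding mat_fun_eq[OF X] by (subst eigb_spec[OF Y]) (rule spec_inner)
  moreover have "mat_fun f X \<bullet> X = (\<Sum>i\<in>UNIV. f (a i) * a i)"
    unfolding mat_fun_eq[OF X] by (subst eigb_spec[OF X]) (rule spec_inner_self[OF on(1)])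
  ultimately have "tr_fun F Y - tr_fun F X - mat_fun f X \<bullet> (Y - X) =
     (\<Sum>i\<in>UNIV. \<Sum>j\<in>UNIV. overlap u v i j * F (b j) - overlap u v i j * F (a i)
       - (overlap u v i j * (f (a i) * b j) - overlap u v i j * (f (a i) * a i)))"
    by (simp add: sum_subtractf tr_fun_eq[OF X] tr_fun_eq[OF Y] inner_diff_right
        sum_overlap_left[OF on, of "\<lambda>i. F (a i)"] sum_overlap_left[OF on, of "\<lambda>i. f (a i) * a i"]
        sum_overlap_right[OF on, of "\<lambda>i. F (b i)"])
  then show ?thesis by (simp add: algebra_simps)
qed

lemma norm_diff_eigb:
  assumes "eigb X a u" "eigb Y b v"
  shows "(norm (Y - X))\<^sup>2 = (\<Sum>i\<in>UNIV. \<Sum>j\<in>UNIV. overlap u v i j * (b j - a i)\<^sup>2)"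
  using norm_diff_spec[OF assms[THEN eigb_onb], of "\<lambda>x. x" b "\<lambda>x. x" a]
  by (simp only: eigb_spec[OF assms(1), symmetric] eigb_spec[OF assms(2), symmetric])

lemma tr_fun_remainder_bound:
  assumes X: "eigb X a u" and Y: "eigb Y b v"
    and "\<And>i j. \<bar>F (b j) - F (a i) - f (a i) * (b j - a i)\<bar> \<le> C * (b j - a i)\<^sup>2"
  shows "\<bar>tr_fun F Y - tr_fun F X - mat_fun f X \<bullet> (Y - X)\<bar> \<le> C * (norm (Y - X))\<^sup>2"
proof -
  have "\<bar>tr_fun F Y - tr_fun F X - mat_fun f X \<bullet> (Y - X)\<bar> \<le>
      (\<Sum>i\<in>UNIV. \<Sum>j\<in>UNIV. overlap u v i j * \<bar>F (b j) - F (a i) - f (a i) * (b j - a i)\<bar>)"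
    unfolding tr_fun_remainder[OF X Y]
    by (intro order_trans[OF sum_abs] sum_mono order_trans[OF sum_abs]) (simp add: abs_mult overlap_nonneg)
  also have "\<dots> \<le> (\<Sum>i\<in>UNIV. \<Sum>j\<in>UNIV. overlap u v i j * (C * (b j - a i)\<^sup>2))"
    by (intro sum_mono mult_left_mono assms overlap_nonneg)
  also have "\<dots> = C * (norm (Y - X))\<^sup>2"
    by (simp add: norm_diff_eigb[OF X Y] sum_distrib_left algebra_simps)
  finally show ?thesis .
qed

text \<open>Scalar moduli of continuity carry over to the Hilbert-Schmidt norm: \<open>e = 0\<close>
  handles Lipschitz functions with their scalar constant, a positive \<open>e\<close> accommodates
  functions that are merely continuous.\<close>

lemma mat_fun_dist_bound:
  fixes X Y :: "complex^'n^'n"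
  assumes X: "eigb X a u" and Y: "eigb Y b v"
    and "\<And>i j. (g (b j) - g (a i))\<^sup>2 \<le> e + K * (b j - a i)\<^sup>2"
  shows "(norm (mat_fun g Y - mat_fun g X))\<^sup>2 \<le> real CARD('n) * e + K * (norm (Y - X))\<^sup>2"
  proof -
  note on = eigb_onb[OF X] eigb_onb[OF Y]
  have "(norm (mat_fun g Y - mat_fun g X))\<^sup>2 =
      (\<Sum>i\<in>UNIV. \<Sum>j\<in>UNIV. overlap u v i j * (g (b j) - g (a i))\<^sup>2)"
    unfolding mat_fun_eq[OF X] mat_fun_eq[OF Y] by (rule norm_diff_spec[OF on])
  also have "\<dots> \<le> (\<Sum>i\<in>UNIV. \<Sum>j\<in>UNIV. overlap u v i j * (e + K * (b j - a i)\<^sup>2))"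
    by (intro sum_mono mult_left_mono assms overlap_nonneg)
  also have "\<dots> = real CARD('n) * e + K * (norm (Y - X))\<^sup>2"
    unfolding norm_diff_eigb[OF X Y]
    by (simp add: distrib_left sum.distrib sum_overlap_left[OF on, of "\<lambda>_. e"] mult.left_commute[of _ K]
        flip: sum_distrib_left)
  finally show ?thesis .
qed

lemma mat_fun_lipschitz:
  fixes X Y :: "complex^'n^'n"
  assumes "hermitian X" "hermitian Y" and "\<And>x y. \<bar>g y - g x\<bar> \<le> L * \<bar>y - x\<bar>" "L \<ge> 0"
  shows "norm (mat_fun g Y - mat_fun g X) \<le> L * norm (Y - X)"
proof -
  obtain a u where X: "eigb X a u" by (rule spectral_theorem[OF assms(1)])
  obtain b v where Y: "eigb Y b v" by (rule spectral_theorem[OF assms(2)])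
  have "(norm (mat_fun g Y - mat_fun g X))\<^sup>2 \<le> real CARD('n) * 0 + L\<^sup>2 * (norm (Y - X))\<^sup>2"
  proof (rule mat_fun_dist_bound[OF X Y])
    fix i j
    show "(g (b j) - g (a i))\<^sup>2 \<le> 0 + L\<^sup>2 * (b j - a i)\<^sup>2"
      using power_mono[OF assms(3)[of "b j" "a i"], of 2] by (simp add: power_mult_distrib)
  qed
  then have "(norm (mat_fun g Y - mat_fun g X))\<^sup>2 \<le> (L * norm (Y - X))\<^sup>2" by (simp add: power_mult_distrib)
  then show ?thesis by (rule power2_le_imp_le) (simp add: assms(4))
qed


section \<open>The trace form in an orthonormal basis\<close>

lemma tr_inner: "mat 1 \<bullet> M = (\<Sum>i\<in>UNIV. Re (M $ i $ i))"
  by (simp add: inner_vec_def mat_def inner_complex_def if_distrib if_distribR sum.delta cong: if_cong)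

lemma cadjoint_mult_inner: "mat 1 \<bullet> (cadjoint M ** N) = M \<bullet> N"
proof -
  have "mat 1 \<bullet> (cadjoint M ** N) = (\<Sum>i\<in>UNIV. \<Sum>k\<in>UNIV. M $ k $ i \<bullet> N $ k $ i)"
    by (simp add: tr_inner matrix_matrix_mult_def cadjoint_def inner_complex_def)
  also have "\<dots> = M \<bullet> N"
    unfolding inner_vec_def by (rule sum.swap)
  finally show ?thesis .
qed

lemma inner_onb:
  assumes "onb u"
  shows "M \<bullet> N = (\<Sum>j\<in>UNIV. (M *v u j) \<bullet> (N *v u j))"
proof -
  have "M \<bullet> N = (cadjoint M ** N) \<bullet> (\<Sum>j\<in>UNIV. rank1 (u j))"
    by (simp add: onb_resolution[OF assms] cadjoint_mult_inner inner_commute[of _ "mat 1"])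
  also have "\<dots> = (\<Sum>j\<in>UNIV. (M *v u j) \<bullet> (N *v u j))"
    by (simp add: inner_sum_right inner_rank1 inner_eq_Re_cip matrix_vector_mul_assoc[symmetric] cip_matrix_left)
  finally show ?thesis .
qed

definition entry :: "('n \<Rightarrow> complex^'n) \<Rightarrow> complex^'n^'n \<Rightarrow> 'n \<Rightarrow> 'n \<Rightarrow> complex" where
  "entry u M i j = cip (M *v u j) (u i)"

lemma inner_entries:
  assumes "onb u"
  shows "M \<bullet> N = (\<Sum>i\<in>UNIV. \<Sum>j\<in>UNIV. entry u M i j \<bullet> entry u N i j)"
proof -
  have *: "x \<bullet> y = (\<Sum>i\<in>UNIV. cip x (u i) \<bullet> cip y (u i))" for x y
  proof -
    have "cip x y = cip (\<Sum>i\<in>UNIV. cip x (u i) *s u i) y"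
      using onb_expand[OF assms, of x] by simp
    then have "cip x y = (\<Sum>i\<in>UNIV. cip x (u i) * cnj (cip y (u i)))"
      by (simp add: cip_sum_left cnj_cip)
    then show ?thesis by (simp add: inner_eq_Re_cip inner_complex_def)
  qed
  show ?thesis
    unfolding inner_onb[OF assms] * entry_def by (rule sum.swap)
qed

lemma onb_matrix_eqI:
  assumes "onb u" "\<And>j. M *v u j = N *v u j"
  shows "M = N"
proof -
  have "(M - N) \<bullet> (M - N) = 0"
    by (simp add: inner_onb[OF assms(1)] matrix_vector_mult_diff_rdistrib assms(2))
  then show ?thesis by simp
qed

section \<open>Bounds on quadratic forms and eigenvalues\<close>

lemma abs_form_le:
  fixes M :: "complex^'n^'n"
  shows "\<bar>v \<bullet> (M *v v)\<bar> \<le> norm M * (norm v)\<^sup>2"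
proof -
  have "norm (rank1 v) = (norm v)\<^sup>2"
  proof -
    have "(norm (rank1 v))\<^sup>2 = ((norm v)\<^sup>2)\<^sup>2"
      unfolding power2_norm_eq_inner[of "rank1 v"] inner_rank1_rank1 cip_self by (simp only: norm_of_real abs_power2)
    then show ?thesis by (rule power2_eq_imp_eq) auto
  qed
  then show ?thesis using Cauchy_Schwarz_ineq2[of M "rank1 v"] by (simp add: inner_rank1)
qed

text \<open>The bound M >= l in the Loewner order. It is stated through the form because such bounds
  add up under nonnegative combinations and survive perturbations, whereas eigenvalues of a sum are
  not sums of eigenvalues.\<close>

definition form_ge :: "real \<Rightarrow> complex^'n^'n \<Rightarrow> bool" where
  "form_ge l M \<longleftrightarrow> (\<forall>v. l * (norm v)\<^sup>2 \<le> v \<bullet> (M *v v))"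

lemma eigb_form: "eigb X a u \<Longrightarrow> a i = u i \<bullet> (X *v u i)"
  by (simp add: eigb_eig scaleR_eq_scale[symmetric] onb_norm eigb_onb power2_norm_eq_inner[symmetric])

lemma eigb_form_sum: "eigb X a u \<Longrightarrow> v \<bullet> (X *v v) = (\<Sum>i\<in>UNIV. a i * (cmod (cip v (u i)))\<^sup>2)"
  unfolding inner_rank1[symmetric]
  by (subst eigb_spec[of X a u]) (auto simp: spec_def inner_sum_left inner_rank1_rank1
      intro!: sum.cong, metis cnj_cip complex_mod_cnj)

lemma eigb_form_ge:
  assumes "eigb X a u"
  shows "form_ge l X \<longleftrightarrow> (\<forall>i. l \<le> a i)"
proof
  assume "form_ge l X"
  then show "\<forall>i. l \<le> a i"
    unfolding form_ge_def using eigb_form[OF assms] onb_norm[OF eigb_onb[OF assms]]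
    by (metis mult.right_neutral one_power2)
next
  assume "\<forall>i. l \<le> a i"
  then show "form_ge l X"
    unfolding form_ge_def eigb_form_sum[OF assms] parseval[OF eigb_onb[OF assms], symmetric] sum_distrib_left
    by (auto intro!: sum_mono mult_right_mono)
qed

lemma eigb_abs_le: "eigb X a u \<Longrightarrow> \<bar>a i\<bar> \<le> norm X"
  using abs_form_le[of "u i" X] by (simp add: eigb_form onb_norm eigb_onb)

lemma form_ge_perturb: "form_ge l X \<Longrightarrow> form_ge (l - norm (Y - X)) Y"
  unfolding form_ge_def
proof
  fix v assume a: "\<forall>v. l * (norm v)\<^sup>2 \<le> v \<bullet> (X *v v)"
  have "v \<bullet> (Y *v v) = v \<bullet> (X *v v) + v \<bullet> ((Y - X) *v v)"
    by (simp add: matrix_vector_mult_diff_rdistrib inner_diff_right)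
  then show "(l - norm (Y - X)) * (norm v)\<^sup>2 \<le> v \<bullet> (Y *v v)"
    using a[rule_format, of v] abs_form_le[of v "Y - X"] by (simp add: left_diff_distrib)
qed

lemma form_ge_combine:
  assumes "form_ge l X" "form_ge m Y" "0 \<le> r" "0 \<le> s"
  shows "form_ge (r * l + s * m) (r *\<^sub>R X + s *\<^sub>R Y)"
  unfolding form_ge_def
proof
  fix v
  have "v \<bullet> ((r *\<^sub>R X + s *\<^sub>R Y) *v v) = r * (v \<bullet> (X *v v)) + s * (v \<bullet> (Y *v v))"
    by (simp add: matrix_vector_mult_add_rdistrib inner_add_right scaleR_matrix_mult_vec scaleR_eq_scale[symmetric])
  then show "(r * l + s * m) * (norm v)\<^sup>2 \<le> v \<bullet> ((r *\<^sub>R X + s *\<^sub>R Y) *v v)"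
    using assms mult_left_mono[of "l * (norm v)\<^sup>2" "v \<bullet> (X *v v)" r] mult_left_mono[of "m * (norm v)\<^sup>2" "v \<bullet> (Y *v v)" s]
    by (simp add: form_ge_def algebra_simps)
qed

lemma form_ge_norm: "form_ge (- norm X) X"
  using form_ge_perturb[of 0 0 X] by (simp add: form_ge_def)

lemma positive_semidefinite_iff: "positive_semidefinite A \<longleftrightarrow> hermitian A \<and> form_ge 0 A"
  by (simp add: positive_semidefinite_def form_ge_def)

text \<open>Strict positivity is uniform in finite dimension: the least eigenvalue serves as
  \<open>l\<close>.\<close>

lemma positive_definite_iff:
  fixes B :: "complex^'n^'n"
  shows "positive_definite B \<longleftrightarrow> hermitian B \<and> (\<exists>l>0. form_ge l B)"
proof
  assume B: "positive_definite B"
  then have "hermitian B" by (simp add: positive_definite_def)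
  then obtain b u where e: "eigb B b u" by (rule spectral_theorem)
  have "b i > 0" for i
    using B eigb_form[OF e] onb_nonzero[OF eigb_onb[OF e]] by (simp add: positive_definite_def)
  then have "form_ge (Min (range b)) B" "Min (range b) > 0"
    by (auto simp: eigb_form_ge[OF e])
  then show "hermitian B \<and> (\<exists>l>0. form_ge l B)" using \<open>hermitian B\<close> by blast
next
  assume "hermitian B \<and> (\<exists>l>0. form_ge l B)"
  then obtain l where "hermitian B" "l > 0" "form_ge l B" by blast
  then show "positive_definite B"
    unfolding positive_definite_def form_ge_def by (metis less_le_trans mult_pos_pos zero_less_norm_iff zero_less_power)
qed

text \<open>Two regimes: for |y - x| < d uniform continuity gives the error \<open>e\<close>, and at
  larger distances the bounded difference is absorbed by the quadratic term with K = (2 M)^2 / d^2.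
  The result has the shape of the hypothesis of \<open>mat_fun_dist_bound\<close>.\<close>

lemma continuous_on_quadratic_modulus:
  fixes g :: "real \<Rightarrow> real"
  assumes "continuous_on {l..u} g" "e > 0"
  obtains K where "K \<ge> 0" "\<And>x y. x \<in> {l..u} \<Longrightarrow> y \<in> {l..u} \<Longrightarrow> (g y - g x)\<^sup>2 \<le> e + K * (y - x)\<^sup>2"
proof -
  have "uniformly_continuous_on {l..u} g"
    using assms(1) by (rule compact_uniformly_continuous) simp
  then obtain d where d: "d > 0" "\<And>x y. x \<in> {l..u} \<Longrightarrow> y \<in> {l..u} \<Longrightarrow> \<bar>y - x\<bar> < d \<Longrightarrow> \<bar>g y - g x\<bar> < sqrt e"
    using assms(2) unfolding uniformly_continuous_on_def dist_real_def by (metis real_sqrt_gt_0_iff)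
  have "bounded (g ` {l..u})"
    using assms(1) by (intro compact_imp_bounded compact_continuous_image) auto
  then obtain M where M: "\<And>x. x \<in> {l..u} \<Longrightarrow> \<bar>g x\<bar> \<le> M"
    unfolding bounded_iff by (metis imageI real_norm_def)
  show ?thesis
  proof (rule that[of "(2 * M)\<^sup>2 / d\<^sup>2"])
    fix x y assume xy: "x \<in> {l..u}" "y \<in> {l..u}"
    show "(g y - g x)\<^sup>2 \<le> e + (2 * M)\<^sup>2 / d\<^sup>2 * (y - x)\<^sup>2"
    proof (cases "\<bar>y - x\<bar> < d")
      case True
      then have "(g y - g x)\<^sup>2 \<le> (sqrt e)\<^sup>2"
        using d(2)[OF xy] by (intro abs_le_square_iff[THEN iffD1]) (use assms(2) in auto)
      also have "\<dots> = e" using assms(2) by simp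
      finally show ?thesis by (intro add_increasing2) auto
    next
      case False
      have "(g y - g x)\<^sup>2 \<le> (2 * M)\<^sup>2"
        using M[OF xy(1)] M[OF xy(2)] by (intro abs_le_square_iff[THEN iffD1]) auto
      also have "\<dots> \<le> (2 * M)\<^sup>2 * ((y - x)\<^sup>2 / d\<^sup>2)"
      proof -
        have "d\<^sup>2 \<le> (y - x)\<^sup>2" using False d(1) by (intro abs_le_square_iff[THEN iffD1]) auto
        then have "1 \<le> (y - x)\<^sup>2 / d\<^sup>2" using d(1) by simp
        from mult_left_mono[OF this, of "(2 * M)\<^sup>2"] show ?thesis by simp
      qed
      finally show ?thesis using assms(2) by simp
    qed
  qed simp
qed

lemma mat_fun_tendsto:
  fixes X0 :: "complex^'n^'n"
  assumes g: "continuous_on {l..u} g" and X: "(X \<longlongrightarrow> X0) F"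
    and ev: "\<forall>\<^sub>F n in F. hermitian (X n) \<and> eigenvalues (X n) \<subseteq> {l..u}"
    and X0: "hermitian X0" "eigenvalues X0 \<subseteq> {l..u}"
  shows "((\<lambda>n. mat_fun g (X n)) \<longlongrightarrow> mat_fun g X0) F"
proof (rule tendstoI)
  fix e :: real assume e: "e > 0"
  \<comment> \<open>The dimension factor of \<open>mat_fun_dist_bound\<close> turns
    \<open>e'\<close> into half of \<open>e\<^sup>2\<close>; the other half is left for the norm
    term.\<close>
  define e' where "e' = e\<^sup>2 / (2 * real CARD('n))"
  have e': "e' > 0" using e by (simp add: e'_def)
  obtain K where K: "K \<ge> 0" "\<And>x y. x \<in> {l..u} \<Longrightarrow> y \<in> {l..u} \<Longrightarrow> (g y - g x)\<^sup>2 \<le> e' + K * (y - x)\<^sup>2"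
    by (rule continuous_on_quadratic_modulus[OF g e']) blast
  have "((\<lambda>n. K * (norm (X n - X0))\<^sup>2) \<longlongrightarrow> K * (norm (X0 - X0))\<^sup>2) F"
    by (intro tendsto_intros X)
  then have "\<forall>\<^sub>F n in F. K * (norm (X n - X0))\<^sup>2 < e\<^sup>2 / 2"
    by (rule order_tendstoD(2)) (use e in simp)
  then show "\<forall>\<^sub>F n in F. dist (mat_fun g (X n)) (mat_fun g X0) < e"
    using ev
  proof eventually_elim
    case (elim n)
    obtain a v where a: "eigb X0 a v" by (rule spectral_theorem[OF X0(1)])
    obtain b w where b: "eigb (X n) b w" using elim spectral_theorem by blast
    have "b j \<in> {l..u}" "a i \<in> {l..u}" for i j
      using X0(2) elim unfolding eigenvalues_eq[OF a] eigenvalues_eq[OF b] by (auto simp: image_subset_iff)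
    then have "(norm (mat_fun g (X n) - mat_fun g X0))\<^sup>2 \<le> real CARD('n) * e' + K * (norm (X n - X0))\<^sup>2"
      by (intro mat_fun_dist_bound[OF a b] K(2)) auto
    also have "\<dots> < e\<^sup>2"
      using elim by (simp add: e'_def)
    finally show ?case
      using e by (simp add: dist_norm power2_less_imp_less)
  qed
qed

section \<open>The derivative of the logarithm\<close>

definition divdiff :: "(real \<Rightarrow> real) \<Rightarrow> (real \<Rightarrow> real) \<Rightarrow> real \<Rightarrow> real \<Rightarrow> real" where
  "divdiff g g' x y = (if x = y then g' x else (g x - g y) / (x - y))"

lemma divdiff_mult: "divdiff g g' x y * (x - y) = g x - g y"
  by (simp add: divdiff_def)

lemma divdiff_commute: "divdiff g g' x y = divdiff g g' y x"
  by (auto simp: divdiff_def divide_simps algebra_simps)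

lemma continuous_on_divdiff:
  assumes "\<And>y. y \<in> S \<Longrightarrow> (g has_field_derivative g' y) (at y)" "x \<in> S"
  shows "continuous_on S (divdiff g g' x)"
proof (rule continuous_at_imp_continuous_on, rule ballI)
  fix y assume y: "y \<in> S"
  show "isCont (divdiff g g' x) y"
  proof (cases "y = x")
    case True
    have "((\<lambda>z. (g z - g x) / (z - x)) \<longlongrightarrow> g' x) (at x)"
      using assms by (simp add: has_field_derivative_iff)
    moreover have "\<forall>\<^sub>F z in at x. (g z - g x) / (z - x) = divdiff g g' x z"
      by (auto simp: eventually_at_filter divdiff_def divide_simps algebra_simps)
    ultimately have "(divdiff g g' x \<longlongrightarrow> g' x) (at x)"
      by (rule Lim_transform_eventually)
    then show ?thesis by (simp add: True isCont_def divdiff_def)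
  next
    case False
    have "isCont g y" using assms(1)[OF y] by (rule DERIV_isCont)
    then have "isCont (\<lambda>z. (g x - g z) / (x - z)) y"
      using False by (intro continuous_intros) auto
    moreover have "\<forall>\<^sub>F z in nhds y. divdiff g g' x z = (g x - g z) / (x - z)"
      using t1_space_nhds[OF False] by (auto elim!: eventually_mono simp: divdiff_def)
    ultimately show ?thesis by (simp add: isCont_cong)
  qed
qed

text \<open>With rows in the eigenbasis of B and columns in that of Y, the difference g(Y) - g(B)
  has the factor g(y j) - g(b i) where Y - B has y j - b i. The identity is exact, and Y enters only
  through Y - B and the functional calculus, so a derivative at B follows from mere continuity of
  \<open>mat_fun\<close>.\<close>

lemma mat_fun_diff:
  assumes B: "eigb B b u" and Y: "hermitian Y"
  shows "mat_fun g Y - mat_fun g B = (\<Sum>i\<in>UNIV. rank1 (u i) ** ((Y - B) ** mat_fun (divdiff g g' (b i)) Y))"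
proof -
  obtain y v where y: "eigb Y y v" by (rule spectral_theorem[OF Y])
  note on = eigb_onb[OF B] eigb_onb[OF y]
  show ?thesis
  proof (rule onb_matrix_eqI[OF on(2)])
    fix j
    have "(mat_fun g Y - mat_fun g B) *v v j =
        complex_of_real (g (y j)) *s v j - (\<Sum>i\<in>UNIV. (complex_of_real (g (b i)) * cip (v j) (u i)) *s u i)"
      by (simp add: matrix_vector_mult_diff_rdistrib mat_fun_eq[OF y] mat_fun_eq[OF B]
          eigb_eig[OF spec_eigb[OF on(2)]] spec_apply[of g b u])
    also have "complex_of_real (g (y j)) *s v j =
        complex_of_real (g (y j)) *s (\<Sum>i\<in>UNIV. cip (v j) (u i) *s u i)"
      by (rule arg_cong[OF onb_expand[OF on(1)]])
    also have "\<dots> - (\<Sum>i\<in>UNIV. (complex_of_real (g (b i)) * cip (v j) (u i)) *s u i) =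
        (\<Sum>i\<in>UNIV. (complex_of_real (g (y j) - g (b i)) * cip (v j) (u i)) *s u i)"
      unfolding vec.scale_sum_right sum_subtractf[symmetric]
      by (intro sum.cong refl) (simp add: vec_eq_iff algebra_simps)
    also have "\<dots> = (\<Sum>i\<in>UNIV. (complex_of_real (divdiff g g' (b i) (y j)) * cip ((Y - B) *v v j) (u i)) *s u i)"
    proof (intro sum.cong refl)
      fix i
      have "cip ((Y - B) *v v j) (u i) = complex_of_real (y j - b i) * cip (v j) (u i)"
        by (simp add: matrix_vector_mult_diff_rdistrib cip_diff_left eigb_eig[OF y]
            cip_hermitian[OF eigb_hermitian[OF B]] eigb_eig[OF B] left_diff_distrib)
      moreover have "g (y j) - g (b i) = divdiff g g' (b i) (y j) * (y j - b i)"
        using divdiff_mult[of g g' "b i" "y j"] by (simp add: algebra_simps)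
      ultimately show "(complex_of_real (g (y j) - g (b i)) * cip (v j) (u i)) *s u i =
          (complex_of_real (divdiff g g' (b i) (y j)) * cip ((Y - B) *v v j) (u i)) *s u i"
        by simp
    qed
    also have "\<dots> = (\<Sum>i\<in>UNIV. rank1 (u i) ** ((Y - B) ** mat_fun (divdiff g g' (b i)) Y)) *v v j"
      by (simp add: sum_matrix_mult_vec matrix_vector_mul_assoc[symmetric] mat_fun_eq[OF y]
          eigb_eig[OF spec_eigb[OF on(2)]] matrix_vec_scale rank1_mult_vec)
    finally show "(mat_fun g Y - mat_fun g B) *v v j =
        (\<Sum>i\<in>UNIV. rank1 (u i) ** ((Y - B) ** mat_fun (divdiff g g' (b i)) Y)) *v v j" .
  qed
qed

lemma tendsto_matrix_mult:
  fixes X Y :: "_ \<Rightarrow> complex^'n^'n"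
  assumes "(X \<longlongrightarrow> A) F" "(Y \<longlongrightarrow> B) F"
  shows "((\<lambda>t. X t ** Y t) \<longlongrightarrow> A ** B) F"
  unfolding matrix_matrix_mult_def
  by (intro tendsto_vec_lambda tendsto_sum tendsto_mult tendsto_vec_nth assms)

text \<open>The exact difference formula is divided by t, and the remaining functions of B + t A
  converge by \<open>mat_fun_tendsto\<close>. This also shows that the limit behind
  \<open>Dlog\<close> exists.\<close>

lemma Dlog_eq:
  fixes A B :: "complex^'n^'n"
  assumes e: "eigb B b u" and b: "\<And>i. b i > 0" and A: "hermitian A"
  shows "Dlog B A = (\<Sum>i\<in>UNIV. rank1 (u i) ** (A ** mat_fun (divdiff ln inverse (b i)) B))"
  unfolding Dlog_def
proof (rule tendsto_Lim)
  let ?\<phi> = "\<lambda>i. divdiff ln inverse (b i)"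
  \<comment> \<open>Once t A has norm below l / 2, the spectrum of B + t A stays above l / 2, away
    from the singularity of \<open>ln\<close>; \<open>m\<close> bounds it from above.\<close>
  define l where "l = Min (range b)"
  have l: "l > 0" "\<And>i. l \<le> b i" using b by (auto simp: l_def)
  define m where "m = norm B + l"
  have B: "hermitian B" by (rule eigb_hermitian[OF e])
  have "(\<lambda>t::real. B + t *\<^sub>R A) \<midarrow>0\<rightarrow> B + 0 *\<^sub>R A" by (intro tendsto_intros)
  then have lim: "(\<lambda>t::real. B + t *\<^sub>R A) \<midarrow>0\<rightarrow> B" by simp
  have "(\<lambda>t::real. norm (t *\<^sub>R A)) \<midarrow>0\<rightarrow> norm (0 *\<^sub>R A)" by (intro tendsto_intros)
  then have small: "\<forall>\<^sub>F t in at (0::real). norm (t *\<^sub>R A) < l / 2"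
    using l by (intro order_tendstoD(2)) auto
  have ev: "\<forall>\<^sub>F t in at 0. hermitian (B + t *\<^sub>R A) \<and> eigenvalues (B + t *\<^sub>R A) \<subseteq> {l/2..m}"
    using small
  proof eventually_elim
    case (elim t)
    have h: "hermitian (B + t *\<^sub>R A)" by (intro hermitian_add hermitian_scaleR A B)
    obtain y v where y: "eigb (B + t *\<^sub>R A) y v" by (rule spectral_theorem[OF h])
    have "form_ge l B" using l eigb_form_ge[OF e] by blast
    from form_ge_perturb[OF this, of "B + t *\<^sub>R A"] have "l - norm (t *\<^sub>R A) \<le> y i" for i
      using eigb_form_ge[OF y] by simp
    then have "l / 2 \<le> y i" for i using elim by (smt (verit) field_sum_of_halves)
    moreover have "y i \<le> m" for i
      using eigb_abs_le[OF y, of i] norm_triangle_ineq[of B "t *\<^sub>R A"] elim l by (simp add: m_def)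
    ultimately show ?case using h eigenvalues_eq[OF y] by auto
  qed
  have "b i \<in> {l/2..m}" for i
    using l(1) l(2)[of i] eigb_abs_le[OF e, of i] by (auto simp: m_def abs_le_iff)
  then have evB: "eigenvalues B \<subseteq> {l/2..m}"
    unfolding eigenvalues_eq[OF e] by blast
  have cont: "continuous_on {l/2..m} (?\<phi> i)" for i
  proof (rule continuous_on_subset)
    show "continuous_on {0<..} (?\<phi> i)"
      by (rule continuous_on_divdiff) (use b in \<open>auto intro!: derivative_eq_intros simp: inverse_eq_divide\<close>)
  qed (use l in auto)
  have "(\<lambda>t::real. \<Sum>i\<in>UNIV. rank1 (u i) ** (A ** mat_fun (?\<phi> i) (B + t *\<^sub>R A)))
      \<midarrow>0\<rightarrow> (\<Sum>i\<in>UNIV. rank1 (u i) ** (A ** mat_fun (?\<phi> i) B))"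
    by (intro tendsto_sum tendsto_matrix_mult tendsto_const mat_fun_tendsto[OF cont lim ev B evB])
  moreover have "\<forall>\<^sub>F t in at 0. (\<Sum>i\<in>UNIV. rank1 (u i) ** (A ** mat_fun (?\<phi> i) (B + t *\<^sub>R A))) =
      (1 / t) *\<^sub>R (mat_log (B + t *\<^sub>R A) - mat_log B)"
    unfolding eventually_at_filter
  proof (rule always_eventually, intro allI impI)
    fix t :: real assume t: "t \<noteq> 0"
    have h: "hermitian (B + t *\<^sub>R A)" by (intro hermitian_add hermitian_scaleR A B)
    show "(\<Sum>i\<in>UNIV. rank1 (u i) ** (A ** mat_fun (?\<phi> i) (B + t *\<^sub>R A))) =
      (1 / t) *\<^sub>R (mat_log (B + t *\<^sub>R A) - mat_log B)"
      unfolding mat_log_def mat_fun_diff[OF e h, of ln inverse]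
      using t by (simp add: matrix_mult_scaleR scaleR_sum_right)
  qed
  ultimately show "(\<lambda>t. (1 / t) *\<^sub>R (mat_log (B + t *\<^sub>R A) - mat_log B))
      \<midarrow>0\<rightarrow> (\<Sum>i\<in>UNIV. rank1 (u i) ** (A ** mat_fun (?\<phi> i) B))"
    by (rule Lim_transform_eventually)
qed simp

section \<open>The derivative of x log x and its symmetry\<close>

definition xlogx :: "real \<Rightarrow> real" where "xlogx x = x * ln x"

abbreviation "dxlogx \<equiv> divdiff xlogx (\<lambda>x. ln x + 1)"

text \<open>The derivative of \<open>x log x\<close> at the matrix with eigenbasis \<open>u\<close> and eigenvalues \<open>b\<close>.\<close>

definition Dxlogx :: "('n \<Rightarrow> real) \<Rightarrow> ('n \<Rightarrow> complex^'n) \<Rightarrow> complex^'n^'n \<Rightarrow> complex^'n^'n" where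
  "Dxlogx b u M = (\<Sum>i\<in>UNIV. \<Sum>j\<in>UNIV. dxlogx (b i) (b j) *\<^sub>R (rank1 (u i) ** (M ** rank1 (u j))))"

text \<open>Product rule for divided differences: x ln x - y ln y = (x - y) ln y + x (ln x - ln y).
  The factor log B on the right of A brings in the column eigenvalue, the factor B on the left the
  row eigenvalue, and this is exactly that pattern.\<close>

lemma Dxlogx_eq:
  assumes e: "eigb B b u" and b: "\<And>i. b i > 0" and A: "hermitian A"
  shows "A ** mat_log B + B ** Dlog B A = Dxlogx b u A"
proof -
  note on = eigb_onb[OF e]
  let ?L = "divdiff ln inverse"
  have dd: "dxlogx (b i) (b j) = ln (b j) + b i * ?L (b i) (b j)" for i j
    using b[of i] by (auto simp: divdiff_def xlogx_def divide_simps) (simp add: algebra_simps)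
  have B: "B ** rank1 (u i) = b i *\<^sub>R rank1 (u i)" for i
    unfolding matrix_eq matrix_vector_mul_assoc[symmetric] rank1_mult_vec matrix_vec_scale eigb_eig[OF e]
      scaleR_matrix_mult_vec by (simp add: mult.commute)
  have "A ** mat_log B = (\<Sum>i\<in>UNIV. rank1 (u i)) ** (A ** mat_log B)"
    by (simp add: onb_resolution[OF on])
  also have "\<dots> = (\<Sum>i\<in>UNIV. \<Sum>j\<in>UNIV. ln (b j) *\<^sub>R (rank1 (u i) ** (A ** rank1 (u j))))"
    by (simp add: mat_log_def mat_fun_eq[OF e] spec_def matrix_mult_sum_left matrix_mult_sum_right
        matrix_mult_scaleR scaleR_sum_right) (rule sum.swap)
  finally have 1: "A ** mat_log B = \<dots>" .
  have 2: "B ** Dlog B A = (\<Sum>i\<in>UNIV. \<Sum>j\<in>UNIV. (b i * ?L (b i) (b j)) *\<^sub>R (rank1 (u i) ** (A ** rank1 (u j))))"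
    by (simp add: Dlog_eq[OF e b A] matrix_mult_sum_right matrix_mul_assoc B matrix_mult_scaleR)
      (simp add: mat_fun_eq[OF e] spec_def matrix_mult_sum_right matrix_mult_scaleR scaleR_sum_right)
  show ?thesis
    unfolding 1 2 Dxlogx_def sum.distrib[symmetric] scaleR_left_distrib[symmetric] dd ..
qed

lemma entry_Dxlogx:
  assumes "onb u"
  shows "entry u (Dxlogx b u M) i j = of_real (dxlogx (b i) (b j)) * entry u M i j"
proof -
  have "entry u (rank1 (u k) ** (M ** rank1 (u l))) i j = (if i = k \<and> j = l then entry u M i j else 0)" for k l
    by (simp add: entry_def matrix_vector_mul_assoc[symmetric] rank1_mult_vec matrix_vec_scale onb_cip[OF assms])
  then have "entry u (Dxlogx b u M) i j =
      (\<Sum>k\<in>UNIV. \<Sum>l\<in>UNIV. of_real (dxlogx (b k) (b l)) * (if i = k \<and> j = l then entry u M i j else 0))"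
    by (simp add: Dxlogx_def entry_def sum_matrix_mult_vec cip_sum_left scaleR_matrix_mult_vec)
  also have "\<dots> = (\<Sum>k\<in>UNIV. if i = k then of_real (dxlogx (b i) (b j)) * entry u M i j else 0)"
    by (intro sum.cong refl) (auto simp: if_distrib cong: if_cong)
  finally show ?thesis by simp
qed

lemma Dxlogx_inner:
  assumes "onb u"
  shows "Dxlogx b u M \<bullet> N = (\<Sum>i\<in>UNIV. \<Sum>j\<in>UNIV. dxlogx (b i) (b j) * (entry u M i j \<bullet> entry u N i j))"
  by (simp add: inner_entries[OF assms] entry_Dxlogx[OF assms] scaleR_conv_of_real[symmetric])

lemma Dxlogx_sym: "onb u \<Longrightarrow> Dxlogx b u M \<bullet> N = Dxlogx b u N \<bullet> M"
  by (simp add: Dxlogx_inner inner_commute[of "entry u M _ _"])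

lemma Dxlogx_add: "Dxlogx b u (M + N) = Dxlogx b u M + Dxlogx b u N"
  by (simp add: Dxlogx_def matrix_add_ldistrib matrix_add_rdistrib_c scaleR_right_distrib sum.distrib)

lemma Dxlogx_scaleR: "Dxlogx b u (r *\<^sub>R M) = r *\<^sub>R Dxlogx b u M"
  by (simp add: Dxlogx_def matrix_mult_scaleR scaleR_sum_right mult.commute)

lemma Dxlogx_diff: "Dxlogx b u (M - N) = Dxlogx b u M - Dxlogx b u N"
  using Dxlogx_add[of b u M "- N"] Dxlogx_scaleR[of b u "-1" N] by simp

lemma Dxlogx_self:
  assumes "eigb B b u"
  shows "Dxlogx b u B = mat_fun xlogx B + B"
proof (rule onb_matrix_eqI[OF eigb_onb[OF assms]])
  fix j
  note on = eigb_onb[OF assms]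
  have *: "rank1 (u i) *v (B *v (rank1 (u k) *v u j)) = (if i = j \<and> k = j then complex_of_real (b j) *s u j else 0)" for i k
    by (simp add: rank1_mult_vec onb_cip[OF on] matrix_vec_scale eigb_eig[OF assms])
  have "Dxlogx b u B *v u j = (\<Sum>i\<in>UNIV. \<Sum>k\<in>UNIV. complex_of_real (dxlogx (b i) (b k)) *s
      (if i = j \<and> k = j then complex_of_real (b j) *s u j else 0))"
    by (simp add: Dxlogx_def sum_matrix_mult_vec scaleR_matrix_mult_vec matrix_vector_mul_assoc[symmetric] *)
  also have "\<dots> = (\<Sum>i\<in>UNIV. if i = j then complex_of_real (dxlogx (b j) (b j) * b j) *s u j else 0)"
    by (intro sum.cong refl) (auto simp: if_distrib[where f = "\<lambda>x. c *s x" for c] cong: if_cong)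
  also have "\<dots> = complex_of_real (xlogx (b j) + b j) *s u j"
    by (simp add: xlogx_def divdiff_def algebra_simps)
  also have "\<dots> = (mat_fun xlogx B + B) *v u j"
    by (simp add: matrix_vector_mult_add_rdistrib mat_fun_eq[OF assms] eigb_eig[OF spec_eigb[OF on]] eigb_eig[OF assms]
        vec.scale_left_distrib)
  finally show "Dxlogx b u B *v u j = (mat_fun xlogx B + B) *v u j" .
qed

text \<open>A log B and B Dlog[B](A) need not be Hermitian separately; their sum is, because divided
  differences are symmetric in the two eigenvalues.\<close>

lemma hermitian_Dxlogx: 
  assumes "hermitian M"
  shows "hermitian (Dxlogx b u M)"
proof -
  have "cadjoint (Dxlogx b u M) = (\<Sum>i\<in>UNIV. \<Sum>j\<in>UNIV. dxlogx (b i) (b j) *\<^sub>R (rank1 (u j) ** (M ** rank1 (u i))))"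
    using assms by (simp add: Dxlogx_def cadjoint_sum cadjoint_mult hermitian_def matrix_mul_assoc)
  also have "\<dots> = Dxlogx b u M"
    unfolding Dxlogx_def by (subst sum.swap) (simp add: divdiff_commute)
  finally show ?thesis by (simp add: hermitian_def)
qed


section \<open>The spectrum of a pencil\<close>

text \<open>One square matrix encodes everything: rows outside \<open>I\<close> force coordinates to
  vanish, the equations of \<open>K\<close> occupy distinct rows inside \<open>I\<close>, and some
  row of \<open>I\<close> stays zero, so the determinant vanishes.\<close>

lemma underdetermined_system:
  fixes c :: "'n::finite \<Rightarrow> 'n \<Rightarrow> complex"
  assumes "card K < card I"
  obtains x where "x \<noteq> (\<lambda>_. 0)" "\<And>i. i \<notin> I \<Longrightarrow> x i = 0" "\<And>k. k \<in> K \<Longrightarrow> (\<Sum>i\<in>UNIV. c k i * x i) = 0"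
proof -
  have "finite K" "finite I" by simp_all
  then obtain f where f: "inj_on f K" "f ` K \<subseteq> I"
    using card_le_inj[of K I] assms by auto
  have "card (f ` K) < card I" using assms f by (simp add: card_image)
  have "\<not> I \<subseteq> f ` K"
  proof
    assume "I \<subseteq> f ` K"
    then have "card I \<le> card (f ` K)" by (intro card_mono) auto
    then show False using \<open>card (f ` K) < card I\<close> by simp
  qed
  then obtain r where r: "r \<in> I" "r \<notin> f ` K" by blast
  define N :: "complex^'n^'n" where "N = (\<chi> p i. if p \<notin> I then (if p = i then 1 else 0)
      else if p \<in> f ` K then c (inv_into K f p) i else 0)"
  have "row r N = 0" using r by (simp add: row_def N_def vec_eq_iff)
  then have "det N = 0" by (rule det_zero_row)
  then have "\<not> (\<exists>M. M ** N = mat 1)"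
    using invertible_det_nz invertible_left_inverse by blast
  then obtain x where x: "N *v x = 0" "x \<noteq> 0"
    unfolding matrix_left_invertible_ker by blast
  have out: "x $ i = 0" if "i \<notin> I" for i
  proof -
    have N: "N $ i $ j = (if i = j then 1 else 0)" for j
      using that by (simp add: N_def)
    have "(N *v x) $ i = (\<Sum>j\<in>UNIV. if i = j then x $ j else 0)"
      unfolding matrix_vector_mult_def vec_lambda_beta N by (intro sum.cong refl) auto
    then show ?thesis by (simp add: x(1))
  qed
  have "(\<Sum>i\<in>UNIV. c k i * x $ i) = 0" if "k \<in> K" for k
  proof -
    have N: "N $ f k $ j = c k j" for j
      using that f by (auto simp: N_def inv_into_f_f)
    have "(N *v x) $ f k = (\<Sum>i\<in>UNIV. c k i * x $ i)"
      unfolding matrix_vector_mult_def vec_lambda_beta N ..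
    then show ?thesis by (simp add: x(1))
  qed
  moreover have "(\<lambda>i. x $ i) \<noteq> (\<lambda>_. 0)"
  proof
    assume "(\<lambda>i. x $ i) = (\<lambda>_. 0)"
    then have "x $ i = 0" for i by (rule fun_cong)
    then show False using x(2) by (simp add: vec_eq_iff)
  qed
  ultimately show ?thesis using that[of "\<lambda>i. x $ i"] out by blast
qed

text \<open>If the congruent matrix had more nonpositive eigenvalues, a dimension count would give a
  nonzero z in the span of the corresponding \<open>f i\<close> with \<open>Q *v z\<close>
  orthogonal to every \<open>e k\<close> with nonpositive \<open>m k\<close>. The form of M at
  \<open>Q *v z\<close> would then be both nonpositive and positive.\<close>

lemma congruence_nonpositive_le:
  assumes M: "eigb M m e" and T: "eigb (Q ** M ** Q) s f" and Q: "hermitian Q" "P ** Q = mat 1"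
  shows "card {i. s i \<le> 0} \<le> card {k. m k \<le> 0}"
proof (rule ccontr)
  assume "\<not> ?thesis"
  then have "card {k. m k \<le> 0} < card {i. s i \<le> 0}" by simp
  then obtain x where x: "x \<noteq> (\<lambda>_. 0)" "\<And>i. i \<notin> {i. s i \<le> 0} \<Longrightarrow> x i = 0"
    "\<And>k. k \<in> {k. m k \<le> 0} \<Longrightarrow> (\<Sum>i\<in>UNIV. cip (Q *v f i) (e k) * x i) = 0"
    by (rule underdetermined_system[where c = "\<lambda>k i. cip (Q *v f i) (e k)"]) blast
  define z where "z = (\<Sum>i\<in>UNIV. x i *s f i)"
  have zf: "cip z (f i) = x i" for i
    by (simp add: z_def cip_sum_left onb_cip[OF eigb_onb[OF T]] if_distrib cong: if_cong)
  have ze: "cip (Q *v z) (e k) = 0" if "m k \<le> 0" for k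
    using x(3)[of k] that by (simp add: z_def matrix_vec_sum matrix_vec_scale cip_sum_left mult.commute)
  have "Q *v z \<noteq> 0"
  proof
    assume "Q *v z = 0"
    then have "z = 0" using Q(2) by (metis matrix_vector_mul_assoc matrix_vector_mul_lid matrix_vector_mult_0_right)
    then show False using x(1) zf by auto
  qed
  have "z \<bullet> ((Q ** M ** Q) *v z) = (\<Sum>i\<in>UNIV. s i * (cmod (x i))\<^sup>2)"
    by (simp only: eigb_form_sum[OF T] zf)
  also have "\<dots> \<le> 0" using x(2) by (intro sum_nonpos) (force simp: mult_le_0_iff)
  finally have "(Q *v z) \<bullet> (M *v (Q *v z)) \<le> 0"
    using inner_hermitian[OF Q(1), of z "M *v (Q *v z)"] by (simp add: matrix_vector_mul_assoc matrix_mul_assoc)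
  then have le: "(\<Sum>k\<in>UNIV. m k * (cmod (cip (Q *v z) (e k)))\<^sup>2) \<le> 0"
    by (simp only: eigb_form_sum[OF M])
  have nn: "0 \<le> m k * (cmod (cip (Q *v z) (e k)))\<^sup>2" for k
    using ze[of k] by (cases "m k \<le> 0") auto
  then have "(\<Sum>k\<in>UNIV. m k * (cmod (cip (Q *v z) (e k)))\<^sup>2) = 0"
    using le by (simp add: order_antisym sum_nonneg)
  then have eq0: "m k * (cmod (cip (Q *v z) (e k)))\<^sup>2 = 0" for k
    using nn by (simp add: sum_nonneg_eq_0_iff)
  have "cip (Q *v z) (e k) = 0" for k
    using ze[of k] eq0[of k] by (cases "m k \<le> 0") auto
  then have "(\<Sum>i\<in>UNIV. cip (Q *v z) (e i) *s e i) = 0" by simp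
  then have "Q *v z = 0" by (rule trans[OF onb_expand[OF eigb_onb[OF M]]])
  then show False using \<open>Q *v z \<noteq> 0\<close> by blast
qed

definition nonpos :: "real \<Rightarrow> real" where
  "nonpos x = (if x \<le> 0 then 1 else 0)"

lemma tr_fun_nonpos: "eigb T a u \<Longrightarrow> tr_fun nonpos T = real (card {i. a i \<le> 0})"
  by (simp add: tr_fun_eq nonpos_def sum.If_cases)

text \<open>Congruence with the inverse P undoes congruence with Q, so the one-sided estimate
  applies in both directions.\<close>

lemma congruence_nonpositive:
  assumes M: "hermitian M" and Q: "hermitian Q" and P: "hermitian P" and PQ: "P ** Q = mat 1"
  shows "tr_fun nonpos (Q ** M ** Q) = tr_fun nonpos M"
proof -
  have QP: "Q ** P = mat 1" using PQ matrix_left_right_inverse by blast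
  have h: "hermitian (Q ** M ** Q)"
    using M Q by (simp add: hermitian_def cadjoint_mult matrix_mul_assoc)
  obtain m e where m: "eigb M m e" by (rule spectral_theorem[OF M])
  obtain s f where s: "eigb (Q ** M ** Q) s f" by (rule spectral_theorem[OF h])
  have "P ** (Q ** M ** Q) ** P = (P ** Q) ** M ** (Q ** P)" by (simp only: matrix_mul_assoc)
  then have "eigb (P ** (Q ** M ** Q) ** P) m e" using m by (simp add: PQ QP)
  then have "card {k. m k \<le> 0} \<le> card {i. s i \<le> 0}"
    by (rule congruence_nonpositive_le[OF s _ P QP])
  moreover have "card {i. s i \<le> 0} \<le> card {k. m k \<le> 0}"
    by (rule congruence_nonpositive_le[OF m s Q PQ])
  ultimately show ?thesis by (simp add: tr_fun_nonpos[OF m] tr_fun_nonpos[OF s])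
qed

lemma det_eigb:
  assumes "eigb X a u"
  shows "det X = complex_of_real (\<Prod>i\<in>UNIV. a i)"
proof -
  define U :: "complex^'a^'a" where "U = (\<chi> i j. u j $ i)"
  define D :: "complex^'a^'a" where "D = (\<chi> i j. if i = j then complex_of_real (a i) else 0)"
  have "cadjoint U ** U = mat 1"
    using eigb_onb[OF assms] by (simp add: onb_def cip_def U_def cadjoint_def matrix_matrix_mult_def mat_def
        vec_eq_iff mult.commute)
  then have "det (cadjoint U) * det U = 1" by (metis det_I det_mul)
  then have U: "det U \<noteq> 0" by auto
  have "X ** U = U ** D"
  proof -
    have "(X ** U) $ i $ j = (X *v u j) $ i" for i j
      by (simp add: matrix_matrix_mult_def matrix_vector_mult_def U_def)
    moreover have "(U ** D) $ i $ j = complex_of_real (a j) * u j $ i" for i j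
      by (simp add: matrix_matrix_mult_def U_def D_def if_distrib cong: if_cong)
    ultimately show ?thesis by (simp add: vec_eq_iff eigb_eig[OF assms])
  qed
  then have "det X * det U = det U * det D" by (metis det_mul)
  then have "det X = det D" using U by simp
  also have "\<dots> = complex_of_real (\<Prod>i\<in>UNIV. a i)"
    by (subst det_diagonal) (simp_all add: D_def)
  finally show ?thesis .
qed

lemma positive_definite_eigb: "positive_definite B \<Longrightarrow> eigb B b u \<Longrightarrow> b i > 0"
  using eigb_form_ge by (metis less_le_trans positive_definite_iff)

lemma matrix_diff_distrib_c:
  fixes C :: "complex^'n^'n"
  shows matrix_diff_rdistrib_c: "(A - B) ** C = A ** C - B ** C"
    and matrix_diff_ldistrib_c: "C ** (A - B) = C ** A - C ** B"
  using matrix_add_rdistrib_c[of "A - B" B C] matrix_add_ldistrib[of C "A - B" B]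
  by (simp_all add: eq_diff_eq)

text \<open>With Q and R the square roots of B and of its inverse, S = R A R satisfies Q S Q = A and
  S - 1 = R (A - B) R. The trace and squared norm of S - 1 and the log-determinant of S are all that
  a sum of second-order remainders of log requires. In the eigenbasis of B, the first two come from
  the entries of A - B divided by square roots of \<open>b i * b j\<close>.\<close>

lemma pencil_spectrum:
  fixes A B :: "complex^'n^'n"
  assumes A: "positive_definite A" and B: "positive_definite B" and a: "eigb A a w" and b: "eigb B b u"
  shows "\<exists>s :: 'n \<Rightarrow> real. (\<forall>k. s k > 0) \<and>
    (\<forall>t. tr_fun nonpos ((1 - t) *\<^sub>R A + t *\<^sub>R B) = (\<Sum>k\<in>UNIV. nonpos ((1 - t) * s k + t))) \<and>
    (\<Sum>k\<in>UNIV. s k - 1) = (\<Sum>j\<in>UNIV. Re (entry u (A - B) j j) / b j) \<and>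
    (\<Sum>k\<in>UNIV. (s k - 1)\<^sup>2) = (\<Sum>i\<in>UNIV. \<Sum>j\<in>UNIV. (cmod (entry u (A - B) i j))\<^sup>2 / (b i * b j)) \<and>
    (\<Sum>k\<in>UNIV. ln (s k)) = (\<Sum>i\<in>UNIV. ln (a i)) - (\<Sum>i\<in>UNIV. ln (b i))"
proof -
  note on = eigb_onb[OF b]
  have bp: "b i > 0" for i by (rule positive_definite_eigb[OF B b])
  have ap: "a i > 0" for i by (rule positive_definite_eigb[OF A a])
  have hA: "hermitian A" and hB: "hermitian B" using A B by (auto simp: positive_definite_iff)
  define Q where "Q = spec sqrt b u"
  define R where "R = spec (\<lambda>x. 1 / sqrt x) b u"
  have hQ: "hermitian Q" and hR: "hermitian R" by (simp_all add: Q_def R_def hermitian_spec)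
  have one: "spec (\<lambda>_. 1) b u = mat 1" by (simp add: spec_def onb_resolution[OF on])
  have RQ: "R ** Q = mat 1" and QR: "Q ** R = mat 1"
    unfolding Q_def R_def spec_mult[OF on] one[symmetric]
    using bp by (auto intro!: spec_cong simp: less_imp_neq[THEN not_sym] order_less_imp_le)
  have QQ: "Q ** Q = B"
    unfolding Q_def spec_mult[OF on]
    by (rule trans[OF spec_cong eigb_spec[OF b, symmetric]]) (simp add: bp less_imp_le)
  have Ru: "R *v u j = complex_of_real (1 / sqrt (b j)) *s u j" for j
    unfolding R_def using eigb_eig[OF spec_eigb[OF on]] by blast
  define S where "S = R ** A ** R"
  have hS: "hermitian S"
    using hA hR by (simp add: S_def hermitian_def cadjoint_mult matrix_mul_assoc)
  obtain s e where s: "eigb S s e" by (rule spectral_theorem[OF hS])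
  have QSQ: "Q ** S ** Q = A"
  proof -
    have "Q ** S ** Q = (Q ** R) ** A ** (R ** Q)" unfolding S_def by (simp only: matrix_mul_assoc)
    then show ?thesis by (simp add: RQ QR)
  qed
  have RBR: "R ** B ** R = mat 1"
  proof -
    have "R ** B ** R = (R ** Q) ** (Q ** R)" unfolding QQ[symmetric] by (simp only: matrix_mul_assoc)
    then show ?thesis by (simp add: RQ QR)
  qed
  have S1: "S - mat 1 = R ** (A - B) ** R"
    unfolding S_def RBR[symmetric] by (simp add: matrix_diff_ldistrib_c matrix_diff_rdistrib_c)
  have eS1: "eigb (S - mat 1) (\<lambda>k. s k - 1) e"
    using eigb_shift[OF s, of "-1"] by simp
  have ent: "entry u (S - mat 1) i j = entry u (A - B) i j / complex_of_real (sqrt (b i) * sqrt (b j))" for i j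
  proof -
    have "entry u (S - mat 1) i j = cip ((A - B) *v (R *v u j)) (R *v u i)"
      unfolding entry_def S1 using cip_hermitian[OF hR] by (simp add: matrix_vector_mul_assoc[symmetric])
    then show ?thesis by (simp add: Ru entry_def matrix_vec_scale)
  qed
  have sp: "s k > 0" for k
  proof -
    have "positive_definite S"
      unfolding positive_definite_def
    proof (intro conjI allI impI hS)
      fix v :: "complex^'n" assume "v \<noteq> 0"
      then have "R *v v \<noteq> 0"
        using QR by (metis matrix_vector_mul_assoc matrix_vector_mul_lid matrix_vector_mult_0_right)
      then have "0 < (R *v v) \<bullet> (A *v (R *v v))" using A by (simp add: positive_definite_def)
      then show "0 < v \<bullet> (S *v v)"
        unfolding S_def using inner_hermitian[OF hR, of v] by (simp add: matrix_vector_mul_assoc[symmetric])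
    qed
    then show ?thesis using positive_definite_eigb s by blast
  qed
  have cnt: "tr_fun nonpos ((1 - t) *\<^sub>R A + t *\<^sub>R B) = (\<Sum>k\<in>UNIV. nonpos ((1 - t) * s k + t))" for t
  proof -
    define M where "M = (1 - t) *\<^sub>R S + t *\<^sub>R mat 1"
    have M: "eigb M (\<lambda>k. (1 - t) * s k + t) e" unfolding M_def by (rule eigb_affine[OF s])
    have "Q ** M ** Q = (1 - t) *\<^sub>R A + t *\<^sub>R B"
      by (simp add: M_def matrix_add_ldistrib matrix_add_rdistrib_c matrix_mult_scaleR QSQ QQ)
    then show ?thesis
      using congruence_nonpositive[OF eigb_hermitian[OF M] hQ hR RQ] tr_fun_eq[OF M] by simp
  qed
  have "(\<Sum>k\<in>UNIV. s k - 1) = mat 1 \<bullet> (S - mat 1)"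
    using tr_fun_eq[OF eS1, of "\<lambda>x. x"] by (simp add: tr_fun_def mat_fun_eq[OF eS1] eigb_spec[OF eS1, symmetric])
  also have "\<dots> = (S - mat 1) \<bullet> (\<Sum>j\<in>UNIV. rank1 (u j))"
    by (simp add: onb_resolution[OF on] inner_commute)
  also have "\<dots> = (\<Sum>j\<in>UNIV. Re (entry u (S - mat 1) j j))"
    by (simp add: inner_sum_right inner_rank1 entry_def inner_eq_Re_cip flip: cnj_cip[of "u _"])
  also have "\<dots> = (\<Sum>j\<in>UNIV. Re (entry u (A - B) j j) / b j)"
    using bp by (simp add: ent less_imp_le Re_divide_of_real del: of_real_mult)
  finally have tr: "(\<Sum>k\<in>UNIV. s k - 1) = \<dots>" .
  have "(\<Sum>k\<in>UNIV. (s k - 1)\<^sup>2) = (S - mat 1) \<bullet> (S - mat 1)"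
    using spec_inner_self[OF eigb_onb[OF eS1], of "\<lambda>x. x" "\<lambda>k. s k - 1" "\<lambda>x. x"]
    by (simp add: eigb_spec[OF eS1, symmetric] power2_eq_square)
  also have "\<dots> = (\<Sum>i\<in>UNIV. \<Sum>j\<in>UNIV. (cmod (entry u (A - B) i j))\<^sup>2 / (b i * b j))"
    unfolding inner_entries[OF on] power2_norm_eq_inner[symmetric] ent
    using bp by (simp add: norm_divide power_divide power_mult_distrib norm_mult less_imp_le)
  finally have tr2: "(\<Sum>k\<in>UNIV. (s k - 1)\<^sup>2) = \<dots>" .
  have "det A = det S * det B"
    unfolding QSQ[symmetric] QQ[symmetric] det_mul by simp
  then have "complex_of_real (\<Prod>i\<in>UNIV. a i) = complex_of_real ((\<Prod>i\<in>UNIV. s i) * (\<Prod>i\<in>UNIV. b i))"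
    by (simp only: det_eigb[OF a] det_eigb[OF s] det_eigb[OF b] of_real_mult)
  then have "(\<Prod>i\<in>UNIV. a i) = (\<Prod>i\<in>UNIV. s i) * (\<Prod>i\<in>UNIV. b i)"
    by (simp only: of_real_eq_iff)
  then have "ln (\<Prod>i\<in>UNIV. a i) = ln (\<Prod>i\<in>UNIV. s i) + ln (\<Prod>i\<in>UNIV. b i)"
    using sp bp by (simp add: ln_mult_pos prod_pos)
  then have lnd: "(\<Sum>k\<in>UNIV. ln (s k)) = (\<Sum>i\<in>UNIV. ln (a i)) - (\<Sum>i\<in>UNIV. ln (b i))"
    using sp bp ap by (simp add: ln_prod less_imp_neq[THEN not_sym])
  show ?thesis
    by (intro exI[of _ s] conjI allI) (fact sp cnt tr tr2 lnd)+
qed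


section \<open>Scalar integrals\<close>

lemma integrable_inverse_one_plus_square: "integrable lborel (\<lambda>t::real. 1 / (1 + t\<^sup>2))"
proof -
  have nz: "1 + x\<^sup>2 \<noteq> 0" for x :: real
    using zero_le_power2[of x] by linarith
  have "set_integrable lborel (einterval (-\<infinity>) \<infinity>) (\<lambda>t::real. 1 / (1 + t\<^sup>2))"
    by (rule interval_integral_FTC_nonneg[where F = arctan and A = "- (pi / 2)" and B = "pi / 2"])
      (auto simp: nz ereal_tendsto_simps inverse_eq_divide
        intro!: derivative_eq_intros continuous_intros tendsto_arctan_at_bot tendsto_arctan_at_top)
  then show ?thesis by (simp add: set_integrable_def)
qed

lemma has_bochner_integral_layer:
  "has_bochner_integral lborel (\<lambda>\<tau>. indicator {0..} \<tau> * (\<tau> * nonpos (x + \<tau>))) ((nprt x)\<^sup>2 / 2)"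
proof -
  have "has_bochner_integral lborel (\<lambda>\<tau>. \<tau> * indicator {0..nprt x} \<tau>) ((nprt x)\<^sup>2 / 2 - 0\<^sup>2 / 2)"
    by (rule has_bochner_integral_FTC_Icc_nonneg[where F = "\<lambda>\<tau>. \<tau>\<^sup>2 / 2"])
      (auto simp: nprt_def intro!: derivative_eq_intros continuous_intros)
  moreover have "(\<lambda>\<tau>. \<tau> * indicator {0..nprt x} \<tau>) = (\<lambda>\<tau>. indicator {0..} \<tau> * (\<tau> * nonpos (x + \<tau>)))"
    by (auto simp: fun_eq_iff nonpos_def nprt_def indicator_def)
  ultimately show ?thesis by simp
qed

text \<open>Signed: negative for t < 0 and positive for t > 1, the two regions in which (1 - t) A +
  t B can fail to be positive.\<close>

definition weight :: "real \<Rightarrow> real" where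
  "weight t = 1 / (\<bar>t\<bar> * (t - 1) ^ 3)"

lemma weight_measurable [measurable]: "weight \<in> borel_measurable borel"
  unfolding weight_def[abs_def] by measurable

lemma nonpos_measurable [measurable]: "nonpos \<in> borel_measurable borel"
  unfolding nonpos_def[abs_def] by measurable

text \<open>The condition (1 - t) s + t <= 0 cuts out a half-line: t >= s / (s - 1) if s > 1, t <=
  -s / (1 - s) if s < 1, nothing if s = 1. At its endpoint a partial-fraction primitive takes, up to
  sign, the second-order Taylor remainder of log at 1 as its value.\<close>

lemma has_bochner_integral_weight:
  assumes s: "s > 0"
  shows "has_bochner_integral lborel (\<lambda>t. weight t * nonpos ((1 - t) * s + t))
    (ln s - (s - 1) + (s - 1)\<^sup>2 / 2)"
proof -
  consider "s = 1" | "s > 1" | "s < 1" by linarith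
  then show ?thesis
  proof cases
    case 1
    then show ?thesis using has_bochner_integral_zero by (simp add: nonpos_def)
  next
    case 2
    define a where "a = s / (s - 1)"
    have a1: "a > 1" using 2 by (simp add: a_def field_simps)
    have am: "a - 1 = 1 / (s - 1)" using 2 by (simp add: a_def field_simps)
    \<comment> \<open>Partial-fraction primitive of 1 / (t (t - 1)^3), normalised to vanish at
      infinity.\<close>
    define F where "F = (\<lambda>t. - (ln t - ln (t - 1) - 1 / (t - 1) + 1 / (2 * (t - 1)\<^sup>2)) :: real)"
    have deriv: "(F has_real_derivative weight t) (at t)" if "t > 1" for t
    proof -
      have "(F has_real_derivative - (1 / t - 1 / (t - 1) - (0 * (t - 1) - 1 * 1) / ((t - 1) * (t - 1))
          + (0 * (2 * (t - 1)\<^sup>2) - 1 * (2 * (2 * (t - 1)))) / ((2 * (t - 1)\<^sup>2) * (2 * (t - 1)\<^sup>2)))) (at t)"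
        unfolding F_def using that by (auto intro!: derivative_eq_intros)
      moreover have "- (1 / t - 1 / (t - 1) - (0 * (t - 1) - 1 * 1) / ((t - 1) * (t - 1))
          + (0 * (2 * (t - 1)\<^sup>2) - 1 * (2 * (2 * (t - 1)))) / ((2 * (t - 1)\<^sup>2) * (2 * (t - 1)\<^sup>2))) = weight t"
      proof -
        define u where "u = t - 1"
        have u: "u > 0" "t = u + 1" using that by (auto simp: u_def)
        have "(0 * (2 * u\<^sup>2) - 1 * (2 * (2 * u))) / ((2 * u\<^sup>2) * (2 * u\<^sup>2)) = - (1 / u ^ 3)"
          using u(1) by (simp add: field_simps power2_eq_square power3_eq_cube)
        moreover have "- (1 / (u + 1) - 1 / u - (0 * u - 1 * 1) / (u * u) + - (1 / u ^ 3)) = 1 / ((u + 1) * u ^ 3)"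
          using u(1) by (simp add: divide_simps power3_eq_cube)
        ultimately show ?thesis unfolding weight_def using u by simp
      qed
      ultimately show ?thesis by simp
    qed
    have cont: "isCont weight t" if "t > 1" for t
      unfolding weight_def[abs_def] using that by (intro continuous_intros) auto
    have Fa: "F a = - (ln s - (s - 1) + (s - 1)\<^sup>2 / 2)"
    proof -
      have "ln a = ln s - ln (s - 1)" using 2 s by (simp add: a_def ln_div)
      moreover have "ln (a - 1) = - ln (s - 1)" using 2 by (simp add: am ln_div)
      moreover have "1 / (a - 1) = s - 1" "1 / (2 * (a - 1)\<^sup>2) = (s - 1)\<^sup>2 / 2"
        by (simp_all add: am power_divide)
      ultimately show ?thesis by (simp add: F_def)
    qed
    have Fat: "(F \<longlongrightarrow> F a) (at_right a)"
      using DERIV_isCont[OF deriv[OF a1]] by (simp add: isCont_def filterlim_at_split)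
    have Finf: "(F \<longlongrightarrow> 0) at_top" unfolding F_def by real_asymp
    note * = interval_integral_FTC_nonneg[where a = "ereal a" and b = \<infinity> and F = F and f = weight and A = "F a" and B = 0]
    have "set_integrable lborel (einterval (ereal a) \<infinity>) weight"
      by (rule *) (use a1 deriv cont Fat Finf in \<open>auto simp: ereal_tendsto_simps weight_def\<close>)
    moreover have "(LBINT t=ereal a..\<infinity>. weight t) = 0 - F a"
      by (rule *) (use a1 deriv cont Fat Finf in \<open>auto simp: ereal_tendsto_simps weight_def\<close>)
    ultimately have "has_bochner_integral lborel (\<lambda>t. indicator (einterval (ereal a) \<infinity>) t *\<^sub>R weight t) (- F a)"
      by (simp add: has_bochner_integral_iff set_integrable_def interval_lebesgue_integral_def set_lebesgue_integral_def)
    moreover have "AE t in lborel. indicator (einterval (ereal a) \<infinity>) t *\<^sub>R weight t = weight t * nonpos ((1 - t) * s + t)"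
      using AE_lborel_singleton[of a]
    proof eventually_elim
      case (elim t)
      have "(1 - t) * s + t \<le> 0 \<longleftrightarrow> a \<le> t"
        using 2 by (simp add: a_def field_simps)
      then show ?case using elim by (auto simp: nonpos_def einterval_def indicator_def)
    qed
    ultimately have "has_bochner_integral lborel (\<lambda>t. weight t * nonpos ((1 - t) * s + t)) (- F a)"
      by (subst (asm) has_bochner_integral_cong_AE) auto
    moreover have "- F a = ln s - (s - 1) + (s - 1)\<^sup>2 / 2" by (simp add: Fa)
    ultimately show ?thesis by (simp only:)
  next
    case 3
    define a where "a = - s / (1 - s)"
    have a1: "a < 0" using 3 s by (simp add: a_def field_simps)
    have am: "1 - a = 1 / (1 - s)" using 3 by (simp add: a_def field_simps)
    \<comment> \<open>The same primitive with \<open>ln\<close> of absolute values. For t < 0 the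
      weight is nonpositive while the fundamental theorem used below asks for a nonnegative
      integrand, so \<open>- weight\<close> is integrated.\<close>
    define F where "F = (\<lambda>t. - (ln (- t) - ln (1 - t) + 1 / (1 - t) + 1 / (2 * (1 - t)\<^sup>2)) :: real)"
    have deriv: "(F has_real_derivative - weight t) (at t)" if "t < 0" for t
    proof -
      have D: "(F has_real_derivative - (1 / t + 1 / (1 - t) + (0 * (1 - t) - 1 * (- 1)) / ((1 - t) * (1 - t))
          + (0 * (2 * (1 - t)\<^sup>2) - 1 * (2 * (2 * (1 - t) * (- 1)))) / ((2 * (1 - t)\<^sup>2) * (2 * (1 - t)\<^sup>2)))) (at t)"
        unfolding F_def using that by (auto intro!: derivative_eq_intros)
      have raw: "(0 * u - 1 * (- 1)) / (u * u) = 1 / u\<^sup>2"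
          "(0 * (2 * u\<^sup>2) - 1 * (2 * (2 * u * (- 1)))) / ((2 * u\<^sup>2) * (2 * u\<^sup>2)) = 1 / u ^ 3" if "u > 0" for u :: real
        using that by (simp_all add: power2_eq_square power3_eq_cube)
      have w: "1 / t + 1 / (1 - t) + 1 / (1 - t)\<^sup>2 + 1 / (1 - t) ^ 3 = weight t"
      proof -
        have "(t - 1) ^ 3 = - ((1 - t) ^ 3)" by (simp add: power3_eq_cube algebra_simps)
        then have "weight t = 1 / (t * (1 - t) ^ 3)" using that by (simp add: weight_def)
        also have "\<dots> = 1 / t + 1 / (1 - t) + 1 / (1 - t)\<^sup>2 + 1 / (1 - t) ^ 3"
          using that by (simp add: divide_simps) (simp add: algebra_simps power2_eq_square power3_eq_cube)
        finally show ?thesis by simp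
      qed
      have "1 - t > 0" using that by simp
      then show ?thesis using D unfolding raw[OF \<open>1 - t > 0\<close>] w by simp
    qed
    have cont: "isCont weight t" if "t < 0" for t
      unfolding weight_def[abs_def] using that by (intro continuous_intros) auto
    have Fa: "F a = - (ln s - (s - 1) + (s - 1)\<^sup>2 / 2)"
    proof -
      have "ln (- a) = ln s - ln (1 - s)" using 3 s by (simp add: a_def ln_div)
      moreover have "ln (1 - a) = - ln (1 - s)" using 3 by (simp add: am ln_div)
      moreover have "1 / (1 - a) = 1 - s" "1 / (2 * (1 - a)\<^sup>2) = (s - 1)\<^sup>2 / 2"
        by (simp_all add: am power_divide power2_commute)
      ultimately show ?thesis by (simp add: F_def)
    qed
    have Fat: "(F \<longlongrightarrow> F a) (at_left a)"
      using DERIV_isCont[OF deriv[OF a1]] by (simp add: isCont_def filterlim_at_split)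
    have Finf: "(F \<longlongrightarrow> 0) at_bot" unfolding F_def by real_asymp
    have pos: "- weight t \<ge> 0" if "t < 0" for t
    proof -
      have "(t - 1) ^ 3 \<le> 0" using that by (simp add: power_le_zero_eq)
      then show ?thesis by (simp add: weight_def mult_nonneg_nonpos divide_le_0_iff)
    qed
    note * = interval_integral_FTC_nonneg[where a = "-\<infinity>" and b = "ereal a" and F = F and f = "\<lambda>t. - weight t" and A = 0 and B = "F a"]
    have "set_integrable lborel (einterval (-\<infinity>) (ereal a)) (\<lambda>t. - weight t)"
      by (rule *) (use a1 deriv cont Fat Finf pos in \<open>auto simp: ereal_tendsto_simps intro!: continuous_intros simp del: neg_0_le_iff_le\<close>)
    moreover have "(LBINT t=-\<infinity>..ereal a. - weight t) = F a - 0"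
      by (rule *) (use a1 deriv cont Fat Finf pos in \<open>auto simp: ereal_tendsto_simps intro!: continuous_intros simp del: neg_0_le_iff_le\<close>)
    ultimately have "has_bochner_integral lborel (\<lambda>t. - (indicator (einterval (-\<infinity>) (ereal a)) t *\<^sub>R (- weight t))) (- F a)"
      by (intro has_bochner_integral_minus)
        (simp add: has_bochner_integral_iff set_integrable_def interval_lebesgue_integral_def set_lebesgue_integral_def)
    moreover have "AE t in lborel. - (indicator (einterval (-\<infinity>) (ereal a)) t *\<^sub>R (- weight t)) = weight t * nonpos ((1 - t) * s + t)"
      using AE_lborel_singleton[of a]
    proof eventually_elim
      case (elim t)
      have "(1 - t) * s + t \<le> 0 \<longleftrightarrow> t \<le> a"
        using 3 by (simp add: a_def field_simps)
      then show ?case using elim by (auto simp: nonpos_def einterval_def indicator_def)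
    qed
    ultimately have "has_bochner_integral lborel (\<lambda>t. weight t * nonpos ((1 - t) * s + t)) (- F a)"
      by (subst (asm) has_bochner_integral_cong_AE) auto
    moreover have "- F a = ln s - (s - 1) + (s - 1)\<^sup>2 / 2" by (simp add: Fa)
    ultimately show ?thesis by (simp only:)
  qed
qed

section \<open>The second-order remainder along the identity direction\<close>

definition int_xlogx :: "real \<Rightarrow> real" where
  "int_xlogx x = x\<^sup>2 * ln x / 2 - x\<^sup>2 / 4"

lemma deriv_xlogx: "x > 0 \<Longrightarrow> (xlogx has_real_derivative ln x + 1) (at x)"
  unfolding xlogx_def[abs_def] by (auto intro!: derivative_eq_intros)

lemma deriv_int_xlogx: "x > 0 \<Longrightarrow> (int_xlogx has_real_derivative xlogx x) (at x)"
  unfolding int_xlogx_def[abs_def] xlogx_def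
  by (auto intro!: derivative_eq_intros simp: power2_eq_square add_divide_distrib)

lemma deriv_shift: "(g has_real_derivative D) (at (x + \<tau>)) \<Longrightarrow> ((\<lambda>\<tau>. g (x + \<tau>)) has_real_derivative D) (at \<tau>)"
  using DERIV_shift[of g D \<tau> x] by (simp add: add.commute)

text \<open>If \<open>\<phi>\<close> is a function of \<open>\<tau>\<close>, then \<open>\<tau> \<phi>' - \<phi>\<close> is a primitive of \<open>\<tau> \<phi>''\<close>. The next three
  functions are of this form, for \<^const>\<open>int_xlogx\<close>, \<^const>\<open>xlogx\<close> and the divided differences of \<^const>\<open>xlogx\<close>.\<close>

definition prim0 :: "real \<Rightarrow> real \<Rightarrow> real" where
  "prim0 x \<tau> = \<tau> * xlogx (x + \<tau>) - int_xlogx (x + \<tau>)"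

definition prim1 :: "real \<Rightarrow> real \<Rightarrow> real" where
  "prim1 x \<tau> = \<tau> * (ln (x + \<tau>) + 1) - xlogx (x + \<tau>)"

definition prim2 :: "real \<Rightarrow> real \<Rightarrow> real \<Rightarrow> real" where
  "prim2 x y \<tau> = \<tau> * divdiff ln inverse (x + \<tau>) (y + \<tau>) - dxlogx (x + \<tau>) (y + \<tau>)"

lemma deriv_prim0:
  assumes "x + \<tau> > 0"
  shows "(prim0 x has_real_derivative \<tau> * (ln (x + \<tau>) + 1)) (at \<tau>)"
  unfolding prim0_def[abs_def]
  by (auto intro!: derivative_eq_intros deriv_shift[OF deriv_xlogx[OF assms]] deriv_shift[OF deriv_int_xlogx[OF assms]])

lemma deriv_prim1:
  assumes "x + \<tau> > 0"
  shows "(prim1 x has_real_derivative \<tau> / (x + \<tau>)) (at \<tau>)"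
  unfolding prim1_def[abs_def]
  using assms by (auto intro!: derivative_eq_intros deriv_shift[OF deriv_xlogx[OF assms]])

text \<open>Off the diagonal the function is a divided difference of \<open>prim1\<close> in its
  first argument, which reduces both its derivative and its growth to facts about one eigenvalue;
  the diagonal is computed directly.\<close>

lemma deriv_prim2:
  assumes "x + \<tau> > 0" "y + \<tau> > 0"
  shows "(prim2 x y has_real_derivative - \<tau> / ((x + \<tau>) * (y + \<tau>))) (at \<tau>)"
proof (cases "x = y")
  case True
  have "prim2 x y = (\<lambda>\<tau>. \<tau> / (x + \<tau>) - (ln (x + \<tau>) + 1))"
    by (auto simp: prim2_def divdiff_def True divide_inverse)
  moreover have "((\<lambda>\<tau>. \<tau> / (x + \<tau>) - (ln (x + \<tau>) + 1)) has_real_derivative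
      (1 * (x + \<tau>) - \<tau> * 1) / ((x + \<tau>) * (x + \<tau>)) - 1 / (x + \<tau>)) (at \<tau>)"
    using assms by (auto intro!: derivative_eq_intros)
  moreover have "(1 * (x + \<tau>) - \<tau> * 1) / ((x + \<tau>) * (x + \<tau>)) - 1 / (x + \<tau>) = - \<tau> / ((x + \<tau>) * (y + \<tau>))"
    using assms True by (simp add: divide_simps)
  ultimately show ?thesis by simp
next
  case False
  have eq: "prim2 x y = (\<lambda>\<tau>. (prim1 x \<tau> - prim1 y \<tau>) / (x - y))"
    using False by (auto simp: prim2_def prim1_def divdiff_def fun_eq_iff divide_simps) (simp add: algebra_simps)
  have "((\<lambda>\<tau>. (prim1 x \<tau> - prim1 y \<tau>) / (x - y)) has_real_derivative (\<tau> / (x + \<tau>) - \<tau> / (y + \<tau>)) / (x - y)) (at \<tau>)"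
    by (intro DERIV_cdivide DERIV_diff deriv_prim1 assms)
  moreover have "(\<tau> / (x + \<tau>) - \<tau> / (y + \<tau>)) / (x - y) = - \<tau> / ((x + \<tau>) * (y + \<tau>))"
    using assms False by (simp add: divide_simps) (simp add: algebra_simps)
  ultimately show ?thesis by (simp add: eq)
qed

text \<open>Only powers of x up to the second accompany divergent terms. Summed over eigenvalues,
  these powers are the dimension and the first two trace moments, which is where \<open>tr\<close>
  and \<open>tr2\<close> of \<open>remainder_integral\<close> act.\<close>

lemma lim_prim0:
  "((\<lambda>\<tau>. prim0 x \<tau> - (\<tau>\<^sup>2 * ln \<tau> / 2 + \<tau>\<^sup>2 / 4 + \<tau> * x - ln \<tau> / 2 * x\<^sup>2)) \<longlongrightarrow> 0) at_top"
proof -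
  have "prim0 x \<tau> = (\<tau>\<^sup>2 - x\<^sup>2) / 2 * ln (x + \<tau>) + (x + \<tau>)\<^sup>2 / 4" for \<tau>
    by (simp add: prim0_def xlogx_def int_xlogx_def power2_eq_square algebra_simps add_divide_distrib diff_divide_distrib)
  moreover have "((\<lambda>\<tau>. (\<tau>\<^sup>2 - x\<^sup>2) / 2 * ln (x + \<tau>) + (x + \<tau>)\<^sup>2 / 4
      - (\<tau>\<^sup>2 * ln \<tau> / 2 + \<tau>\<^sup>2 / 4 + \<tau> * x - ln \<tau> / 2 * x\<^sup>2)) \<longlongrightarrow> 0) at_top"
    by real_asymp
  ultimately show ?thesis by simp
qed

lemma lim_prim1: "((\<lambda>\<tau>. prim1 x \<tau> - (\<tau> - ln \<tau> * x)) \<longlongrightarrow> 0) at_top"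
  unfolding prim1_def xlogx_def by real_asymp

lemma lim_prim2: "((\<lambda>\<tau>. prim2 x y \<tau> + ln \<tau>) \<longlongrightarrow> 0) at_top"
proof (cases "x = y")
  case True
  have "((\<lambda>\<tau>. \<tau> * inverse (x + \<tau>) - (ln (x + \<tau>) + 1) + ln \<tau>) \<longlongrightarrow> 0) at_top" by real_asymp
  then show ?thesis by (simp add: prim2_def divdiff_def True)
next
  case False
  have eq: "prim2 x y \<tau> + ln \<tau> =
      ((prim1 x \<tau> - (\<tau> - ln \<tau> * x)) - (prim1 y \<tau> - (\<tau> - ln \<tau> * y))) / (x - y)" for \<tau>
    using False by (auto simp: prim2_def prim1_def divdiff_def divide_simps) (simp add: algebra_simps)
  have "((\<lambda>\<tau>. ((prim1 x \<tau> - (\<tau> - ln \<tau> * x)) - (prim1 y \<tau> - (\<tau> - ln \<tau> * y))) / (x - y)) \<longlongrightarrow> (0 - 0) / (x - y)) at_top"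
    by (intro tendsto_divide tendsto_diff lim_prim1 tendsto_const) (use False in auto)
  then show ?thesis by (simp add: eq)
qed

text \<open>Here \<open>c\<close> and \<open>d\<close> stand for the diagonal entries and the
  squared moduli of all entries of A - B in the eigenbasis of B; \<open>tr\<close> and
  \<open>tr2\<close> expand Tr A and Tr A^2 around B. A primitive \<open>G\<close> of
  \<open>\<tau> * \<kappa> \<tau>\<close> vanishes at infinity, and the integral is -G(0).\<close>

lemma remainder_integral:
  fixes a b c :: "'n::finite \<Rightarrow> real" and d :: "'n \<Rightarrow> 'n \<Rightarrow> real"
  assumes a: "\<And>i. a i > 0" and b: "\<And>i. b i > 0"
    and tr: "(\<Sum>i\<in>UNIV. a i) = (\<Sum>i\<in>UNIV. b i) + (\<Sum>i\<in>UNIV. c i)"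
    and tr2: "(\<Sum>i\<in>UNIV. (a i)\<^sup>2) = (\<Sum>i\<in>UNIV. (b i)\<^sup>2) + 2 * (\<Sum>i\<in>UNIV. b i * c i) + (\<Sum>i\<in>UNIV. \<Sum>j\<in>UNIV. d i j)"
    and \<kappa>: "\<And>\<tau>. \<tau> \<ge> 0 \<Longrightarrow> \<kappa> \<tau> = (\<Sum>i\<in>UNIV. ln (a i + \<tau>)) - (\<Sum>i\<in>UNIV. ln (b i + \<tau>))
      - (\<Sum>i\<in>UNIV. c i / (b i + \<tau>)) + (\<Sum>i\<in>UNIV. \<Sum>j\<in>UNIV. d i j / ((b i + \<tau>) * (b j + \<tau>))) / 2"
    and int: "integrable lborel (\<lambda>\<tau>. indicator {0..} \<tau> * (\<tau> * \<kappa> \<tau>))"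
  shows "(\<integral>\<tau>. indicator {0..} \<tau> * (\<tau> * \<kappa> \<tau>) \<partial>lborel) =
    (\<Sum>i\<in>UNIV. int_xlogx (a i)) - (\<Sum>i\<in>UNIV. int_xlogx (b i)) - (\<Sum>i\<in>UNIV. c i * xlogx (b i))
      - (\<Sum>i\<in>UNIV. \<Sum>j\<in>UNIV. d i j * dxlogx (b i) (b j)) / 2"
proof -
  define G where "G = (\<lambda>\<tau>. (\<Sum>i\<in>UNIV. prim0 (a i) \<tau>) - (\<Sum>i\<in>UNIV. prim0 (b i) \<tau>)
      - (\<Sum>i\<in>UNIV. c i * prim1 (b i) \<tau>) - (\<Sum>i\<in>UNIV. \<Sum>j\<in>UNIV. d i j * prim2 (b i) (b j) \<tau>) / 2)"
  define K where "K = (\<lambda>\<tau>. (\<Sum>i\<in>UNIV. ln (a i + \<tau>)) - (\<Sum>i\<in>UNIV. ln (b i + \<tau>))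
      - (\<Sum>i\<in>UNIV. c i / (b i + \<tau>)) + (\<Sum>i\<in>UNIV. \<Sum>j\<in>UNIV. d i j / ((b i + \<tau>) * (b j + \<tau>))) / 2)"
  have pos: "a i + \<tau> > 0" "b i + \<tau> > 0" if "\<tau> \<ge> 0" for i \<tau>
    using a[of i] b[of i] that by auto
  have deriv: "(G has_real_derivative \<tau> * K \<tau>) (at \<tau>)" if \<tau>: "\<tau> \<ge> 0" for \<tau>
  proof -
    have "(G has_real_derivative (\<Sum>i\<in>UNIV. \<tau> * (ln (a i + \<tau>) + 1)) - (\<Sum>i\<in>UNIV. \<tau> * (ln (b i + \<tau>) + 1))
      - (\<Sum>i\<in>UNIV. c i * (\<tau> / (b i + \<tau>)))
      - (\<Sum>i\<in>UNIV. \<Sum>j\<in>UNIV. d i j * (- \<tau> / ((b i + \<tau>) * (b j + \<tau>)))) / 2) (at \<tau>)"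
      unfolding G_def
      by (intro DERIV_diff DERIV_sum DERIV_cdivide DERIV_cmult deriv_prim0 deriv_prim1 deriv_prim2 pos \<tau>)
    then show ?thesis
      by (rule DERIV_cong) (simp add: K_def sum.distrib distrib_left right_diff_distrib sum_distrib_left sum_negf mult.left_commute mult.commute)
  qed
  have cont: "isCont (\<lambda>\<tau>. \<tau> * K \<tau>) \<tau>" if "\<tau> > 0" for \<tau>
    unfolding K_def using pos[of \<tau>] that by (intro continuous_intros) (auto simp: less_imp_neq[THEN not_sym])
  have lim: "(G \<longlongrightarrow> 0) at_top"
  proof -
    \<comment> \<open>\<open>G\<close> with the divergent part of each term removed: every piece
      tends to 0, and the removed parts add up to 0 by \<open>tr\<close> and
      \<open>tr2\<close>.\<close>
    define H where "H = (\<lambda>\<tau>. (\<Sum>i\<in>UNIV. prim0 (a i) \<tau> - (\<tau>\<^sup>2 * ln \<tau> / 2 + \<tau>\<^sup>2 / 4 + \<tau> * a i - ln \<tau> / 2 * (a i)\<^sup>2))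
      - (\<Sum>i\<in>UNIV. prim0 (b i) \<tau> - (\<tau>\<^sup>2 * ln \<tau> / 2 + \<tau>\<^sup>2 / 4 + \<tau> * b i - ln \<tau> / 2 * (b i)\<^sup>2))
      - (\<Sum>i\<in>UNIV. c i * (prim1 (b i) \<tau> - (\<tau> - ln \<tau> * b i)))
      - (\<Sum>i\<in>UNIV. \<Sum>j\<in>UNIV. d i j * (prim2 (b i) (b j) \<tau> + ln \<tau>)) / 2)"
    have "(H \<longlongrightarrow> (\<Sum>i\<in>(UNIV::'n set). 0) - (\<Sum>i\<in>(UNIV::'n set). 0) - (\<Sum>i\<in>UNIV. c i * 0)
        - (\<Sum>i\<in>UNIV. \<Sum>j\<in>UNIV. d i j * 0) / 2) at_top"
      unfolding H_def
      by (intro tendsto_diff tendsto_sum tendsto_divide tendsto_mult tendsto_const lim_prim0 lim_prim1 lim_prim2) auto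
    moreover have "H = G"
    proof
      fix \<tau>
      have "H \<tau> - G \<tau> = - (\<tau> * ((\<Sum>i\<in>UNIV. a i) - (\<Sum>i\<in>UNIV. b i) - (\<Sum>i\<in>UNIV. c i)))
          + ln \<tau> / 2 * ((\<Sum>i\<in>UNIV. (a i)\<^sup>2) - (\<Sum>i\<in>UNIV. (b i)\<^sup>2) - 2 * (\<Sum>i\<in>UNIV. b i * c i) - (\<Sum>i\<in>UNIV. \<Sum>j\<in>UNIV. d i j))"
        by (simp add: H_def G_def sum.distrib sum_subtractf distrib_left right_diff_distrib sum_distrib_left
            sum_distrib_right mult.commute mult.left_commute add_divide_distrib diff_divide_distrib sum_divide_distrib)
      then show "H \<tau> = G \<tau>" using tr tr2 by simp
    qed
    ultimately show ?thesis by simp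
  qed
  have ae: "AE \<tau> in lborel. indicator {0..} \<tau> * (\<tau> * \<kappa> \<tau>) = indicator (einterval 0 \<infinity>) \<tau> *\<^sub>R (\<tau> * K \<tau>)"
    using AE_lborel_singleton[of 0] by eventually_elim (auto simp: K_def \<kappa> einterval_def indicator_def)
  have m: "(\<lambda>\<tau>. indicator (einterval 0 \<infinity>) \<tau> *\<^sub>R (\<tau> * K \<tau>)) \<in> borel_measurable lborel"
    unfolding K_def by measurable
  \<comment> \<open>The integrand may change sign, so the fundamental theorem is used in the form
    that relies on integrability; the hypothesis \<open>int\<close> will come from Fubini's
    theorem.\<close>
  have "set_integrable lborel (einterval 0 \<infinity>) (\<lambda>\<tau>. \<tau> * K \<tau>)"
    unfolding set_integrable_def using int by (rule integrable_cong_AE_imp[OF _ m]) (use ae in \<open>auto elim: eventually_mono\<close>)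
  then have "(LBINT \<tau>=0..\<infinity>. \<tau> * K \<tau>) = 0 - G 0"
  proof (intro interval_integral_FTC_integrable)
    fix \<tau> assume "0 < ereal \<tau>"
    then show "(G has_vector_derivative \<tau> * K \<tau>) (at \<tau>)" "isCont (\<lambda>\<tau>. \<tau> * K \<tau>) \<tau>"
      using deriv[of \<tau>] cont[of \<tau>] by (auto simp: has_real_derivative_iff_has_vector_derivative)
  next
    have "(G \<longlongrightarrow> G 0) (at_right 0)"
      using DERIV_isCont[OF deriv[of 0]] by (simp add: isCont_def filterlim_at_split)
    then show "((G \<circ> real_of_ereal) \<longlongrightarrow> G 0) (at_right 0)"
      by (simp add: ereal_tendsto_simps zero_ereal_def)
    show "((G \<circ> real_of_ereal) \<longlongrightarrow> 0) (at_left \<infinity>)"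
      using lim by (simp add: ereal_tendsto_simps)
  qed auto
  moreover have "(LBINT \<tau>=0..\<infinity>. \<tau> * K \<tau>) = (\<integral>\<tau>. indicator {0..} \<tau> * (\<tau> * \<kappa> \<tau>) \<partial>lborel)"
    unfolding interval_lebesgue_integral_def set_lebesgue_integral_def
    using integral_cong_AE[OF borel_measurable_integrable[OF int] m ae] by simp
  moreover have "- G 0 = (\<Sum>i\<in>UNIV. int_xlogx (a i)) - (\<Sum>i\<in>UNIV. int_xlogx (b i)) - (\<Sum>i\<in>UNIV. c i * xlogx (b i))
      - (\<Sum>i\<in>UNIV. \<Sum>j\<in>UNIV. d i j * dxlogx (b i) (b j)) / 2"
    by (simp add: G_def prim0_def prim1_def prim2_def sum_negf)
  ultimately show ?thesis by simp
qed


section \<open>The segment between the two matrices\<close>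

definition seg :: "complex^'n^'n \<Rightarrow> complex^'n^'n \<Rightarrow> real \<Rightarrow> complex^'n^'n" where
  "seg A B t = (1 - t) *\<^sub>R A + t *\<^sub>R B"

lemma hermitian_seg: "hermitian A \<Longrightarrow> hermitian B \<Longrightarrow> hermitian (seg A B t)"
  unfolding seg_def by (intro hermitian_add hermitian_scaleR)

lemma seg_shift: "seg (A + \<tau> *\<^sub>R mat 1) (B + \<tau> *\<^sub>R mat 1) t = seg A B t + \<tau> *\<^sub>R mat 1"
  by (simp add: seg_def algebra_simps flip: scaleR_add_left)

lemma form_ge_mono: "form_ge l X \<Longrightarrow> m \<le> l \<Longrightarrow> form_ge m X"
  unfolding form_ge_def by (meson mult_right_mono order_trans zero_le_power2)

lemma form_ge_seg_neg:
  assumes "form_ge \<alpha> A" "t \<le> 0"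
  shows "form_ge ((1 - t) * \<alpha> + t * norm B) (seg A B t)"
  using form_ge_combine[OF assms(1) form_ge_norm[of "- B"], of "1 - t" "- t"] assms(2)
  by (simp add: seg_def)

lemma form_ge_seg_pos:
  assumes "form_ge \<beta> B" "t \<ge> 1"
  shows "form_ge (t * \<beta> - (t - 1) * norm A) (seg A B t)"
  using form_ge_combine[OF assms(1) form_ge_norm[of "- A"], of t "t - 1"] assms(2)
  by (simp add: seg_def algebra_simps)

lemma norm_nprt_le:
  fixes X :: "complex^'n^'n"
  assumes "hermitian X" "form_ge (- c) X" "0 \<le> c"
  shows "norm (mat_fun nprt X) \<le> sqrt (real CARD('n)) * c"
proof -
  obtain x u where x: "eigb X x u" by (rule spectral_theorem[OF assms(1)])
  have "(norm (mat_fun nprt X))\<^sup>2 = (\<Sum>i\<in>UNIV. nprt (x i) * nprt (x i))"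
    unfolding mat_fun_eq[OF x] power2_norm_eq_inner by (rule spec_inner_self[OF eigb_onb[OF x]])
  also have "\<dots> \<le> (\<Sum>i\<in>(UNIV :: 'n set). c * c)"
  proof (intro sum_mono mult_mono)
    fix i
    have "- c \<le> x i" using assms(2) eigb_form_ge[OF x] by blast
    then show "nprt (x i) \<le> c" "nprt (x i) \<le> c" using assms(3) by (auto simp: nprt_def)
  qed (auto simp: nprt_def assms(3))
  also have "\<dots> = (sqrt (real CARD('n)) * c)\<^sup>2" by (simp add: power_mult_distrib power2_eq_square)
  finally show ?thesis by (rule power2_le_imp_le) (simp add: assms(3))
qed

lemma nprt_eq_0: "hermitian X \<Longrightarrow> form_ge 0 X \<Longrightarrow> mat_fun nprt X = 0"
  using norm_nprt_le[of X 0] by simp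

text \<open>The segment stays positive beyond [0, 1]: past t = 0 at most |t| |B| is lost against the
  bound \<alpha>, past t = 1 at most (t - 1) |A| against \<beta>. The \<open>+ 1\<close> keeps the
  denominators positive. The bounds may be 0, so singular A are covered, with no margin at t =
  0.\<close>

lemma nprt_seg_eq_0:
  assumes A: "hermitian A" "form_ge \<alpha> A" "0 \<le> \<alpha>" and B: "hermitian B" "form_ge \<beta> B" "0 \<le> \<beta>"
    and t: "- (\<alpha> / (norm B + 1)) \<le> t" "t \<le> 1 + \<beta> / (norm A + 1)"
  shows "mat_fun nprt (seg A B t) = 0"
proof (rule nprt_eq_0[OF hermitian_seg[OF A(1) B(1)]])
  consider "t < 0" | "0 \<le> t" "t \<le> 1" | "t > 1" by linarith
  then show "form_ge 0 (seg A B t)"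
  proof cases
    case 1
    have "- t * (norm B + 1) \<le> \<alpha>" using t(1) by (simp add: field_simps add_pos_nonneg)
    then have "- t * norm B \<le> \<alpha>" using 1 by (simp add: algebra_simps)
    also have "\<alpha> \<le> (1 - t) * \<alpha>" using 1 A(3) by (simp add: algebra_simps mult_nonneg_nonpos)
    finally show ?thesis
      by (intro form_ge_mono[OF form_ge_seg_neg[OF A(2)]]) (use 1 in auto)
  next
    case 2
    then show ?thesis
      unfolding seg_def using form_ge_combine[OF A(2) B(2), of "1 - t" t] A(3) B(3)
      by (auto intro: form_ge_mono)
  next
    case 3
    have "t - 1 \<le> \<beta> / (norm A + 1)" using t(2) by simp
    then have "(t - 1) * (norm A + 1) \<le> \<beta>" by (simp add: pos_le_divide_eq add_nonneg_pos)
    then have "(t - 1) * norm A \<le> \<beta>" using 3 by (simp add: algebra_simps)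
    also have "\<beta> \<le> t * \<beta>" using 3 B(3) by (simp add: mult_le_cancel_right1)
    finally show ?thesis
      by (intro form_ge_mono[OF form_ge_seg_pos[OF B(2)]]) (use 3 in auto)
  qed
qed

text \<open>For t < 0 only the summand t B can be negative, for t > 1 only (1 - t) A. The factor |t|
  of the first bound cancels the singularity of the weight at t = 0, even for singular A.\<close>

lemma norm_nprt_seg_le:
  fixes A B :: "complex^'n^'n"
  assumes A: "hermitian A" "form_ge 0 A" and B: "hermitian B" "form_ge 0 B"
  shows "norm (mat_fun nprt (seg A B t)) \<le> sqrt (real CARD('n)) *
    (if t < 0 then - t * norm B else \<bar>t - 1\<bar> * norm A)"
proof -
  consider "t < 0" | "0 \<le> t" "t \<le> 1" | "t > 1" by linarith
  then show ?thesis
  proof cases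
    case 1
    then have "form_ge (- (- t * norm B)) (seg A B t)"
      using form_ge_seg_neg[OF A(2), of t B] by simp
    from norm_nprt_le[OF hermitian_seg[OF A(1) B(1)] this] 1 show ?thesis by (simp add: mult_nonpos_nonneg)
  next
    case 2
    then have "mat_fun nprt (seg A B t) = 0"
      by (intro nprt_seg_eq_0[OF A _ B]) (auto simp: add_nonneg_nonneg)
    then show ?thesis using 2 by simp
  next
    case 3
    then have "form_ge (- ((t - 1) * norm A)) (seg A B t)"
      using form_ge_seg_pos[OF B(2), of t A] by simp
    from norm_nprt_le[OF hermitian_seg[OF A(1) B(1)] this] 3 show ?thesis by simp
  qed
qed

section \<open>Integrable majorants, uniform in A\<close>

lemma inverse_product_bound:
  fixes t \<mu> :: real
  assumes "\<mu> > 0" "t < - \<mu> \<or> t > 1 + \<mu>"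
  shows "1 / (\<bar>t\<bar> * \<bar>t - 1\<bar>) \<le> 2 * (1 + 1 / \<mu>) / (1 + t\<^sup>2)"
proof -
  have aux: "1 + w \<le> 2 * (q + v)" if "1 \<le> v" "w \<le> q" "0 \<le> q" for v w q :: real
    using that unfolding distrib_left by linarith
  have *: "1 + t\<^sup>2 \<le> 2 * (1 + 1 / \<mu>) * (\<bar>t\<bar> * \<bar>t - 1\<bar>)"
  proof (cases "t < 0")
    case True
    then have p: "- t > \<mu>" using assms by auto
    then have "1 \<le> 1 / \<mu> * (- t)" using assms(1) by (simp add: field_simps)
    also have "\<dots> \<le> 1 / \<mu> * (\<bar>t\<bar> * \<bar>t - 1\<bar>)"
      using True assms(1) by (intro mult_left_mono) (auto simp: algebra_simps mult_le_cancel_right1)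
    finally have "1 \<le> 1 / \<mu> * (\<bar>t\<bar> * \<bar>t - 1\<bar>)" .
    moreover have "t\<^sup>2 \<le> \<bar>t\<bar> * \<bar>t - 1\<bar>" using True by (simp add: power2_eq_square algebra_simps)
    moreover have "0 \<le> \<bar>t\<bar> * \<bar>t - 1\<bar>" by simp
    ultimately have "1 + t\<^sup>2 \<le> 2 * ((1 + 1 / \<mu>) * (\<bar>t\<bar> * \<bar>t - 1\<bar>))"
      unfolding distrib_right mult_1_left by (rule aux)
    then show ?thesis by (simp only: mult.assoc)
  next
    case False
    then have p: "t - 1 > \<mu>" using assms by auto
    then have "1 \<le> 1 / \<mu> * (t - 1)" using assms(1) by (simp add: field_simps)
    then have "t \<le> (1 + 1 / \<mu>) * (t - 1)" by (simp add: algebra_simps)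
    then have "t * t \<le> (1 + 1 / \<mu>) * (t - 1) * t" using p assms(1) by (intro mult_right_mono) auto
    moreover have "1 \<le> t * t" using p assms(1) mult_mono[of 1 t 1 t] by auto
    ultimately have "1 + t\<^sup>2 \<le> 2 * ((1 + 1 / \<mu>) * (t - 1) * t)" unfolding power2_eq_square by linarith
    then show ?thesis using p assms(1) by (simp add: mult.commute mult.left_commute)
  qed
  have "t \<noteq> 0" "t \<noteq> 1" using assms by auto
  then have "\<bar>t\<bar> * \<bar>t - 1\<bar> > 0" by (intro mult_pos_pos) auto
  moreover have "1 + t\<^sup>2 > 0" by (intro add_pos_nonneg) auto
  ultimately show ?thesis using * by (simp add: divide_simps mult.commute)
qed

definition fweight :: "real \<Rightarrow> real" where
  "fweight t = 1 / (\<bar>t\<bar> * (t - 1)\<^sup>2)"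

lemma fweight_nonneg: "0 \<le> fweight t" by (simp add: fweight_def)

text \<open>The factor is that of the gradient in A: x_-^2 / 2 has derivative -x_-, and the segment
  depends on A with coefficient 1 - t.\<close>

lemma fweight_eq: "fweight t = weight t * (t - 1)"
  by (cases "t = 1") (simp_all add: fweight_def weight_def power2_eq_square power3_eq_cube divide_simps)

lemma frenkel_integrand_eq:
  "hermitian A \<Longrightarrow> hermitian B \<Longrightarrow> frenkel_integrand A B t = fweight t *\<^sub>R mat_fun nprt (seg A B t)"
  using neg_part_eq[OF hermitian_seg[of A B t]] by (simp add: frenkel_integrand_def fweight_def seg_def)

text \<open>\<open>C\<close> depends on A only through the norm bound \<open>r\<close>, as dominated
  convergence towards a singular A will require. Near t = 0 the negative part is itself of size |t|;
  near t = 1 the integrand is zero on a margin \<mu> determined by \<open>\<beta>\<close> and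
  \<open>r\<close>.\<close>

lemma frenkel_bounds:
  fixes B :: "complex^'n^'n"
  assumes B: "hermitian B" "form_ge \<beta> B" "0 < \<beta>"
  obtains C where "0 \<le> C"
    "\<And>A t. hermitian A \<Longrightarrow> form_ge 0 A \<Longrightarrow> norm A \<le> r \<Longrightarrow> norm (mat_fun nprt (seg A B t)) \<le> C * \<bar>t - 1\<bar>"
    "\<And>A t. hermitian A \<Longrightarrow> form_ge 0 A \<Longrightarrow> norm A \<le> r \<Longrightarrow> norm (frenkel_integrand A B t) \<le> C / (1 + t\<^sup>2)"
proof -
  define N where "N = sqrt (real CARD('n))"
  \<comment> \<open>Keeps \<open>\<mu>\<close> and \<open>C\<close> of the right sign for negative
    \<open>r\<close>, when no A qualifies.\<close>
  define \<rho> where "\<rho> = max r 0"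
  define \<mu> where "\<mu> = \<beta> / (\<rho> + 1)"
  have \<mu>: "\<mu> > 0" and \<rho>: "\<rho> \<ge> 0" "r \<le> \<rho>" using B(3) by (auto simp: \<mu>_def \<rho>_def)
  have N: "N \<ge> 0" by (simp add: N_def)
  \<comment> \<open>Collects both regimes: |B| from t < 0, and \<rho> times the constant of
    \<open>inverse_product_bound\<close> from t > 1 + \<mu>.\<close>
  define C where "C = N * (norm B + \<rho> * (2 * (1 + 1 / \<mu>)))"
  have C0: "C \<ge> 0" unfolding C_def using N \<rho> \<mu> by (intro mult_nonneg_nonneg add_nonneg_nonneg) auto
  have B0: "form_ge 0 B" using form_ge_mono[OF B(2)] B(3) by simp
  have "norm B \<le> norm B + \<rho> * (2 * (1 + 1 / \<mu>))" using \<rho> \<mu> by simp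
  then have CB: "N * norm B \<le> C" unfolding C_def by (rule mult_left_mono) (rule N)
  have "\<rho> * 1 \<le> \<rho> * (2 * (1 + 1 / \<mu>))" using \<rho> \<mu> by (intro mult_left_mono) auto
  then have "\<rho> \<le> norm B + \<rho> * (2 * (1 + 1 / \<mu>))" using norm_ge_zero[of B] by linarith
  then have C\<rho>: "N * \<rho> \<le> C" unfolding C_def by (rule mult_left_mono) (rule N)
  have "\<rho> * (2 * (1 + 1 / \<mu>)) \<le> norm B + \<rho> * (2 * (1 + 1 / \<mu>))" by simp
  then have C2: "N * (\<rho> * (2 * (1 + 1 / \<mu>))) \<le> C" unfolding C_def by (rule mult_left_mono) (rule N)
  have pos: "0 < 1 + t\<^sup>2" for t :: real by (intro add_pos_nonneg) auto
  show ?thesis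
  proof (rule that[OF C0])
    fix A :: "complex^'n^'n" and t :: real
    assume A: "hermitian A" "form_ge 0 A" "norm A \<le> r"
    have A\<rho>: "norm A \<le> \<rho>" using A(3) \<rho> by simp
    have bd: "norm (mat_fun nprt (seg A B t)) \<le> N * (if t < 0 then - t * norm B else \<bar>t - 1\<bar> * norm A)"
      unfolding N_def by (rule norm_nprt_seg_le[OF A(1,2) B(1) B0])
    also have "\<dots> \<le> C * \<bar>t - 1\<bar>"
    proof (cases "t < 0")
      case True
      have "N * norm B * (- t) \<le> C * \<bar>t - 1\<bar>" using CB C0 True N by (intro mult_mono) auto
      then show ?thesis using True by (simp add: algebra_simps)
    next
      case False
      have "N * norm A \<le> C" using C\<rho> mult_left_mono[OF A\<rho> N] by linarith
      then have "N * norm A * \<bar>t - 1\<bar> \<le> C * \<bar>t - 1\<bar>" by (intro mult_right_mono) auto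
      then show ?thesis using False by (simp add: mult.assoc mult.left_commute mult.commute)
    qed
    finally show "norm (mat_fun nprt (seg A B t)) \<le> C * \<bar>t - 1\<bar>" .
    show "norm (frenkel_integrand A B t) \<le> C / (1 + t\<^sup>2)"
    proof (cases "0 \<le> t \<and> t \<le> 1 + \<mu>")
      case True
      have "\<mu> \<le> \<beta> / (norm A + 1)"
        unfolding \<mu>_def using A\<rho> B(3) by (intro divide_left_mono) (auto intro!: mult_pos_pos add_nonneg_pos \<rho>)
      then have "mat_fun nprt (seg A B t) = 0"
        using True B(3) by (intro nprt_seg_eq_0[OF A(1,2) _ B(1,2)]) auto
      then show ?thesis using C0 pos[of t] by (simp add: frenkel_integrand_eq[OF A(1) B(1)])
    next
      case False
      have "norm (frenkel_integrand A B t) = fweight t * norm (mat_fun nprt (seg A B t))"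
        by (simp add: frenkel_integrand_eq[OF A(1) B(1)] fweight_nonneg)
      also have "\<dots> \<le> fweight t * (N * (if t < 0 then - t * norm B else \<bar>t - 1\<bar> * norm A))"
        by (intro mult_left_mono bd fweight_nonneg)
      also have "\<dots> \<le> C / (1 + t\<^sup>2)"
      proof (cases "t < 0")
        case True
        have "fweight t * (N * (- t * norm B)) = N * norm B / (t - 1)\<^sup>2"
          using True by (simp add: fweight_def divide_simps)
        also have "\<dots> \<le> C / (1 + t\<^sup>2)"
          using CB N True C0 by (intro frac_le pos) (auto simp: power2_eq_square algebra_simps)
        finally show ?thesis using True by simp
      next
        case False': False
        then have t: "t > 1 + \<mu>" using False by simp
        have "fweight t * (N * (\<bar>t - 1\<bar> * norm A)) = N * norm A * (1 / (\<bar>t\<bar> * \<bar>t - 1\<bar>))"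
          using t \<mu> by (simp add: fweight_def power2_eq_square divide_simps)
        also have "\<dots> \<le> N * \<rho> * (2 * (1 + 1 / \<mu>) / (1 + t\<^sup>2))"
          by (intro mult_mono inverse_product_bound mult_left_mono[OF A\<rho> N] mult_nonneg_nonneg N \<rho> \<mu>) (use t in auto)
        also have "\<dots> = N * (\<rho> * (2 * (1 + 1 / \<mu>))) / (1 + t\<^sup>2)" by simp
        also have "\<dots> \<le> C / (1 + t\<^sup>2)" using C2 pos[of t] by (intro divide_right_mono) auto
        finally show ?thesis using False' by simp
      qed
      finally show ?thesis .
    qed
  qed
qed

section \<open>Measurability and integrability\<close>

lemma nprt_lipschitz: "\<bar>nprt y - nprt x\<bar> \<le> 1 * \<bar>y - x\<bar>"
  by (auto simp: nprt_def)

lemma continuous_on_mat_fun_lipschitz: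
  assumes "continuous_on S X" "\<And>z. hermitian (X z)" "\<And>x y. \<bar>g y - g x\<bar> \<le> L * \<bar>y - x\<bar>" "L \<ge> 0"
  shows "continuous_on S (\<lambda>z. mat_fun g (X z))"
  unfolding continuous_on_def
proof
  fix z assume "z \<in> S"
  then have "(X \<longlongrightarrow> X z) (at z within S)" using assms(1) by (simp add: continuous_on_def)
  then have "((\<lambda>y. L * norm (X y - X z)) \<longlongrightarrow> L * norm (X z - X z)) (at z within S)"
    by (intro tendsto_intros)
  then have lim: "((\<lambda>y. L * norm (X y - X z)) \<longlongrightarrow> 0) (at z within S)" by simp
  have "norm (norm (mat_fun g (X y) - mat_fun g (X z))) \<le> L * norm (X y - X z)" for y
    unfolding real_norm_def abs_norm_cancel by (rule mat_fun_lipschitz[OF assms(2) assms(2) assms(3) assms(4)])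
  then have "((\<lambda>y. norm (mat_fun g (X y) - mat_fun g (X z))) \<longlongrightarrow> 0) (at z within S)"
    by (rule Lim_null_comparison[OF always_eventually[OF allI] lim])
  then show "((\<lambda>y. mat_fun g (X y)) \<longlongrightarrow> mat_fun g (X z)) (at z within S)"
    by (rule LIM_zero_cancel[OF tendsto_norm_zero_cancel])
qed

lemma continuous_nprt_seg:
  "hermitian A \<Longrightarrow> hermitian B \<Longrightarrow> continuous_on UNIV (\<lambda>t. mat_fun nprt (seg A B t))"
proof (rule continuous_on_mat_fun_lipschitz[OF _ _ nprt_lipschitz])
  show "continuous_on UNIV (seg A B)" unfolding seg_def[abs_def] by (intro continuous_intros)
qed (auto intro: hermitian_seg)

lemma frenkel_measurable [measurable]:
  assumes "hermitian A" "hermitian B"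
  shows "frenkel_integrand A B \<in> borel_measurable borel"
proof -
  have "(\<lambda>t. mat_fun nprt (seg A B t)) \<in> borel_measurable borel"
    by (intro borel_measurable_continuous_onI continuous_nprt_seg assms)
  moreover have "fweight \<in> borel_measurable borel" unfolding fweight_def[abs_def] by measurable
  moreover have "frenkel_integrand A B = (\<lambda>t. fweight t *\<^sub>R mat_fun nprt (seg A B t))"
    by (rule ext) (rule frenkel_integrand_eq[OF assms])
  ultimately show ?thesis by (simp only: borel_measurable_scaleR)
qed

lemma frenkel_integrable:
  assumes A: "hermitian A" "form_ge 0 A" and B: "hermitian B" "form_ge \<beta> B" "0 < \<beta>"
  shows "integrable lborel (frenkel_integrand A B)"
proof -
  obtain C where C: "0 \<le> C" "\<And>t. norm (frenkel_integrand A B t) \<le> C / (1 + t\<^sup>2)"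
    using frenkel_bounds[OF B, of "norm A"] A by (metis order_refl)
  have "integrable lborel (\<lambda>t::real. C * (1 / (1 + t\<^sup>2)))"
    by (intro integrable_mult_right integrable_inverse_one_plus_square)
  then show ?thesis
    by (rule Bochner_Integration.integrable_bound)
      (use C frenkel_measurable[OF A(1) B(1)] in \<open>auto intro!: AE_I2 order_trans[OF C(2)]\<close>)
qed

text \<open>The step function \<^const>\<open>nonpos\<close> is a pointwise limit of Lipschitz functions.\<close>

lemma tr_fun_nonpos_measurable:
  fixes X :: "'a::topological_space \<Rightarrow> complex^'n^'n"
  assumes "continuous_on UNIV X" "\<And>z. hermitian (X z)"
  shows "(\<lambda>z. tr_fun nonpos (X z)) \<in> borel_measurable borel"
proof (rule borel_measurable_LIMSEQ_real)
  let ?g = "\<lambda>k x. max 0 (1 - real k * max 0 x)"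
  fix z
  obtain a u where a: "eigb (X z) a u" by (rule spectral_theorem[OF assms(2)])
  have "(\<lambda>k. ?g k x) \<longlonglongrightarrow> nonpos x" for x :: real
  proof (cases "x \<le> 0")
    case False
    have "\<forall>\<^sub>F k in sequentially. real k > 1 / x"
      using filterlim_real_sequentially by (auto simp: filterlim_at_top_dense)
    then have "\<forall>\<^sub>F k in sequentially. ?g k x = nonpos x"
      by eventually_elim (use False in \<open>auto simp: nonpos_def field_simps\<close>)
    then show ?thesis by (rule tendsto_eventually)
  qed (simp add: nonpos_def)
  then show "(\<lambda>k. tr_fun (?g k) (X z)) \<longlonglongrightarrow> tr_fun nonpos (X z)"
    unfolding tr_fun_eq[OF a] by (intro tendsto_sum)
next
  fix k :: nat
  have "continuous_on UNIV (\<lambda>z. mat_fun (\<lambda>x. max 0 (1 - real k * max 0 x)) (X z))"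
  proof (rule continuous_on_mat_fun_lipschitz[OF assms, where L = "real k"])
    fix x y :: real
    have "\<bar>max 0 (1 - real k * max 0 y) - max 0 (1 - real k * max 0 x)\<bar> \<le> \<bar>real k * max 0 y - real k * max 0 x\<bar>"
      by linarith
    also have "\<dots> = real k * \<bar>max 0 y - max 0 x\<bar>" by (simp add: abs_mult flip: right_diff_distrib)
    also have "\<dots> \<le> real k * \<bar>y - x\<bar>" by (intro mult_left_mono) auto
    finally show "\<bar>max 0 (1 - real k * max 0 y) - max 0 (1 - real k * max 0 x)\<bar> \<le> real k * \<bar>y - x\<bar>" .
  qed simp
  then show "(\<lambda>z. tr_fun (\<lambda>x. max 0 (1 - real k * max 0 x)) (X z)) \<in> borel_measurable borel"
    unfolding tr_fun_def by (intro borel_measurable_continuous_onI continuous_intros)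
qed

section \<open>The trace formula\<close>

lemma half_norm_nprt: "hermitian T \<Longrightarrow> (norm (mat_fun nprt T))\<^sup>2 / 2 = tr_fun (\<lambda>x. (nprt x)\<^sup>2 / 2) T"
proof -
  assume "hermitian T"
  then obtain a u where a: "eigb T a u" by (rule spectral_theorem)
  show ?thesis
    unfolding tr_fun_eq[OF a] mat_fun_eq[OF a] power2_norm_eq_inner spec_inner_self[OF eigb_onb[OF a]]
    by (simp add: power2_eq_square sum_divide_distrib)
qed

lemma has_bochner_integral_tr_layer:
  assumes "hermitian T"
  shows "has_bochner_integral lborel (\<lambda>\<tau>. indicator {0..} \<tau> * (\<tau> * tr_fun nonpos (T + \<tau> *\<^sub>R mat 1)))
    ((norm (mat_fun nprt T))\<^sup>2 / 2)"
proof -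
  obtain a u where a: "eigb T a u" by (rule spectral_theorem[OF assms])
  have "has_bochner_integral lborel (\<lambda>\<tau>. \<Sum>i\<in>UNIV. indicator {0..} \<tau> * (\<tau> * nonpos (a i + \<tau>)))
      (\<Sum>i\<in>UNIV. (nprt (a i))\<^sup>2 / 2)"
    by (intro has_bochner_integral_sum has_bochner_integral_layer)
  then show ?thesis
    by (simp add: half_norm_nprt[OF assms] tr_fun_eq[OF a] tr_fun_eq[OF eigb_shift[OF a]] sum_distrib_left)
qed

lemma mat_fun_inner:
  assumes "eigb B b u"
  shows "mat_fun g B \<bullet> M = (\<Sum>j\<in>UNIV. g (b j) * Re (entry u M j j))"
proof -
  have "M \<bullet> rank1 (u j) = Re (entry u M j j)" for j
    using inner_commute[of "u j" "M *v u j"] by (simp add: inner_rank1 entry_def inner_eq_Re_cip)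
  then show ?thesis
    by (simp add: mat_fun_eq[OF assms] spec_def inner_sum_left inner_commute[of "rank1 _"])
qed

theorem trace_formula:
  fixes A B :: "complex^'n^'n"
  assumes A: "positive_definite A" and B: "positive_definite B" and b: "eigb B b u"
  shows "(\<integral>t. weight t * ((norm (mat_fun nprt (seg A B t)))\<^sup>2 / 2) \<partial>lborel) =
      tr_fun int_xlogx A - tr_fun int_xlogx B - mat_fun xlogx B \<bullet> (A - B) - Dxlogx b u (A - B) \<bullet> (A - B) / 2"
    and "integrable lborel (\<lambda>t. weight t * ((norm (mat_fun nprt (seg A B t)))\<^sup>2 / 2))"
proof -
  obtain \<beta> where \<beta>: "\<beta> > 0" "form_ge \<beta> B" using B by (auto simp: positive_definite_iff)
  obtain \<alpha> where \<alpha>: "\<alpha> > 0" "form_ge \<alpha> A" using A by (auto simp: positive_definite_iff)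
  have hA: "hermitian A" and hB: "hermitian B" using A B by (auto simp: positive_definite_iff)
  have A0: "form_ge 0 A" using form_ge_mono[OF \<alpha>(2)] \<alpha>(1) by simp
  obtain a w where a: "eigb A a w" by (rule spectral_theorem[OF hA])
  note on = eigb_onb[OF b]
  have bp: "b i > 0" for i by (rule positive_definite_eigb[OF B b])
  have ap: "a i > 0" for i by (rule positive_definite_eigb[OF A a])
  define c where "c = (\<lambda>j. Re (entry u (A - B) j j))"
  define d where "d = (\<lambda>i j. (cmod (entry u (A - B) i j))\<^sup>2)"
  define \<kappa> where "\<kappa> = (\<lambda>\<tau>. (\<Sum>i\<in>UNIV. ln (a i + \<tau>)) - (\<Sum>i\<in>UNIV. ln (b i + \<tau>))
      - (\<Sum>i\<in>UNIV. c i / (b i + \<tau>)) + (\<Sum>i\<in>UNIV. \<Sum>j\<in>UNIV. d i j / ((b i + \<tau>) * (b j + \<tau>))) / 2)"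
  define q where "q = (\<lambda>t. (norm (mat_fun nprt (seg A B t)))\<^sup>2 / 2)"
  \<comment> \<open>Integrated over \<tau> first, it returns \<open>weight t * q t\<close>;
    integrated over t first, it sees the pencil of A + \<tau> and B + \<tau>.\<close>
  define f where "f = (\<lambda>t \<tau>. weight t * (indicator {0..} \<tau> * (\<tau> * tr_fun nonpos (seg A B t + \<tau> *\<^sub>R mat 1))))"
  have nn: "tr_fun nonpos T \<ge> 0" if "hermitian T" for T :: "complex^'n^'n"
    using spectral_theorem[OF that] tr_fun_nonpos by (metis of_nat_0_le_iff)
  have hseg: "hermitian (seg A B t)" for t by (rule hermitian_seg[OF hA hB])
  have hs: "hermitian (seg A B t + \<tau> *\<^sub>R mat 1)" for t \<tau>
    by (intro hermitian_add hermitian_scaleR hermitian_mat_1 hseg)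
  have "(\<lambda>z. tr_fun nonpos (seg A B (fst z) + snd z *\<^sub>R mat 1)) \<in> borel_measurable (borel :: (real \<times> real) measure)"
  proof (rule tr_fun_nonpos_measurable[OF _ hs])
    show "continuous_on UNIV (\<lambda>z. seg A B (fst z) + snd z *\<^sub>R mat 1 :: complex^'n^'n)"
      unfolding seg_def by (intro continuous_intros)
  qed
  then have trm: "(\<lambda>z. tr_fun nonpos (seg A B (fst z) + snd z *\<^sub>R mat 1)) \<in> borel_measurable (lborel \<Otimes>\<^sub>M lborel)"
    by (simp add: borel_prod measurable_cong_sets[OF sets_pair_measure_cong[OF sets_lborel sets_lborel] refl])
  have fm: "case_prod f \<in> borel_measurable (lborel \<Otimes>\<^sub>M lborel)"
    unfolding f_def split_beta' using trm by measurable
  have inner: "has_bochner_integral lborel (f t) (weight t * q t)" for t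
    unfolding f_def q_def by (intro has_bochner_integral_mult_right has_bochner_integral_tr_layer hseg)
  \<comment> \<open>The layer integrand is nonnegative, so the inner absolute integral merely
    replaces \<open>weight t\<close> by its modulus. The signed weight is thus controlled for
    Fubini's theorem.\<close>
  have inner_norm: "(\<integral>\<tau>. norm (f t \<tau>) \<partial>lborel) = \<bar>weight t\<bar> * q t" for t
  proof -
    have "norm (f t \<tau>) = \<bar>weight t\<bar> * (indicator {0..} \<tau> * (\<tau> * tr_fun nonpos (seg A B t + \<tau> *\<^sub>R mat 1)))" for \<tau>
      using nn[OF hs, of t \<tau>] by (auto simp: f_def abs_mult indicator_def)
    moreover have "has_bochner_integral lborel (\<lambda>\<tau>. \<bar>weight t\<bar> * (indicator {0..} \<tau> * (\<tau> * tr_fun nonpos (seg A B t + \<tau> *\<^sub>R mat 1))))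
        (\<bar>weight t\<bar> * q t)"
      unfolding q_def by (intro has_bochner_integral_mult_right has_bochner_integral_tr_layer hseg)
    ultimately show ?thesis by (simp only: has_bochner_integral_integral_eq)
  qed
  obtain C where C: "0 \<le> C" "\<And>t. norm (mat_fun nprt (seg A B t)) \<le> C * \<bar>t - 1\<bar>"
      "\<And>t. norm (frenkel_integrand A B t) \<le> C / (1 + t\<^sup>2)"
    using frenkel_bounds[OF hB \<beta>(2,1), of "norm A"] hA A0 by (metis order_refl)
  have qm: "q \<in> borel_measurable borel"
    unfolding q_def by (intro borel_measurable_continuous_onI continuous_intros continuous_nprt_seg hA hB) auto
  \<comment> \<open>One of the two norm factors supplies |t - 1|, which converts |weight| to
    \<open>fweight\<close>; the other then completes the norm of the matrix integrand, whose
    majorant is known.\<close>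
  have qb: "\<bar>weight t\<bar> * q t \<le> C\<^sup>2 * (1 / (1 + t\<^sup>2))" for t
  proof (cases "t = 1")
    case False
    have w: "\<bar>weight t\<bar> * \<bar>t - 1\<bar> = fweight t"
      using fweight_eq[of t] fweight_nonneg[of t] by (metis abs_mult abs_of_nonneg)
    have "\<bar>weight t\<bar> * q t = \<bar>weight t\<bar> * norm (mat_fun nprt (seg A B t)) * norm (mat_fun nprt (seg A B t)) / 2"
      by (simp add: q_def power2_eq_square)
    also have "\<dots> \<le> \<bar>weight t\<bar> * norm (mat_fun nprt (seg A B t)) * (C * \<bar>t - 1\<bar>)"
    proof -
      have "\<bar>weight t\<bar> * norm (mat_fun nprt (seg A B t)) * norm (mat_fun nprt (seg A B t)) \<le>
        \<bar>weight t\<bar> * norm (mat_fun nprt (seg A B t)) * (C * \<bar>t - 1\<bar>)"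
        by (intro mult_left_mono C(2)) auto
      moreover have "0 \<le> \<bar>weight t\<bar> * norm (mat_fun nprt (seg A B t)) * norm (mat_fun nprt (seg A B t))" by simp
      ultimately show ?thesis by linarith
    qed
    also have "\<dots> = C * (\<bar>weight t\<bar> * \<bar>t - 1\<bar> * norm (mat_fun nprt (seg A B t)))" by simp
    also have "\<dots> = C * norm (frenkel_integrand A B t)"
      unfolding w by (simp add: frenkel_integrand_eq[OF hA hB] fweight_nonneg)
    also have "\<dots> \<le> C * (C / (1 + t\<^sup>2))" by (intro mult_left_mono C)
    finally show ?thesis by (simp add: power2_eq_square)
  qed (simp add: weight_def)
  have int_q: "integrable lborel (\<lambda>t. \<bar>weight t\<bar> * q t)"
  proof (rule Bochner_Integration.integrable_bound)
    show "integrable lborel (\<lambda>t::real. C\<^sup>2 * (1 / (1 + t\<^sup>2)))"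
      by (intro integrable_mult_right integrable_inverse_one_plus_square)
    show "(\<lambda>t. \<bar>weight t\<bar> * q t) \<in> borel_measurable lborel" using qm by measurable
    show "AE t in lborel. norm (\<bar>weight t\<bar> * q t) \<le> norm (C\<^sup>2 * (1 / (1 + t\<^sup>2)))"
      using qb by (intro AE_I2) (auto simp: q_def abs_mult intro: order_trans)
  qed
  have wqm: "(\<lambda>t. weight t * q t) \<in> borel_measurable lborel" using qm by measurable
  have "(\<lambda>t. \<bar>weight t * q t\<bar>) = (\<lambda>t. \<bar>weight t\<bar> * q t)" by (simp add: abs_mult q_def)
  then have "integrable lborel (\<lambda>t. weight t * q t)"
    using int_q integrable_abs_iff[OF wqm] by simp
  then show "integrable lborel (\<lambda>t. weight t * ((norm (mat_fun nprt (seg A B t)))\<^sup>2 / 2))"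
    unfolding q_def .
  have int_f: "integrable (lborel \<Otimes>\<^sub>M lborel) (case_prod f)"
  proof (rule lborel_pair.Fubini_integrable[OF fm])
    show "integrable lborel (\<lambda>t. \<integral>\<tau>. norm (case_prod f (t, \<tau>)) \<partial>lborel)"
      unfolding prod.case inner_norm by (rule int_q)
    show "AE t in lborel. integrable lborel (\<lambda>\<tau>. case_prod f (t, \<tau>))"
      using inner by (auto simp: has_bochner_integral_iff)
  qed
  have outer: "(\<integral>t. f t \<tau> \<partial>lborel) = indicator {0..} \<tau> * (\<tau> * \<kappa> \<tau>)" for \<tau>
  proof (cases "\<tau> \<ge> 0")
    case True
    define A' where "A' = A + \<tau> *\<^sub>R mat 1"
    define B' where "B' = B + \<tau> *\<^sub>R mat 1"
    have a': "eigb A' (\<lambda>i. a i + \<tau>) w" and b': "eigb B' (\<lambda>i. b i + \<tau>) u"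
      unfolding A'_def B'_def by (rule eigb_shift[OF a], rule eigb_shift[OF b])
    have pd: "positive_definite X" if X: "eigb X x v" "\<And>i. x i > 0" for X :: "complex^'n^'n" and x v
    proof -
      have "form_ge (Min (range x)) X" "Min (range x) > 0" using X(2) by (auto simp: eigb_form_ge[OF X(1)])
      then show ?thesis unfolding positive_definite_iff using eigb_hermitian[OF X(1)] by blast
    qed
    have pdA: "positive_definite A'" by (rule pd[OF a']) (intro add_pos_nonneg ap True)
    have pdB: "positive_definite B'" by (rule pd[OF b']) (intro add_pos_nonneg bp True)
    obtain s :: "'n \<Rightarrow> real" where s: "\<forall>k. s k > 0"
      "\<forall>t. tr_fun nonpos ((1 - t) *\<^sub>R A' + t *\<^sub>R B') = (\<Sum>k\<in>UNIV. nonpos ((1 - t) * s k + t))"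
      "(\<Sum>k\<in>UNIV. s k - 1) = (\<Sum>j\<in>UNIV. Re (entry u (A' - B') j j) / (b j + \<tau>))"
      "(\<Sum>k\<in>UNIV. (s k - 1)\<^sup>2) = (\<Sum>i\<in>UNIV. \<Sum>j\<in>UNIV. (cmod (entry u (A' - B') i j))\<^sup>2 / ((b i + \<tau>) * (b j + \<tau>)))"
      "(\<Sum>k\<in>UNIV. ln (s k)) = (\<Sum>i\<in>UNIV. ln (a i + \<tau>)) - (\<Sum>i\<in>UNIV. ln (b i + \<tau>))"
      using pencil_spectrum[OF pdA pdB a' b'] by blast
    \<comment> \<open>The shift cancels, so the entries of A - B serve for every \<tau>; only the
      eigenvalues move.\<close>
    have "A' - B' = A - B" by (simp add: A'_def B'_def)
    then have "\<kappa> \<tau> = (\<Sum>k\<in>UNIV. ln (s k) - (s k - 1) + (s k - 1)\<^sup>2 / 2)"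
      using s(3,4,5) unfolding \<kappa>_def sum.distrib sum_subtractf sum_divide_distrib[symmetric] c_def d_def
      by (simp only:)
    moreover have "has_bochner_integral lborel (\<lambda>t. \<tau> * (\<Sum>k\<in>UNIV. weight t * nonpos ((1 - t) * s k + t)))
        (\<tau> * (\<Sum>k\<in>UNIV. ln (s k) - (s k - 1) + (s k - 1)\<^sup>2 / 2))"
      by (intro has_bochner_integral_mult_right has_bochner_integral_sum has_bochner_integral_weight s(1)[rule_format])
    moreover have "f t \<tau> = \<tau> * (\<Sum>k\<in>UNIV. weight t * nonpos ((1 - t) * s k + t))" for t
    proof -
      have "tr_fun nonpos (seg A B t + \<tau> *\<^sub>R mat 1) = (\<Sum>k\<in>UNIV. nonpos ((1 - t) * s k + t))"
        using s(2)[rule_format, of t] unfolding A'_def B'_def seg_def[symmetric] seg_shift .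
      then show ?thesis using True by (simp add: f_def sum_distrib_left mult.left_commute)
    qed
    ultimately have "(\<integral>t. f t \<tau> \<partial>lborel) = \<tau> * \<kappa> \<tau>"
      by (simp only: has_bochner_integral_integral_eq)
    then show ?thesis using True by simp
  qed (simp add: f_def)
  have "integrable lborel (\<lambda>\<tau>. \<integral>t. f t \<tau> \<partial>lborel)"
    using lborel_pair.integrable_snd[OF int_f] by simp
  then have int_\<kappa>: "integrable lborel (\<lambda>\<tau>. indicator {0..} \<tau> * (\<tau> * \<kappa> \<tau>))" by (simp only: outer)
  have "(\<integral>t. weight t * q t \<partial>lborel) = (\<integral>t. (\<integral>\<tau>. f t \<tau> \<partial>lborel) \<partial>lborel)"
    by (intro Bochner_Integration.integral_cong refl) (rule has_bochner_integral_integral_eq[OF inner, symmetric])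
  also have "\<dots> = (\<integral>\<tau>. (\<integral>t. f t \<tau> \<partial>lborel) \<partial>lborel)"
    by (rule lborel_pair.Fubini_integral[OF int_f, symmetric])
  also have "\<dots> = (\<integral>\<tau>. indicator {0..} \<tau> * (\<tau> * \<kappa> \<tau>) \<partial>lborel)" by (simp only: outer)
  also have "\<dots> = (\<Sum>i\<in>UNIV. int_xlogx (a i)) - (\<Sum>i\<in>UNIV. int_xlogx (b i)) - (\<Sum>i\<in>UNIV. c i * xlogx (b i))
      - (\<Sum>i\<in>UNIV. \<Sum>j\<in>UNIV. d i j * dxlogx (b i) (b j)) / 2"
  proof (rule remainder_integral[OF ap bp _ _ _ int_\<kappa>])
    have idA: "mat_fun (\<lambda>x. x) A = A" and idB: "mat_fun (\<lambda>x. x) B = B"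
      by (simp_all add: mat_fun_eq[OF a] mat_fun_eq[OF b] eigb_spec[OF a, symmetric] eigb_spec[OF b, symmetric])
    have "(\<Sum>i\<in>UNIV. a i) = mat 1 \<bullet> A" "(\<Sum>i\<in>UNIV. b i) = mat 1 \<bullet> B"
      using tr_fun_eq[OF a, of "\<lambda>x. x"] tr_fun_eq[OF b, of "\<lambda>x. x"] by (simp_all add: tr_fun_def idA idB)
    moreover have "mat 1 \<bullet> (A - B) = (\<Sum>i\<in>UNIV. c i)"
    proof -
      have "mat_fun (\<lambda>_. 1) B = mat 1" by (simp add: mat_fun_eq[OF b] spec_def onb_resolution[OF on])
      then show ?thesis using mat_fun_inner[OF b, of "\<lambda>_. 1" "A - B"] by (simp add: c_def)
    qed
    ultimately show "(\<Sum>i\<in>UNIV. a i) = (\<Sum>i\<in>UNIV. b i) + (\<Sum>i\<in>UNIV. c i)" by (simp add: inner_diff_right)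
    have "(\<Sum>i\<in>UNIV. (a i)\<^sup>2) = A \<bullet> A" "(\<Sum>i\<in>UNIV. (b i)\<^sup>2) = B \<bullet> B"
      using spec_inner_self[OF eigb_onb[OF a], of "\<lambda>x. x" a "\<lambda>x. x"] spec_inner_self[OF on, of "\<lambda>x. x" b "\<lambda>x. x"]
      by (simp_all add: eigb_spec[OF a, symmetric] eigb_spec[OF b, symmetric] power2_eq_square)
    moreover have "A \<bullet> A = B \<bullet> B + 2 * (B \<bullet> (A - B)) + (A - B) \<bullet> (A - B)"
      by (simp add: inner_diff_left inner_diff_right inner_commute)
    moreover have "B \<bullet> (A - B) = (\<Sum>i\<in>UNIV. b i * c i)"
      using mat_fun_inner[OF b, of "\<lambda>x. x" "A - B"] by (simp add: c_def idB)
    moreover have "(A - B) \<bullet> (A - B) = (\<Sum>i\<in>UNIV. \<Sum>j\<in>UNIV. d i j)"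
      unfolding inner_entries[OF on] d_def power2_norm_eq_inner ..
    ultimately show "(\<Sum>i\<in>UNIV. (a i)\<^sup>2) = (\<Sum>i\<in>UNIV. (b i)\<^sup>2) + 2 * (\<Sum>i\<in>UNIV. b i * c i) + (\<Sum>i\<in>UNIV. \<Sum>j\<in>UNIV. d i j)"
      by simp
  qed (simp add: \<kappa>_def)
  also have "\<dots> = tr_fun int_xlogx A - tr_fun int_xlogx B - mat_fun xlogx B \<bullet> (A - B) - Dxlogx b u (A - B) \<bullet> (A - B) / 2"
    unfolding tr_fun_eq[OF a] tr_fun_eq[OF b] mat_fun_inner[OF b] Dxlogx_inner[OF on] d_def c_def power2_norm_eq_inner
    by (simp add: mult.commute)
  finally show "(\<integral>t. weight t * ((norm (mat_fun nprt (seg A B t)))\<^sup>2 / 2) \<partial>lborel) =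
      tr_fun int_xlogx A - tr_fun int_xlogx B - mat_fun xlogx B \<bullet> (A - B) - Dxlogx b u (A - B) \<bullet> (A - B) / 2"
    unfolding q_def .
qed


section \<open>The gradient of the trace formula\<close>

text \<open>The derivative -x_- of x_-^2 / 2 is 1-Lipschitz, although not differentiable at 0; hence
  the constant 1 / 2. For x and y of opposite signs the bound rests on x y <= 0.\<close>

lemma nprt_remainder: "\<bar>(nprt y)\<^sup>2 / 2 - (nprt x)\<^sup>2 / 2 - (- nprt x) * (y - x)\<bar> \<le> 1 / 2 * (y - x)\<^sup>2"
proof -
  have sq: "0 \<le> x * x" "0 \<le> y * y" by simp_all
  have rhs: "1 / 2 * (y - x)\<^sup>2 = x * x / 2 - x * y + y * y / 2"
    by (simp add: power2_eq_square algebra_simps)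
  have d: "0 \<le> x * x / 2 - x * y + y * y / 2"
    using rhs zero_le_power2[of "y - x"] by linarith
  show ?thesis
  proof (cases "x \<le> 0"; cases "y \<le> 0")
    assume "x \<le> 0" "\<not> y \<le> 0"
    then have "x * y \<le> 0" "nprt x = - x" "nprt y = 0" by (auto simp: nprt_def mult_nonpos_nonneg)
    moreover from this have "(nprt y)\<^sup>2 / 2 - (nprt x)\<^sup>2 / 2 - (- nprt x) * (y - x) = x * x / 2 - x * y"
      by (simp add: power2_eq_square algebra_simps)
    ultimately show ?thesis unfolding rhs using sq by linarith
  next
    assume "\<not> x \<le> 0" "y \<le> 0"
    then have "x * y \<le> 0" "nprt x = 0" "nprt y = - y" by (auto simp: nprt_def mult_nonneg_nonpos)
    moreover from this have "(nprt y)\<^sup>2 / 2 - (nprt x)\<^sup>2 / 2 - (- nprt x) * (y - x) = y * y / 2"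
      by (simp add: power2_eq_square algebra_simps)
    ultimately show ?thesis unfolding rhs using sq by linarith
  qed (use d in \<open>auto simp: nprt_def power2_eq_square algebra_simps\<close>)
qed

text \<open>On [l, m] the derivative ln w + 1 of \<open>xlogx\<close> is bounded by the stated
  constant, so \<open>xlogx\<close> is Lipschitz there; a second mean value estimate lifts this to a
  quadratic bound for its primitive.\<close>

lemma int_xlogx_remainder:
  assumes "0 < l" "x \<in> {l..m}" "y \<in> {l..m}"
  shows "\<bar>int_xlogx y - int_xlogx x - xlogx x * (y - x)\<bar> \<le> (\<bar>ln l\<bar> + \<bar>ln m\<bar> + 1) * (y - x)\<^sup>2"
proof -
  let ?K = "\<bar>ln l\<bar> + \<bar>ln m\<bar> + 1"
  have lip: "\<bar>xlogx z - xlogx x\<bar> \<le> ?K * \<bar>z - x\<bar>" if "z \<in> {l..m}" for z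
  proof -
    have "norm (xlogx z - xlogx x) \<le> ?K * norm (z - x)"
    proof (rule field_differentiable_bound[where S = "{l..m}" and f' = "\<lambda>z. ln z + 1"])
      fix w assume w: "w \<in> {l..m}"
      then show "(xlogx has_field_derivative ln w + 1) (at w within {l..m})"
        using assms(1) by (intro has_field_derivative_at_within[OF deriv_xlogx]) auto
      have "ln l \<le> ln w" "ln w \<le> ln m" using w assms(1) by auto
      then show "norm (ln w + 1) \<le> ?K" by auto
    qed (use that assms in auto)
    then show ?thesis by simp
  qed
  have "norm ((\<lambda>z. int_xlogx z - xlogx x * z) y - (\<lambda>z. int_xlogx z - xlogx x * z) x) \<le> (?K * \<bar>y - x\<bar>) * norm (y - x)"
  proof (rule field_differentiable_bound[where S = "closed_segment x y" and f' = "\<lambda>z. xlogx z - xlogx x"])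
    fix z assume z: "z \<in> closed_segment x y"
    then have zl: "z \<in> {l..m}"
      using assms by (auto simp: closed_segment_eq_real_ivl split: if_splits)
    then show "((\<lambda>z. int_xlogx z - xlogx x * z) has_field_derivative xlogx z - xlogx x) (at z within closed_segment x y)"
      using assms(1) by (auto intro!: derivative_eq_intros has_field_derivative_at_within[OF deriv_int_xlogx])
    have "\<bar>z - x\<bar> \<le> \<bar>y - x\<bar>" using z by (auto simp: closed_segment_eq_real_ivl split: if_splits)
    then have "?K * \<bar>z - x\<bar> \<le> ?K * \<bar>y - x\<bar>" by (intro mult_left_mono) auto
    then show "norm (xlogx z - xlogx x) \<le> ?K * \<bar>y - x\<bar>" using lip[OF zl] by simp
  qed auto
  then show ?thesis by (simp add: power2_eq_square algebra_simps flip: abs_mult_self_eq[of "y - x"])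
qed

lemma half_norm_nprt_remainder:
  assumes "hermitian X" "hermitian Y"
  shows "\<bar>(norm (mat_fun nprt Y))\<^sup>2 / 2 - (norm (mat_fun nprt X))\<^sup>2 / 2 + mat_fun nprt X \<bullet> (Y - X)\<bar>
    \<le> 1 / 2 * (norm (Y - X))\<^sup>2"
proof -
  obtain a u where a: "eigb X a u" by (rule spectral_theorem[OF assms(1)])
  obtain b v where b: "eigb Y b v" by (rule spectral_theorem[OF assms(2)])
  have "mat_fun (\<lambda>x. - nprt x) X = - mat_fun nprt X"
    by (simp add: mat_fun_eq[OF a] spec_def sum_negf)
  then show ?thesis
    using tr_fun_remainder_bound[OF a b nprt_remainder] by (simp add: half_norm_nprt assms)
qed

text \<open>By \<open>Dxlogx_self\<close> this equals f(A) - f(B) - Df[B](A - B) with f(x) = x log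
  x. The form chosen separates one functional calculus term in A from a linear one.\<close>

definition entropy_remainder :: "('n \<Rightarrow> real) \<Rightarrow> ('n \<Rightarrow> complex^'n) \<Rightarrow> complex^'n^'n \<Rightarrow> complex^'n^'n \<Rightarrow> complex^'n^'n" where
  "entropy_remainder b u A B = mat_fun xlogx A - Dxlogx b u A + B"

lemma scalar_eq_if_quadratically_close:
  fixes m z :: real
  assumes "e0 > 0" "\<And>e. 0 < e \<Longrightarrow> e \<le> e0 \<Longrightarrow> \<bar>e * m - e * z\<bar> \<le> K * e\<^sup>2"
  shows "m = z"
proof (rule ccontr)
  assume "m \<noteq> z"
  then have p: "\<bar>m - z\<bar> > 0" by simp
  \<comment> \<open>Small enough for \<open>K * e\<close> to be at most half of the supposed
    gap.\<close>
  define e where "e = min e0 (\<bar>m - z\<bar> / (2 * (\<bar>K\<bar> + 1)))"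
  have e: "e > 0" "e \<le> e0" using p assms(1) by (auto simp: e_def)
  have "e * \<bar>m - z\<bar> \<le> K * e\<^sup>2"
    using assms(2)[OF e] e(1) by (simp add: abs_mult flip: right_diff_distrib)
  also have "\<dots> = e * (K * e)" by (simp add: power2_eq_square)
  finally have "\<bar>m - z\<bar> \<le> K * e" using e(1) by simp
  also have "\<dots> \<le> (\<bar>K\<bar> + 1) * e" using e(1) by (intro mult_right_mono) auto
  also have "\<dots> \<le> (\<bar>K\<bar> + 1) * (\<bar>m - z\<bar> / (2 * (\<bar>K\<bar> + 1)))" by (intro mult_left_mono) (auto simp: e_def)
  also have "\<dots> = \<bar>m - z\<bar> / 2" by (simp add: field_simps)
  finally show False using p by simp
qed

text \<open>Both sides of \<open>trace_formula\<close> are expanded at A in the direction X with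
  error O(e^2) for 0 < e <= e0, so their linear coefficients agree. On the integral side the
  expansion is made pointwise in t and its error is integrated.\<close>

lemma entropy_remainder_inner:
  fixes A B X :: "complex^'n^'n"
  assumes A: "positive_definite A" and B: "positive_definite B" and b: "eigb B b u" and X: "hermitian X"
  shows "integral\<^sup>L lborel (frenkel_integrand A B) \<bullet> X = entropy_remainder b u A B \<bullet> X"
proof -
  obtain \<alpha> where \<alpha>: "\<alpha> > 0" "form_ge \<alpha> A" using A by (auto simp: positive_definite_iff)
  obtain \<beta> where \<beta>: "\<beta> > 0" "form_ge \<beta> B" using B by (auto simp: positive_definite_iff)
  have hA: "hermitian A" and hB: "hermitian B" using A B by (auto simp: positive_definite_iff)
  have A0: "form_ge 0 A" using form_ge_mono[OF \<alpha>(2)] \<alpha>(1) by simp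
  note on = eigb_onb[OF b]
  \<comment> \<open>Keeps A + e X above \<alpha> / 2, so that the trace formula applies to it and
    the logarithms of its eigenvalues stay bounded.\<close>
  define e0 where "e0 = \<alpha> / (2 * (norm X + 1))"
  have e0: "e0 > 0" using \<alpha>(1) by (simp add: e0_def add_nonneg_pos)
  have e0X: "e0 * norm X \<le> \<alpha> / 2"
  proof -
    have "e0 * norm X \<le> e0 * (norm X + 1)" using e0 by (intro mult_left_mono) auto
    also have "\<dots> = \<alpha> / 2" using add_nonneg_pos[OF norm_ge_zero[of X], of 1] by (simp add: e0_def field_simps)
    finally show ?thesis .
  qed
  define m where "m = norm A + \<alpha>"
  \<comment> \<open>A margin valid for A and all A + e X at once. Within it every negative part
    vanishes, which matters because the remainder is estimated with 1 / (|t| |t - 1|), not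
    integrable at 0 or 1.\<close>
  define \<mu> where "\<mu> = min (\<alpha> / 2 / (norm B + 1)) (\<beta> / (m + 1))"
  have m0: "m > 0" using \<alpha>(1) by (simp add: m_def add_nonneg_pos)
  have \<mu>: "\<mu> > 0" using \<alpha>(1) \<beta>(1) m0 by (simp add: \<mu>_def add_nonneg_pos)
  define k where "k = 2 * (1 + 1 / \<mu>)"
  define K1 where "K1 = (norm X)\<^sup>2 * k / 2 * (\<integral>t. 1 / (1 + t\<^sup>2) \<partial>lborel)"
  define K2 where "K2 = (\<bar>ln (\<alpha> / 2)\<bar> + \<bar>ln m\<bar> + 1) * (norm X)\<^sup>2 + \<bar>Dxlogx b u X \<bullet> X\<bar> / 2"
  define q where "q = (\<lambda>A t. (norm (mat_fun nprt (seg A B t)))\<^sup>2 / 2)"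
  define \<Psi> where "\<Psi> = (\<lambda>A. tr_fun int_xlogx A - tr_fun int_xlogx B - mat_fun xlogx B \<bullet> (A - B)
      - Dxlogx b u (A - B) \<bullet> (A - B) / 2)"
  have zero: "mat_fun nprt (seg A' B t) = 0"
    if "hermitian A'" "form_ge (\<alpha> / 2) A'" "norm A' \<le> m" "- \<mu> \<le> t" "t \<le> 1 + \<mu>" for A' t
  proof (rule nprt_seg_eq_0[OF that(1,2) _ hB \<beta>(2)])
    have "\<beta> / (m + 1) \<le> \<beta> / (norm A' + 1)"
      using that(3) \<beta>(1) m0 by (intro divide_left_mono mult_pos_pos) (auto intro: add_nonneg_pos)
    then show "t \<le> 1 + \<beta> / (norm A' + 1)" using that(5) by (auto simp: \<mu>_def)
    show "- (\<alpha> / 2 / (norm B + 1)) \<le> t" using that(4) by (auto simp: \<mu>_def)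
  qed (use \<alpha>(1) \<beta>(1) in auto)
  have fint: "integrable lborel (frenkel_integrand A B)"
    by (rule frenkel_integrable[OF hA A0 hB \<beta>(2,1)])
  have "\<bar>e * (integral\<^sup>L lborel (frenkel_integrand A B) \<bullet> X) - e * (entropy_remainder b u A B \<bullet> X)\<bar> \<le> (K1 + K2) * e\<^sup>2"
    if e: "0 < e" "e \<le> e0" for e
  proof -
    define A' where "A' = A + e *\<^sub>R X"
    have hA': "hermitian A'" unfolding A'_def by (intro hermitian_add hermitian_scaleR hA X)
    have eX: "norm (e *\<^sub>R X) \<le> \<alpha> / 2"
    proof -
      have "norm (e *\<^sub>R X) = e * norm X" using e(1) by simp
      then show ?thesis using mult_right_mono[OF e(2) norm_ge_zero[of X]] e0X by linarith
    qed
    have "A' - A = e *\<^sub>R X" by (simp add: A'_def)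
    then have gA': "form_ge (\<alpha> / 2) A'"
      using form_ge_mono[OF form_ge_perturb[OF \<alpha>(2), of A'], of "\<alpha> / 2"] eX by simp
    have nA': "norm A' \<le> m"
      using norm_triangle_ineq[of A "e *\<^sub>R X"] eX \<alpha>(1) by (simp add: A'_def m_def)
    have nA: "norm A \<le> m" using \<alpha>(1) by (simp add: m_def)
    have gA: "form_ge (\<alpha> / 2) A" using form_ge_mono[OF \<alpha>(2)] \<alpha>(1) by simp
    have pA': "positive_definite A'"
      unfolding positive_definite_iff using hA' gA' \<alpha>(1) by (intro conjI exI[of _ "\<alpha> / 2"]) auto
    define r where "r = (\<lambda>t. weight t * (q A' t - q A t + mat_fun nprt (seg A B t) \<bullet> (seg A' B t - seg A B t)))"
    have dseg: "seg A' B t - seg A B t = ((1 - t) * e) *\<^sub>R X" for t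
      by (simp add: seg_def A'_def algebra_simps)
    have r_eq: "r t = weight t * q A' t - weight t * q A t - e * (frenkel_integrand A B t \<bullet> X)" for t
      by (simp add: r_def dseg frenkel_integrand_eq[OF hA hB] fweight_eq algebra_simps)
    note i1 = trace_formula(2)[OF pA' B b] and i2 = trace_formula(2)[OF A B b]
    have i3: "integrable lborel (\<lambda>t. e * (frenkel_integrand A B t \<bullet> X))"
      by (intro integrable_mult_right integrable_inner_left fint)
    have rint: "integrable lborel r"
      unfolding r_eq[abs_def] q_def
      by (rule Bochner_Integration.integrable_diff[OF Bochner_Integration.integrable_diff[OF i1 i2] i3])
    have "integral\<^sup>L lborel r = \<Psi> A' - \<Psi> A - (\<integral>t. e * (frenkel_integrand A B t \<bullet> X) \<partial>lborel)"
      unfolding r_eq[abs_def] q_def \<Psi>_def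
      by (simp only: Bochner_Integration.integral_diff[OF Bochner_Integration.integrable_diff[OF i1 i2] i3]
          Bochner_Integration.integral_diff[OF i1 i2] trace_formula(1)[OF A B b] trace_formula(1)[OF pA' B b])
    then have int_r: "integral\<^sup>L lborel r = \<Psi> A' - \<Psi> A - e * (integral\<^sup>L lborel (frenkel_integrand A B) \<bullet> X)"
      using fint by simp
    have rb: "norm (r t) \<le> (norm X)\<^sup>2 * k / 2 * e\<^sup>2 * (1 / (1 + t\<^sup>2))" for t
    proof (cases "- \<mu> \<le> t \<and> t \<le> 1 + \<mu>")
      case True
      have "1 + t\<^sup>2 > 0" by (intro add_pos_nonneg) auto
      moreover have "r t = 0"
        using zero[OF hA' gA' nA', of t] zero[OF hA gA nA, of t] True by (simp add: r_def q_def)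
      ultimately show ?thesis using \<mu> by (simp add: k_def)
    next
      case False
      then have t: "t < - \<mu> \<or> t > 1 + \<mu>" by auto
      have "norm (r t) \<le> \<bar>weight t\<bar> * (1 / 2 * (norm (seg A' B t - seg A B t))\<^sup>2)"
        unfolding r_def q_def real_norm_def abs_mult[of "weight t"]
        by (intro mult_left_mono half_norm_nprt_remainder hermitian_seg hA hA' hB) auto
      also have "\<dots> = (norm X)\<^sup>2 * e\<^sup>2 / 2 * (\<bar>weight t\<bar> * \<bar>t - 1\<bar>\<^sup>2)"
        by (simp add: dseg power_mult_distrib power2_commute[of 1 t])
      also have "\<bar>weight t\<bar> * \<bar>t - 1\<bar>\<^sup>2 = 1 / (\<bar>t\<bar> * \<bar>t - 1\<bar>)"
        using t \<mu> by (auto simp: weight_def abs_mult power_abs power2_eq_square power3_eq_cube)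
      also have "(norm X)\<^sup>2 * e\<^sup>2 / 2 * (1 / (\<bar>t\<bar> * \<bar>t - 1\<bar>)) \<le> (norm X)\<^sup>2 * e\<^sup>2 / 2 * (k / (1 + t\<^sup>2))"
        unfolding k_def by (intro mult_left_mono inverse_product_bound \<mu> t) auto
      finally show ?thesis by (simp add: algebra_simps)
    qed
    have "\<bar>integral\<^sup>L lborel r\<bar> \<le> (\<integral>t. norm (r t) \<partial>lborel)"
      using integral_norm_bound[of lborel r] by simp
    also have "\<dots> \<le> (\<integral>t. (norm X)\<^sup>2 * k / 2 * e\<^sup>2 * (1 / (1 + t\<^sup>2)) \<partial>lborel)"
      by (intro integral_mono integrable_norm rint integrable_mult_right integrable_inverse_one_plus_square rb)
    also have "\<dots> = K1 * e\<^sup>2" unfolding integral_mult_right_zero K1_def by simp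
    finally have 1: "\<bar>\<Psi> A' - \<Psi> A - e * (integral\<^sup>L lborel (frenkel_integrand A B) \<bullet> X)\<bar> \<le> K1 * e\<^sup>2"
      by (simp only: int_r)
    obtain a w where a: "eigb A a w" by (rule spectral_theorem[OF hA])
    obtain a' w' where a': "eigb A' a' w'" by (rule spectral_theorem[OF hA'])
    have "a i \<in> {\<alpha> / 2..m}" "a' i \<in> {\<alpha> / 2..m}" for i
      using gA gA' nA nA' eigb_abs_le[OF a, of i] eigb_abs_le[OF a', of i] by (auto simp: eigb_form_ge[OF a] eigb_form_ge[OF a'])
    then have F: "\<bar>tr_fun int_xlogx A' - tr_fun int_xlogx A - mat_fun xlogx A \<bullet> (A' - A)\<bar>
        \<le> (\<bar>ln (\<alpha> / 2)\<bar> + \<bar>ln m\<bar> + 1) * (norm (A' - A))\<^sup>2"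
      using \<alpha>(1) by (intro tr_fun_remainder_bound[OF a a'] int_xlogx_remainder) auto
    \<comment> \<open>Symmetry of \<open>Dxlogx\<close> merges the two cross terms, so half of the
      quadratic form has gradient Df[B](A - B).\<close>
    have quad: "Dxlogx b u (A' - B) \<bullet> (A' - B) = Dxlogx b u (A - B) \<bullet> (A - B)
        + 2 * e * (Dxlogx b u (A - B) \<bullet> X) + e\<^sup>2 * (Dxlogx b u X \<bullet> X)"
    proof -
      have "Dxlogx b u (C + e *\<^sub>R X) \<bullet> (C + e *\<^sub>R X) =
          Dxlogx b u C \<bullet> C + 2 * e * (Dxlogx b u C \<bullet> X) + e\<^sup>2 * (Dxlogx b u X \<bullet> X)" for C
        using Dxlogx_sym[OF on, of b X C]
        by (simp add: Dxlogx_add Dxlogx_scaleR inner_add_left inner_add_right power2_eq_square algebra_simps)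
      moreover have "A' - B = (A - B) + e *\<^sub>R X" by (simp add: A'_def)
      ultimately show ?thesis by (simp only:)
    qed
    have Z: "entropy_remainder b u A B \<bullet> X = mat_fun xlogx A \<bullet> X - mat_fun xlogx B \<bullet> X - Dxlogx b u (A - B) \<bullet> X"
      by (simp add: entropy_remainder_def Dxlogx_diff Dxlogx_self[OF b] inner_diff_left inner_add_left)
    have "\<Psi> A' - \<Psi> A - e * (entropy_remainder b u A B \<bullet> X) =
        (tr_fun int_xlogx A' - tr_fun int_xlogx A - mat_fun xlogx A \<bullet> (A' - A)) - e\<^sup>2 * (Dxlogx b u X \<bullet> X) / 2"
      unfolding \<Psi>_def quad Z by (simp add: A'_def inner_diff_right inner_add_right add_divide_distrib diff_divide_distrib algebra_simps)
    also have "\<bar>\<dots>\<bar> \<le> (\<bar>ln (\<alpha> / 2)\<bar> + \<bar>ln m\<bar> + 1) * (norm (A' - A))\<^sup>2 + e\<^sup>2 * \<bar>Dxlogx b u X \<bullet> X\<bar> / 2"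
      using F abs_triangle_ineq4[of "tr_fun int_xlogx A' - tr_fun int_xlogx A - mat_fun xlogx A \<bullet> (A' - A)" "e\<^sup>2 * (Dxlogx b u X \<bullet> X) / 2"]
      by (simp add: abs_mult)
    also have "\<dots> = K2 * e\<^sup>2"
      by (simp add: K2_def A'_def power_mult_distrib algebra_simps)
    finally have 2: "\<bar>\<Psi> A' - \<Psi> A - e * (entropy_remainder b u A B \<bullet> X)\<bar> \<le> K2 * e\<^sup>2" .
    show ?thesis using 1 2 unfolding distrib_right by linarith
  qed
  then show ?thesis by (rule scalar_eq_if_quadratically_close[OF e0])
qed

section \<open>From the gradient to the matrix identity\<close>

lemma bounded_linear_cadjoint: "bounded_linear (cadjoint :: complex^'n^'n \<Rightarrow> _)"
proof -
  have "linear (cadjoint :: complex^'n^'n \<Rightarrow> _)" by (rule linearI) simp_all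
  then show ?thesis by (simp add: linear_conv_bounded_linear)
qed

lemma hermitian_integral:
  fixes f :: "real \<Rightarrow> complex^'n^'n"
  assumes "integrable lborel f" "\<And>t. hermitian (f t)"
  shows "hermitian (integral\<^sup>L lborel f)"
  unfolding hermitian_def integral_bounded_linear[OF bounded_linear_cadjoint assms(1), symmetric]
    assms(2)[unfolded hermitian_def] ..

lemma hermitian_mat_fun: "hermitian X \<Longrightarrow> hermitian (mat_fun g X)"
  by (erule spectral_theorem) (simp add: mat_fun_eq hermitian_spec)

text \<open>The gradient identity is available in Hermitian directions. The difference of the two
  sides is itself Hermitian, so it may be taken as the direction, and its squared norm is then
  zero.\<close>

lemma frenkel_integral_positive_definite:
  fixes A B :: "complex^'n^'n"
  assumes A: "positive_definite A" and B: "positive_definite B" and b: "eigb B b u"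
  shows "integral\<^sup>L lborel (frenkel_integrand A B) = entropy_remainder b u A B"
proof -
  obtain \<alpha> where \<alpha>: "\<alpha> > 0" "form_ge \<alpha> A" using A by (auto simp: positive_definite_iff)
  obtain \<beta> where \<beta>: "\<beta> > 0" "form_ge \<beta> B" using B by (auto simp: positive_definite_iff)
  have hA: "hermitian A" and hB: "hermitian B" using A B by (auto simp: positive_definite_iff)
  have A0: "form_ge 0 A" using form_ge_mono[OF \<alpha>(2)] \<alpha>(1) by simp
  have "hermitian (frenkel_integrand A B t)" for t
    unfolding frenkel_integrand_eq[OF hA hB] by (intro hermitian_scaleR hermitian_mat_fun hermitian_seg hA hB)
  then have "hermitian (integral\<^sup>L lborel (frenkel_integrand A B))"
    by (rule hermitian_integral[OF frenkel_integrable[OF hA A0 hB \<beta>(2,1)]])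
  moreover have "hermitian (entropy_remainder b u A B)"
    unfolding entropy_remainder_def
    by (intro hermitian_add hermitian_diff hermitian_mat_fun hermitian_Dxlogx hA hB)
  ultimately have "hermitian (integral\<^sup>L lborel (frenkel_integrand A B) - entropy_remainder b u A B)"
    by (rule hermitian_diff)
  from entropy_remainder_inner[OF A B b this]
  have "(integral\<^sup>L lborel (frenkel_integrand A B) - entropy_remainder b u A B) \<bullet>
      (integral\<^sup>L lborel (frenkel_integrand A B) - entropy_remainder b u A B) = 0"
    by (simp only: inner_diff_left)
  then show ?thesis by simp
qed

section \<open>Passage to singular matrices\<close>

text \<open>At a = 0 the limit of x ln x is 0, which is the value \<open>xlogx\<close> takes
  there.\<close>

lemma tendsto_xlogx_shift:
  assumes "a \<ge> 0"
  shows "(\<lambda>n. xlogx (a + inverse (real (Suc n)))) \<longlonglongrightarrow> xlogx a"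
proof (cases "a = 0")
  case True
  have "(\<lambda>n. inverse (real (Suc n)) * ln (inverse (real (Suc n)))) \<longlonglongrightarrow> 0" by real_asymp
  then show ?thesis by (simp add: True xlogx_def)
next
  case False
  then have "isCont xlogx a" using DERIV_isCont[OF deriv_xlogx, of a] assms by simp
  moreover have "(\<lambda>n. a + inverse (real (Suc n))) \<longlonglongrightarrow> a + 0"
    by (intro tendsto_add tendsto_const LIMSEQ_inverse_real_of_nat)
  ultimately show ?thesis using isCont_tendsto_compose[of a xlogx] by simp
qed

text \<open>A and its shifts share the eigenbasis \<open>w\<close>, so the functional calculus term
  converges eigenvalue by eigenvalue although x log x has unbounded slope at 0; the coefficients of
  \<open>Dxlogx b u\<close> come from B alone, so that term is linear in A. The integrals converge
  under a common majorant.\<close>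

lemma frenkel_integral:
  fixes A B :: "complex^'n^'n"
  assumes A: "positive_semidefinite A" and B: "positive_definite B" and b: "eigb B b u"
  shows "integral\<^sup>L lborel (frenkel_integrand A B) = entropy_remainder b u A B"
proof -
  obtain \<beta> where \<beta>: "\<beta> > 0" "form_ge \<beta> B" using B by (auto simp: positive_definite_iff)
  have hA: "hermitian A" and A0: "form_ge 0 A" and hB: "hermitian B"
    using A B by (auto simp: positive_definite_iff positive_semidefinite_iff)
  obtain a w where a: "eigb A a w" by (rule spectral_theorem[OF hA])
  have a0: "a i \<ge> 0" for i using A0 eigb_form_ge[OF a] by blast
  define \<delta> where "\<delta> = (\<lambda>n. inverse (real (Suc n)))"
  define A' where "A' = (\<lambda>n. A + \<delta> n *\<^sub>R mat 1)"
  have \<delta>: "0 < \<delta> n" "\<delta> n \<le> 1" for n by (auto simp: \<delta>_def field_simps)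
  have \<delta>0: "\<delta> \<longlonglongrightarrow> 0" unfolding \<delta>_def by (rule LIMSEQ_inverse_real_of_nat)
  have a': "eigb (A' n) (\<lambda>i. a i + \<delta> n) w" for n unfolding A'_def by (rule eigb_shift[OF a])
  have hA': "hermitian (A' n)" for n by (rule eigb_hermitian[OF a'])
  have gA': "form_ge (\<delta> n) (A' n)" for n unfolding eigb_form_ge[OF a'] using a0 by simp
  have pA': "positive_definite (A' n)" for n
    unfolding positive_definite_iff using hA' gA' \<delta> by blast
  have gA0: "form_ge 0 (A' n)" for n using form_ge_mono[OF gA'] \<delta> less_imp_le by blast
  \<comment> \<open>Norm bound for the whole sequence, from \<open>\<delta> n \<le> 1\<close>; it
    fixes one majorant for all n.\<close>
  define r where "r = norm A + norm (mat 1 :: complex^'n^'n)"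
  have nA': "norm (A' n) \<le> r" for n
  proof -
    have "norm (\<delta> n *\<^sub>R mat 1 :: complex^'n^'n) \<le> norm (mat 1 :: complex^'n^'n)"
      using \<delta>[of n] by (simp add: mult_left_le_one_le)
    then show ?thesis unfolding A'_def r_def by (intro norm_triangle_le) simp
  qed
  obtain C where C: "0 \<le> C"
    "\<And>A t. hermitian A \<Longrightarrow> form_ge 0 A \<Longrightarrow> norm A \<le> r \<Longrightarrow> norm (frenkel_integrand A B t) \<le> C / (1 + t\<^sup>2)"
    using frenkel_bounds[OF hB \<beta>(2,1), of r] by metis
  have A'_lim: "A' \<longlonglongrightarrow> A"
  proof -
    have "A' \<longlonglongrightarrow> A + 0 *\<^sub>R mat 1" unfolding A'_def by (intro tendsto_intros \<delta>0)
    then show ?thesis by simp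
  qed
  have "(\<lambda>n. integral\<^sup>L lborel (frenkel_integrand (A' n) B)) \<longlonglongrightarrow> integral\<^sup>L lborel (frenkel_integrand A B)"
  proof (rule integral_dominated_convergence)
    show "integrable lborel (\<lambda>t::real. C * (1 / (1 + t\<^sup>2)))"
      by (intro integrable_mult_right integrable_inverse_one_plus_square)
    show "AE t in lborel. norm (frenkel_integrand (A' n) B t) \<le> C * (1 / (1 + t\<^sup>2))" for n
      using C(2)[OF hA' gA0 nA'] by (intro AE_I2) simp
    show "AE t in lborel. (\<lambda>n. frenkel_integrand (A' n) B t) \<longlonglongrightarrow> frenkel_integrand A B t"
    proof (intro AE_I2)
      fix t
      have "(\<lambda>n. seg (A' n) B t) \<longlonglongrightarrow> seg A B t"
        unfolding seg_def by (intro tendsto_intros A'_lim)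
      then have lim: "(\<lambda>n. 1 * norm (seg (A' n) B t - seg A B t)) \<longlonglongrightarrow> 0"
        by (simp add: tendsto_norm_zero LIM_zero)
      have "norm (norm (mat_fun nprt (seg (A' n) B t) - mat_fun nprt (seg A B t))) \<le> 1 * norm (seg (A' n) B t - seg A B t)" for n
        unfolding real_norm_def abs_norm_cancel
        by (rule mat_fun_lipschitz[OF hermitian_seg[OF hA hB] hermitian_seg[OF hA' hB] nprt_lipschitz]) simp
      then have "(\<lambda>n. norm (mat_fun nprt (seg (A' n) B t) - mat_fun nprt (seg A B t))) \<longlonglongrightarrow> 0"
        by (rule Lim_null_comparison[OF always_eventually[OF allI] lim])
      then have "(\<lambda>n. mat_fun nprt (seg (A' n) B t)) \<longlonglongrightarrow> mat_fun nprt (seg A B t)"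
        by (rule LIM_zero_cancel[OF tendsto_norm_zero_cancel])
      then show "(\<lambda>n. frenkel_integrand (A' n) B t) \<longlonglongrightarrow> frenkel_integrand A B t"
        unfolding frenkel_integrand_eq[OF hA hB] frenkel_integrand_eq[OF hA' hB] by (intro tendsto_intros)
    qed
  qed (use frenkel_measurable hA hA' hB in auto)
  moreover have "(\<lambda>n. entropy_remainder b u (A' n) B) \<longlonglongrightarrow> entropy_remainder b u A B"
  proof -
    have "(\<lambda>n. mat_fun xlogx (A' n)) \<longlonglongrightarrow> mat_fun xlogx A"
      unfolding mat_fun_eq[OF a] mat_fun_eq[OF a'] spec_def \<delta>_def
      by (intro tendsto_sum tendsto_scaleR tendsto_const tendsto_xlogx_shift a0)
    moreover have "(\<lambda>n. Dxlogx b u A + \<delta> n *\<^sub>R Dxlogx b u (mat 1)) \<longlonglongrightarrow> Dxlogx b u A + 0 *\<^sub>R Dxlogx b u (mat 1)"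
      by (intro tendsto_intros \<delta>0)
    then have "(\<lambda>n. Dxlogx b u (A' n)) \<longlonglongrightarrow> Dxlogx b u A"
      by (simp add: A'_def Dxlogx_add Dxlogx_scaleR)
    ultimately show ?thesis
      unfolding entropy_remainder_def by (intro tendsto_intros)
  qed
  ultimately show ?thesis
    unfolding frenkel_integral_positive_definite[OF pA' B b] by (rule LIMSEQ_unique)
qed

text \<open>The first conjunct ensures that each \<open>integral\<close> denotes a genuine value
  rather than a default. Bochner integrability of the matrix function passes to each entry by
  bounded linearity and from there to the gauge integral over the line.\<close>

theorem mainTheorem1:
  fixes A B :: "complex^'n^'n"
  assumes "positive_semidefinite A" and "positive_definite B"
  shows "(\<forall>i j. (\<lambda>t. frenkel_integrand A B t $ i $ j) integrable_on UNIV) \<and>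
    mat_xlogx A - A ** mat_log B - B ** Dlog B A + B =
      (\<chi> i j. integral UNIV (\<lambda>t. frenkel_integrand A B t $ i $ j))"
proof -
  obtain \<beta> where \<beta>: "\<beta> > 0" "form_ge \<beta> B" using assms(2) by (auto simp: positive_definite_iff)
  have hA: "hermitian A" and A0: "form_ge 0 A" and hB: "hermitian B"
    using assms by (auto simp: positive_definite_iff positive_semidefinite_iff)
  obtain b u where b: "eigb B b u" by (rule spectral_theorem[OF hB])
  have int: "integrable lborel (frenkel_integrand A B)"
    by (rule frenkel_integrable[OF hA A0 hB \<beta>(2,1)])
  have bl: "bounded_linear (\<lambda>M :: complex^'n^'n. M $ i $ j)" for i j
    using bounded_linear_compose[OF bounded_linear_vec_nth bounded_linear_vec_nth] .
  have entries: "((\<lambda>t. frenkel_integrand A B t $ i $ j) has_integral integral\<^sup>L lborel (frenkel_integrand A B) $ i $ j) UNIV" for i j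
    using has_integral_integral_lborel[OF integrable_bounded_linear[OF bl int]] integral_bounded_linear[OF bl int] by simp
  have "mat_xlogx A = mat_fun xlogx A" by (simp add: mat_xlogx_def xlogx_def[abs_def])
  then have "mat_xlogx A - A ** mat_log B - B ** Dlog B A + B = mat_fun xlogx A - (A ** mat_log B + B ** Dlog B A) + B"
    by simp
  also have "\<dots> = entropy_remainder b u A B"
    by (simp only: Dxlogx_eq[OF b positive_definite_eigb[OF assms(2) b] hA] entropy_remainder_def)
  also have "\<dots> = integral\<^sup>L lborel (frenkel_integrand A B)"
    by (rule frenkel_integral[OF assms b, symmetric])
  also have "\<dots> = (\<chi> i j. integral UNIV (\<lambda>t. frenkel_integrand A B t $ i $ j))"
    by (simp add: vec_eq_iff integral_unique[OF entries])
  finally show ?thesis using entries by (auto intro: has_integral_integrable)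
qed

end
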